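(* Let $W$ be the Coxeter group of type $H_3$ and let $w\in W$ be a proper quasi-Coxeter element in the conjugacy class $H_3(a_1)$. Then the interval group $G([1,w])$ is isomorphic to the Artin group of type $H_3$. Moreover, since the interval $([1,w],\preceq)$ is a lattice, $G([1,w])$ is also a Garside group.
   Context: Let $(W,R)$ be a finite Coxeter system and $T=\bigcup_{g\in W}g^{-1}Rg$ its set of reflections. The reflection length $\ell_T(g)$ is the least $k$ such that $g$ is a product of $k$ elements of $T$; a factorization of $g$ into $\ell_T(g)$ reflections is a reduced decomposition. A Coxeter element is any conjugate of the product of all elements of $R$ in some order. An element $w$ is quasi-Coxeter if it has a reduced decomposition $w=t_1\cdots t_m$ with $\langle t_1,\dots,t_m\rangle=W$; it is proper if it is not a Coxeter element. Write $x\preceq y$ if $\ell_T(y)=\ell_T(x)+\ell_T(x^{-1}y)$, and $[1,w]=\{x\in W: x\preceq w\}$. The interval group $G([1,w])$ is the group with generators $\boldsymbol{x}$ in bijection with $x\in[1,w]$ and relations $\boldsymbol{u}\boldsymbol{v}=\boldsymbol{r}$ whenever $u,v,r\in[1,w]$, $uv=r$ and $\ell_T(r)=\ell_T(u)+\ell_T(v)$. In type $H_3$ there are two conjugacy classes of proper quasi-Coxeter elements, denoted $H_3(a_1)$ and $H_3(a_2)$. The class denoted $H_3(a_2)$ is the one whose interval group has the presentation with generators $s_1,s_2,s_3$ and relations $s_1s_2s_1=s_2s_1s_2$, $s_1s_3s_1=s_3s_1s_3$, $s_2s_3s_2s_3s_2=s_3s_2s_3s_2s_3$, $s_2s_3s_2s_1s_3s_2=s_3s_2s_1s_3s_2s_3$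 and $(s_3s_2s_1)^3=(s_1s_3s_2)^3$, a group that is not isomorphic to the Artin group of type $H_3$; $H_3(a_1)$ is the other class. The Artin group of type $H_3$ is $\langle a,b,c\mid ababa=babab,\ bcb=cbc,\ ac=ca\rangle$. A Garside monoid is a cancellative monoid in which 1 is the only invertible element, in which any two elements have left and right lcms and gcds, and which has an element whose left and right divisors coincide, are finite in number and generate the monoid; a Garside group is the group of fractions of a Garside monoid. *)

theory Defs
  imports "HOL-Algebra.Multiplicative_Group" "HOL-Algebra.Generated_Groups" "HOL-Algebra.Lattice"
begin

section \<open>Group presentations\<close>

text \<open>
  A letter \<open>(x, True)\<close> stands for the generator \<open>x\<close> and \<open>(x, False)\<close> for its formal inverse.
\<close>

type_synonym 'a gword = "('a \<times> bool) list"

definition gwords :: "'a set \<Rightarrow> 'a gword set" where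
  "gwords S = lists (S \<times> UNIV)"

definition pos :: "'a list \<Rightarrow> 'a gword" where
  "pos xs = map (\<lambda>x. (x, True)) xs"

inductive word_eq :: "'a set \<Rightarrow> ('a gword \<times> 'a gword) set \<Rightarrow> 'a gword \<Rightarrow> 'a gword \<Rightarrow> bool"
  for S Q where
  refl: "u \<in> gwords S \<Longrightarrow> word_eq S Q u u"
| sym: "word_eq S Q u v \<Longrightarrow> word_eq S Q v u"
| trans: "word_eq S Q u v \<Longrightarrow> word_eq S Q v w \<Longrightarrow> word_eq S Q u w"
| cancel: "u \<in> gwords S \<Longrightarrow> v \<in> gwords S \<Longrightarrow> x \<in> S \<Longrightarrow>
    word_eq S Q (u @ [(x, b), (x, \<not> b)] @ v) (u @ v)"
| relation: "u \<in> gwords S \<Longrightarrow> v \<in> gwords S \<Longrightarrow> (l, r) \<in> Q \<Longrightarrow> l \<in> gwords S \<Longrightarrow> r \<in> gwords S \<Longrightarrow>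
    word_eq S Q (u @ l @ v) (u @ r @ v)"

definition word_class :: "'a set \<Rightarrow> ('a gword \<times> 'a gword) set \<Rightarrow> 'a gword \<Rightarrow> 'a gword set" where
  "word_class S Q u = {v. word_eq S Q u v}"

text \<open>The group with generators \<open>S\<close> and relations \<open>l = r\<close> for \<open>(l, r) \<in> Q\<close>.\<close>

definition presented_group ::
    "'a set \<Rightarrow> ('a gword \<times> 'a gword) set \<Rightarrow> 'a gword set monoid" where
  "presented_group S Q =
    \<lparr>carrier = word_class S Q ` gwords S,
     mult = (\<lambda>A B. \<Union>u\<in>A. \<Union>v\<in>B. word_class S Q (u @ v)),
     one = word_class S Q []\<rparr>"

lemma gwords_append [simp]: "u @ v \<in> gwords S \<longleftrightarrow> u \<in> gwords S \<and> v \<in> gwords S"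
  by (auto simp: gwords_def)

lemma gwords_Nil [simp]: "[] \<in> gwords S"
  by (simp add: gwords_def)

lemma gwords_Cons [simp]: "(x, b) # u \<in> gwords S \<longleftrightarrow> x \<in> S \<and> u \<in> gwords S"
  by (auto simp: gwords_def)

lemma word_eq_gwords: "word_eq S Q u v \<Longrightarrow> u \<in> gwords S \<and> v \<in> gwords S"
  by (induction rule: word_eq.induct) auto

lemma word_eq_append_left:
  assumes "word_eq S Q u v" "p \<in> gwords S"
  shows "word_eq S Q (p @ u) (p @ v)"
  using assms
proof (induction rule: word_eq.induct)
  case (cancel u v x b)
  then show ?case using word_eq.cancel[of "p @ u" S v x Q b] by simp
next
  case (relation u v l r)
  then show ?case using word_eq.relation[of "p @ u" S v l r Q] by simp
next
  case (refl u)
  then show ?case by (simp add: word_eq.refl)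
next
  case (sym u v)
  then show ?case by (simp add: word_eq.sym)
next
  case (trans u v w)
  then show ?case by (meson word_eq.trans)
qed

lemma word_eq_append_right:
  assumes "word_eq S Q u v" "p \<in> gwords S"
  shows "word_eq S Q (u @ p) (v @ p)"
  using assms
proof (induction rule: word_eq.induct)
  case (cancel u v x b)
  then show ?case using word_eq.cancel[of u S "v @ p" x Q b] by simp
next
  case (relation u v l r)
  then show ?case using word_eq.relation[of u S "v @ p" l r Q] by simp
next
  case (refl u)
  then show ?case by (simp add: word_eq.refl)
next
  case (sym u v)
  then show ?case by (simp add: word_eq.sym)
next
  case (trans u v w)
  then show ?case by (meson word_eq.trans)
qed

lemma word_eq_append:
  "word_eq S Q u u' \<Longrightarrow> word_eq S Q v v' \<Longrightarrow> word_eq S Q (u @ v) (u' @ v')"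
  by (meson word_eq.trans word_eq_append_left word_eq_append_right word_eq_gwords)

lemma word_class_eq_iff:
  assumes "u \<in> gwords S"
  shows "word_class S Q u = word_class S Q v \<longleftrightarrow> word_eq S Q u v"
proof
  assume "word_class S Q u = word_class S Q v"
  moreover have "u \<in> word_class S Q u"
    using assms by (simp add: word_class_def word_eq.refl)
  ultimately show "word_eq S Q u v"
    by (simp add: word_class_def word_eq.sym)
next
  assume uv: "word_eq S Q u v"
  have "word_eq S Q u x \<longleftrightarrow> word_eq S Q v x" for x
    using word_eq.trans[OF uv, of x] word_eq.trans[OF word_eq.sym[OF uv], of x] by iprover
  then show "word_class S Q u = word_class S Q v"
    by (simp add: word_class_def)
qed

lemma presented_group_mult:
  assumes "u \<in> gwords S" "v \<in> gwords S"
  shows "word_class S Q u \<otimes>\<^bsub>presented_group S Q\<^esub> word_class S Q v = word_class S Q (u @ v)"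
proof -
  have *: "word_class S Q (u' @ v') = word_class S Q (u @ v)"
    if "u' \<in> word_class S Q u" "v' \<in> word_class S Q v" for u' v'
  proof -
    have "word_eq S Q (u @ v) (u' @ v')"
      using that by (intro word_eq_append) (simp_all add: word_class_def)
    moreover have "u @ v \<in> gwords S"
      using assms by simp
    ultimately show ?thesis
      using word_class_eq_iff by metis
  qed
  have "u \<in> word_class S Q u" "v \<in> word_class S Q v"
    using assms by (simp_all add: word_class_def word_eq.refl)
  then have "(\<Union>u'\<in>word_class S Q u. \<Union>v'\<in>word_class S Q v. word_class S Q (u' @ v'))
      = word_class S Q (u @ v)"
    using * by blast
  then show ?thesis
    by (simp add: presented_group_def)
qed

lemma presented_group_inverse:
  assumes "u \<in> gwords S"
  shows "\<exists>v \<in> gwords S. word_eq S Q (v @ u) []"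
  using assms
proof (induction u)
  case Nil
  show ?case by (rule bexI[of _ "[]"]) (simp_all add: word_eq.refl)
next
  case (Cons a u)
  obtain x b where a: "a = (x, b)" by (cases a)
  with Cons obtain v where v: "v \<in> gwords S" "word_eq S Q (v @ u) []" by auto
  have "word_eq S Q (v @ [(x, \<not> b), (x, \<not> \<not> b)] @ u) (v @ u)"
    using Cons.prems a v by (intro word_eq.cancel) auto
  then have "word_eq S Q ((v @ [(x, \<not> b)]) @ a # u) []"
    using word_eq.trans[OF _ v(2)] a by simp
  moreover have "v @ [(x, \<not> b)] \<in> gwords S" using Cons.prems a v by auto
  ultimately show ?case by blast
qed

lemma carrier_presented_group: "carrier (presented_group S Q) = word_class S Q ` gwords S"
  and one_presented_group: "\<one>\<^bsub>presented_group S Q\<^esub> = word_class S Q []"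
  by (simp_all add: presented_group_def)

lemma group_presented_group: "group (presented_group S Q)"
proof (rule groupI)
  fix x assume "x \<in> carrier (presented_group S Q)"
  then obtain u where u: "u \<in> gwords S" "x = word_class S Q u"
    by (auto simp: carrier_presented_group)
  then show "\<one>\<^bsub>presented_group S Q\<^esub> \<otimes>\<^bsub>presented_group S Q\<^esub> x = x"
    by (simp add: one_presented_group presented_group_mult)
  obtain v where "v \<in> gwords S" "word_eq S Q (v @ u) []"
    using presented_group_inverse[OF u(1)] by metis
  then show "\<exists>y\<in>carrier (presented_group S Q).
      y \<otimes>\<^bsub>presented_group S Q\<^esub> x = \<one>\<^bsub>presented_group S Q\<^esub>"
    using u word_class_eq_iff[of "v @ u" S Q "[]"]
    by (intro bexI[of _ "word_class S Q v"])
      (simp_all add: carrier_presented_group one_presented_group presented_group_mult)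
qed (auto simp: carrier_presented_group one_presented_group presented_group_mult)


section \<open>Coxeter systems\<close>

text \<open>
  The exponent of \<open>r s\<close> in the presentation is its order in \<open>W\<close>.  Since \<open>ord\<close> is \<open>0\<close> on elements
  of infinite order, such pairs contribute only the trivial relation.
\<close>

definition coxeter_relations :: "('a, 'm) monoid_scheme \<Rightarrow> 'a set \<Rightarrow> ('a gword \<times> 'a gword) set" where
  "coxeter_relations W R =
    {(pos (concat (replicate (group.ord W (r \<otimes>\<^bsub>W\<^esub> s)) [r, s])), []) | r s. r \<in> R \<and> s \<in> R}"

definition coxeter_system :: "('a, 'm) monoid_scheme \<Rightarrow> 'a set \<Rightarrow> bool" where
  "coxeter_system W R \<longleftrightarrow>
    group W \<and> R \<subseteq> carrier W \<and>
    (\<forall>r\<in>R. r \<noteq> \<one>\<^bsub>W\<^esub> \<and> r \<otimes>\<^bsub>W\<^esub> r = \<one>\<^bsub>W\<^esub>) \<and>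
    (\<exists>\<phi> \<in> iso (presented_group R (coxeter_relations W R)) W.
       \<forall>r\<in>R. \<phi> (word_class R (coxeter_relations W R) (pos [r])) = r)"

definition type_H3 :: "('a, 'm) monoid_scheme \<Rightarrow> 'a set \<Rightarrow> bool" where
  "type_H3 W R \<longleftrightarrow>
    (\<exists>a b c. R = {a, b, c} \<and> distinct [a, b, c] \<and> group.ord W (a \<otimes>\<^bsub>W\<^esub> b) = 5 \<and>
       group.ord W (b \<otimes>\<^bsub>W\<^esub> c) = 3 \<and> group.ord W (a \<otimes>\<^bsub>W\<^esub> c) = 2)"


section \<open>Reflection length and quasi-Coxeter elements\<close>

definition list_prod :: "('a, 'm) monoid_scheme \<Rightarrow> 'a list \<Rightarrow> 'a" where
  "list_prod M xs = foldr (\<otimes>\<^bsub>M\<^esub>) xs \<one>\<^bsub>M\<^esub>"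

definition reflections :: "('a, 'm) monoid_scheme \<Rightarrow> 'a set \<Rightarrow> 'a set" where
  "reflections W R = {inv\<^bsub>W\<^esub> g \<otimes>\<^bsub>W\<^esub> r \<otimes>\<^bsub>W\<^esub> g | g r. g \<in> carrier W \<and> r \<in> R}"

definition reflection_length :: "('a, 'm) monoid_scheme \<Rightarrow> 'a set \<Rightarrow> 'a \<Rightarrow> nat" where
  "reflection_length W R g =
    (LEAST k. \<exists>ts. length ts = k \<and> set ts \<subseteq> reflections W R \<and> list_prod W ts = g)"

definition reduced_decomposition :: "('a, 'm) monoid_scheme \<Rightarrow> 'a set \<Rightarrow> 'a \<Rightarrow> 'a list \<Rightarrow> bool" where
  "reduced_decomposition W R g ts \<longleftrightarrow>
    set ts \<subseteq> reflections W R \<and> list_prod W ts = g \<and> length ts = reflection_length W R g"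

definition coxeter_element :: "('a, 'm) monoid_scheme \<Rightarrow> 'a set \<Rightarrow> 'a \<Rightarrow> bool" where
  "coxeter_element W R w \<longleftrightarrow>
    (\<exists>rs. \<exists>g\<in>carrier W. distinct rs \<and> set rs = R \<and>
       w = inv\<^bsub>W\<^esub> g \<otimes>\<^bsub>W\<^esub> list_prod W rs \<otimes>\<^bsub>W\<^esub> g)"

definition quasi_coxeter :: "('a, 'm) monoid_scheme \<Rightarrow> 'a set \<Rightarrow> 'a \<Rightarrow> bool" where
  "quasi_coxeter W R w \<longleftrightarrow>
    w \<in> carrier W \<and>
    (\<exists>ts. reduced_decomposition W R w ts \<and> generate W (set ts) = carrier W)"

definition proper_quasi_coxeter :: "('a, 'm) monoid_scheme \<Rightarrow> 'a set \<Rightarrow> 'a \<Rightarrow> bool" where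
  "proper_quasi_coxeter W R w \<longleftrightarrow> quasi_coxeter W R w \<and> \<not> coxeter_element W R w"


section \<open>Intervals and interval groups\<close>

definition abs_le :: "('a, 'm) monoid_scheme \<Rightarrow> 'a set \<Rightarrow> 'a \<Rightarrow> 'a \<Rightarrow> bool" where
  "abs_le W R x y \<longleftrightarrow>
    reflection_length W R y = reflection_length W R x + reflection_length W R (inv\<^bsub>W\<^esub> x \<otimes>\<^bsub>W\<^esub> y)"

definition interval :: "('a, 'm) monoid_scheme \<Rightarrow> 'a set \<Rightarrow> 'a \<Rightarrow> 'a set" where
  "interval W R w = {x \<in> carrier W. abs_le W R x w}"

definition interval_order :: "('a, 'm) monoid_scheme \<Rightarrow> 'a set \<Rightarrow> 'a \<Rightarrow> 'a gorder" where
  "interval_order W R w = \<lparr>carrier = interval W R w, eq = (=), le = abs_le W R\<rparr>"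

definition interval_group :: "('a, 'm) monoid_scheme \<Rightarrow> 'a set \<Rightarrow> 'a \<Rightarrow> 'a gword set monoid" where
  "interval_group W R w = presented_group (interval W R w)
    {(pos [u, v], pos [r]) | u v r.
       u \<in> interval W R w \<and> v \<in> interval W R w \<and> r \<in> interval W R w \<and> u \<otimes>\<^bsub>W\<^esub> v = r \<and>
       reflection_length W R r = reflection_length W R u + reflection_length W R v}"


section \<open>The classes \<open>H\<^sub>3(a\<^sub>1)\<close> and \<open>H\<^sub>3(a\<^sub>2)\<close> and the Artin group of type \<open>H\<^sub>3\<close>\<close>

definition H3_a2_group :: "nat gword set monoid" where
  "H3_a2_group = presented_group {1, 2, 3}
    {(pos [1, 2, 1], pos [2, 1, 2]),
     (pos [1, 3, 1], pos [3, 1, 3]),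
     (pos [2, 3, 2, 3, 2], pos [3, 2, 3, 2, 3]),
     (pos [2, 3, 2, 1, 3, 2], pos [3, 2, 1, 3, 2, 3]),
     (pos [3, 2, 1, 3, 2, 1, 3, 2, 1], pos [1, 3, 2, 1, 3, 2, 1, 3, 2])}"

text \<open>
  For \<open>(W, R)\<close> of type \<open>H\<^sub>3\<close> the proper quasi-Coxeter elements form two conjugacy classes.
  Conjugate elements have isomorphic interval groups, so the interval group distinguishes
  the class \<open>H\<^sub>3(a\<^sub>2)\<close>, and \<open>H\<^sub>3(a\<^sub>1)\<close> is what remains.
\<close>

definition H3_a2 :: "('a, 'm) monoid_scheme \<Rightarrow> 'a set \<Rightarrow> 'a set" where
  "H3_a2 W R = {w. proper_quasi_coxeter W R w \<and> interval_group W R w \<cong> H3_a2_group}"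

definition H3_a1 :: "('a, 'm) monoid_scheme \<Rightarrow> 'a set \<Rightarrow> 'a set" where
  "H3_a1 W R = {w. proper_quasi_coxeter W R w} - H3_a2 W R"

text \<open>The generators \<open>a, b, c\<close> are \<open>1, 2, 3\<close>.\<close>

definition artin_group_H3 :: "nat gword set monoid" where
  "artin_group_H3 = presented_group {1, 2, 3}
    {(pos [1, 2, 1, 2, 1], pos [2, 1, 2, 1, 2]),
     (pos [2, 3, 2], pos [3, 2, 3]),
     (pos [1, 3], pos [3, 1])}"


section \<open>Garside groups\<close>

definition left_divides :: "('a, 'm) monoid_scheme \<Rightarrow> 'a \<Rightarrow> 'a \<Rightarrow> bool" where
  "left_divides M a b \<longleftrightarrow> (\<exists>c\<in>carrier M. b = a \<otimes>\<^bsub>M\<^esub> c)"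

definition right_divides :: "('a, 'm) monoid_scheme \<Rightarrow> 'a \<Rightarrow> 'a \<Rightarrow> bool" where
  "right_divides M a b \<longleftrightarrow> (\<exists>c\<in>carrier M. b = c \<otimes>\<^bsub>M\<^esub> a)"

definition has_lcms_and_gcds :: "'a set \<Rightarrow> ('a \<Rightarrow> 'a \<Rightarrow> bool) \<Rightarrow> bool" where
  "has_lcms_and_gcds A dv \<longleftrightarrow>
    (\<forall>x\<in>A. \<forall>y\<in>A.
       (\<exists>m\<in>A. dv x m \<and> dv y m \<and> (\<forall>n\<in>A. dv x n \<and> dv y n \<longrightarrow> dv m n)) \<and>
       (\<exists>d\<in>A. dv d x \<and> dv d y \<and> (\<forall>n\<in>A. dv n x \<and> dv n y \<longrightarrow> dv n d)))"

definition garside_monoid :: "('a, 'm) monoid_scheme \<Rightarrow> bool" where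
  "garside_monoid M \<longleftrightarrow>
    monoid M \<and>
    (\<forall>x\<in>carrier M. \<forall>y\<in>carrier M. \<forall>z\<in>carrier M.
       (z \<otimes>\<^bsub>M\<^esub> x = z \<otimes>\<^bsub>M\<^esub> y \<longrightarrow> x = y) \<and> (x \<otimes>\<^bsub>M\<^esub> z = y \<otimes>\<^bsub>M\<^esub> z \<longrightarrow> x = y)) \<and>
    Units M = {\<one>\<^bsub>M\<^esub>} \<and>
    has_lcms_and_gcds (carrier M) (left_divides M) \<and>
    has_lcms_and_gcds (carrier M) (right_divides M) \<and>
    (\<exists>\<Delta>\<in>carrier M.
       {x \<in> carrier M. left_divides M x \<Delta>} = {x \<in> carrier M. right_divides M x \<Delta>} \<and>
       finite {x \<in> carrier M. left_divides M x \<Delta>} \<and>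
       (\<forall>x\<in>carrier M. \<exists>xs. set xs \<subseteq> {x \<in> carrier M. left_divides M x \<Delta>} \<and> list_prod M xs = x))"

text \<open>
  Among groups into which \<open>M\<close> embeds, the group of left fractions is characterised up to
  isomorphism by every element being of the form \<open>a\<^sup>-\<^sup>1 b\<close> with \<open>a\<close>, \<open>b\<close> in \<open>M\<close>.
\<close>

definition is_group_of_fractions :: "('g, 'm) monoid_scheme \<Rightarrow> ('a, 'n) monoid_scheme \<Rightarrow> bool" where
  "is_group_of_fractions G M \<longleftrightarrow>
    group G \<and>
    (\<exists>\<iota> \<in> hom M G. inj_on \<iota> (carrier M) \<and>
       (\<forall>g\<in>carrier G. \<exists>a\<in>carrier M. \<exists>b\<in>carrier M. g = inv\<^bsub>G\<^esub> (\<iota> a) \<otimes>\<^bsub>G\<^esub> \<iota> b))"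

text \<open>
  A monoid embeds into its group of fractions, so it is no restriction to look for \<open>M\<close> on the
  element type of \<open>G\<close>.
\<close>

definition garside_group :: "('g, 'm) monoid_scheme \<Rightarrow> bool" where
  "garside_group G \<longleftrightarrow> (\<exists>M :: 'g monoid. garside_monoid M \<and> is_group_of_fractions G M)"

end

theory Submission
  imports Defs
begin

text \<open>
  A Coxeter group \<open>W\<close> of type \<open>H\<^sub>3\<close> is \<open>A\<^sub>5 \<times> {\<plusminus>1}\<close>, and its reflections are the pairs \<open>(t, -1)\<close>
  with \<open>t\<close> an involution.  This is where the computations take place: \<open>H3_representation\<close> embeds
  the abstract group, by comparing the 120 normal forms of a coset enumeration with their images.
  Every rotation \<open>(g, 1)\<close> with \<open>g \<noteq> 1\<close> is a product of two reflections, so the reflection length can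
  be read off from the image.  A quasi-Coxeter element has the form \<open>(g, -1)\<close> with \<open>g\<close> a 3-cycle or
  a 5-cycle, since in all other cases the reflections in a shortest factorisation normalise a
  noncentral cyclic subgroup (\<open>quasi_coxeter_image\<close>).

  All 5-cycles are conjugate in \<open>S\<^sub>5\<close>, which acts on \<open>A\<^sub>5 \<times> {\<plusminus>1}\<close> and preserves the set of reflections.
  As the interval below \<open>w\<close> depends on nothing but \<open>w\<close> and the reflections, the interval of a
  5-cycle is isomorphic to that of a fixed product \<open>a c b\<close> of simple reflections.  The same holds
  for 3-cycles and one fixed product of three reflections, whose interval group turns out to be the
  group that defines the class \<open>H\<^sub>3(a\<^sub>2)\<close> (\<open>three_cycle_interval\<close>).  So an element of \<open>H\<^sub>3(a\<^sub>1)\<close> maps to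
  a 5-cycle, and \<open>five_cycle_interval\<close> settles that case.

  Both isomorphisms rest on the same description of the interval group: \<open>w\<close> has length three, all
  fifteen reflections lie below it, and the group is presented by the factorisations \<open>x y z = w\<close>
  into reflections (\<open>hom_from_factorisations\<close>).  Such a factorisation can be rotated to
  \<open>y z (w\<^sup>-\<^sup>1 x w) = w\<close>.  Playing rotations off against each other derives all factorisations, as well
  as the periodicity of conjugation by \<open>w\<close>, from the braid relations
  (\<open>artin_H3_triples_if_relations\<close>, \<open>H3_a2_triples_if_relations\<close>), and conversely the factorisations
  that share their last factor are the pentagons, triangles and squares that express braid relations.

  The interval is a lattice because no two reflections lie below two different products of two
  reflections.  For any balanced interval that is a lattice, the interval group is a Garside group
  (\<open>garside\<close>).  There the main point is that the interval monoid embeds into the group: a word over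
  the interval has a well-defined greatest divisor in the interval (its head) and a well-defined
  remainder (its tail), whence \<open>w\<close> can be cancelled, and group words can be compared as fractions
  with powers of \<open>w\<close> as denominators.  Greedy heads then give joins, first of elements of the
  interval, then of positive words and of arbitrary group elements.
\<close>

section \<open>Products of lists and presented groups\<close>

lemma list_prod_Nil [simp]: "list_prod G [] = \<one>\<^bsub>G\<^esub>"
  and list_prod_Cons [simp]: "list_prod G (x # xs) = x \<otimes>\<^bsub>G\<^esub> list_prod G xs"
  by (simp_all add: list_prod_def)

context group
begin

lemma list_prod_closed [simp]: "set xs \<subseteq> carrier G \<Longrightarrow> list_prod G xs \<in> carrier G"
  by (induction xs) auto

lemma list_prod_append:
  "set xs \<subseteq> carrier G \<Longrightarrow> set ys \<subseteq> carrier G \<Longrightarrow>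
    list_prod G (xs @ ys) = list_prod G xs \<otimes> list_prod G ys"
  by (induction xs) (auto simp: m_assoc)

lemma inv_mult_cancel [simp]:
  "x \<in> carrier G \<Longrightarrow> y \<in> carrier G \<Longrightarrow> inv x \<otimes> (x \<otimes> y) = y"
  "x \<in> carrier G \<Longrightarrow> y \<in> carrier G \<Longrightarrow> x \<otimes> (inv x \<otimes> y) = y"
  by (simp_all flip: m_assoc)

lemma conj_eq_iff:
  "\<lbrakk>x \<in> carrier G; y \<in> carrier G; g \<in> carrier G\<rbrakk> \<Longrightarrow> y = inv g \<otimes> x \<otimes> g \<longleftrightarrow> g \<otimes> y = x \<otimes> g"
  by (metis inv_closed inv_mult_cancel m_assoc m_closed)

lemma list_prod_conj:
  assumes "g \<in> carrier G" "set xs \<subseteq> carrier G"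
  shows "list_prod G (map (\<lambda>x. inv g \<otimes> x \<otimes> g) xs) = inv g \<otimes> list_prod G xs \<otimes> g"
  using assms(2) by (induction xs) (use assms(1) in \<open>auto simp: m_assoc\<close>)

end

primrec word_val :: "('g, 'm) monoid_scheme \<Rightarrow> ('a \<Rightarrow> 'g) \<Rightarrow> 'a gword \<Rightarrow> 'g" where
  "word_val H f [] = \<one>\<^bsub>H\<^esub>"
| "word_val H f (a # u) =
    (if snd a then f (fst a) else inv\<^bsub>H\<^esub> f (fst a)) \<otimes>\<^bsub>H\<^esub> word_val H f u"

lemma pos_Nil [simp]: "pos [] = []"
  and pos_Cons [simp]: "pos (x # xs) = (x, True) # pos xs"
  and pos_append [simp]: "pos (xs @ ys) = pos xs @ pos ys"
  by (simp_all add: pos_def)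

lemma pos_in_gwords [simp]: "pos xs \<in> gwords S \<longleftrightarrow> set xs \<subseteq> S"
  by (induction xs) auto

lemma word_val_pos: "word_val H f (pos xs) = list_prod H (map f xs)"
  by (induction xs) auto

context group
begin

lemma word_val_closed [simp]:
  assumes "f \<in> S \<rightarrow> carrier G" "u \<in> gwords S"
  shows "word_val G f u \<in> carrier G"
  using assms(2)
proof (induction u)
  case (Cons a u)
  then have "f (fst a) \<in> carrier G"
    using assms(1) by (cases a) auto
  with Cons show ?case by (cases a) auto
qed simp

lemma word_val_append:
  assumes "f \<in> S \<rightarrow> carrier G" "u \<in> gwords S" "v \<in> gwords S"
  shows "word_val G f (u @ v) = word_val G f u \<otimes> word_val G f v"
  using assms(2)
proof (induction u)
  case (Cons a u)
  obtain x b where a: "a = (x, b)" by (cases a)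
  have "f x \<in> carrier G"
    using Cons.prems a assms(1) by auto
  then show ?case
    using Cons a word_val_closed[OF assms(1)] assms(3) by (auto simp: m_assoc)
qed (use assms in auto)

lemma word_val_word_eq:
  assumes f: "f \<in> S \<rightarrow> carrier G"
    and rel: "\<And>l r. (l, r) \<in> Q \<Longrightarrow> l \<in> gwords S \<Longrightarrow> r \<in> gwords S \<Longrightarrow> word_val G f l = word_val G f r"
    and "word_eq S Q u v"
  shows "word_val G f u = word_val G f v"
  using assms(3)
proof (induction rule: word_eq.induct)
  case (cancel u v x b)
  then have "f x \<in> carrier G" using f by auto
  then show ?case
    using cancel f by (cases b) (simp_all add: word_val_append[OF f] word_val_closed[OF f])
next
  case (relation u v l r)
  then show ?case
    using rel by (simp add: word_val_append[OF f])
qed auto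

lemma presented_group_hom:
  assumes f: "f \<in> S \<rightarrow> carrier G"
    and rel: "\<And>l r. (l, r) \<in> Q \<Longrightarrow> l \<in> gwords S \<Longrightarrow> r \<in> gwords S \<Longrightarrow> word_val G f l = word_val G f r"
  shows "\<exists>F\<in>hom (presented_group S Q) G. \<forall>u\<in>gwords S. F (word_class S Q u) = word_val G f u"
proof -
  define F where "F A = word_val G f (SOME u. u \<in> A)" for A
  have F: "F (word_class S Q u) = word_val G f u" if "u \<in> gwords S" for u
  proof -
    have "u \<in> word_class S Q u"
      using that by (simp add: word_class_def word_eq.refl)
    then have "(SOME v. v \<in> word_class S Q u) \<in> word_class S Q u"
      by (rule someI)
    then have "word_eq S Q u (SOME v. v \<in> word_class S Q u)"
      by (simp add: word_class_def)
    from word_val_word_eq[OF f rel this] show ?thesis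
      by (simp add: F_def)
  qed
  have "F \<in> hom (presented_group S Q) G"
  proof (rule homI)
    fix x assume "x \<in> carrier (presented_group S Q)"
    then show "F x \<in> carrier G"
      by (auto simp: carrier_presented_group F word_val_closed[OF f])
  next
    fix x y assume "x \<in> carrier (presented_group S Q)" "y \<in> carrier (presented_group S Q)"
    then show "F (x \<otimes>\<^bsub>presented_group S Q\<^esub> y) = F x \<otimes> F y"
      by (auto simp: carrier_presented_group presented_group_mult F word_val_append[OF f])
  qed
  with F show ?thesis by blast
qed

end

abbreviation gen_class :: "'a set \<Rightarrow> ('a gword \<times> 'a gword) set \<Rightarrow> 'a \<Rightarrow> 'a gword set" where
  "gen_class S Q x \<equiv> word_class S Q [(x, True)]"

lemma word_class_closed [simp]:
  "u \<in> gwords S \<Longrightarrow> word_class S Q u \<in> carrier (presented_group S Q)"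
  by (simp add: carrier_presented_group)

lemma word_class_eq_word_val:
  assumes "u \<in> gwords S"
  shows "word_class S Q u = word_val (presented_group S Q) (gen_class S Q) u"
  using assms
proof (induction u)
  case Nil
  show ?case by (simp add: one_presented_group)
next
  case (Cons a u)
  interpret P: group "presented_group S Q" by (rule group_presented_group)
  obtain x b where a: "a = (x, b)" by (cases a)
  have x: "x \<in> S" and u: "u \<in> gwords S" using Cons.prems a by auto
  have "word_class S Q [(x, False)] \<otimes>\<^bsub>presented_group S Q\<^esub> gen_class S Q x
      = word_class S Q [(x, False), (x, True)]"
    using x by (simp add: presented_group_mult)
  also have "\<dots> = \<one>\<^bsub>presented_group S Q\<^esub>"
    using word_eq.cancel[of "[]" S "[]" x Q False] x
    by (simp add: one_presented_group word_class_eq_iff)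
  finally have "inv\<^bsub>presented_group S Q\<^esub> gen_class S Q x = word_class S Q [(x, False)]"
    using x by (intro P.inv_equality) auto
  moreover have "word_class S Q (a # u)
      = word_class S Q [a] \<otimes>\<^bsub>presented_group S Q\<^esub> word_class S Q u"
    using x u a by (simp add: presented_group_mult)
  ultimately show ?case
    using Cons.IH u a by (cases b) simp_all
qed

lemma word_val_relation:
  assumes "(l, r) \<in> Q" "l \<in> gwords S" "r \<in> gwords S"
  shows "word_val (presented_group S Q) (gen_class S Q) l
       = word_val (presented_group S Q) (gen_class S Q) r"
proof -
  have "word_eq S Q l r"
    using word_eq.relation[of "[]" S "[]" l r Q] assms by simp
  then show ?thesis
    using assms by (metis word_class_eq_iff word_class_eq_word_val)
qed

lemma hom_word_val:
  assumes "group K" "group H" "F \<in> hom K H" "f \<in> S \<rightarrow> carrier K" "u \<in> gwords S"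
  shows "F (word_val K f u) = word_val H (\<lambda>x. F (f x)) u"
proof -
  interpret K: group K by fact
  interpret h: group_hom K H F
    using assms by (simp add: group_hom_def group_hom_axioms_def)
  show ?thesis
    using assms(5)
  proof (induction u)
    case (Cons a u)
    obtain x b where a: "a = (x, b)" by (cases a)
    have "f x \<in> carrier K" "word_val K f u \<in> carrier K"
      using Cons.prems a assms(4) by auto
    then show ?case
      using Cons a by auto
  qed simp
qed

lemma word_val_cong:
  "u \<in> gwords S \<Longrightarrow> (\<And>x. x \<in> S \<Longrightarrow> f x = g x) \<Longrightarrow> word_val H f u = word_val H g u"
  by (induction u) auto

lemma hom_presented_group_id:
  assumes "h \<in> hom (presented_group S Q) (presented_group S Q)"
    and "\<And>x. x \<in> S \<Longrightarrow> h (gen_class S Q x) = gen_class S Q x"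
    and "A \<in> carrier (presented_group S Q)"
  shows "h A = A"
proof -
  obtain u where u: "u \<in> gwords S" "A = word_class S Q u"
    using assms(3) by (auto simp: carrier_presented_group)
  have "h A = word_val (presented_group S Q) (\<lambda>x. h (gen_class S Q x)) u"
    unfolding u(2) word_class_eq_word_val[OF u(1)]
    by (rule hom_word_val[OF group_presented_group group_presented_group assms(1) _ u(1)]) simp
  also have "\<dots> = A"
    unfolding u(2) word_class_eq_word_val[OF u(1)]
    using u(1) assms(2) by (rule word_val_cong)
  finally show ?thesis .
qed

text \<open>
  Both composites of homomorphisms between presented groups are determined by their values on
  the generators, so mutually inverse substitutions of generators suffice for an isomorphism.
\<close>

lemma presented_group_isoI:
  assumes F: "F \<in> hom (presented_group S Q) (presented_group S' Q')"
    and E: "E \<in> hom (presented_group S' Q') (presented_group S Q)"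
    and "\<And>x. x \<in> S \<Longrightarrow> E (F (gen_class S Q x)) = gen_class S Q x"
    and "\<And>y. y \<in> S' \<Longrightarrow> F (E (gen_class S' Q' y)) = gen_class S' Q' y"
  shows "presented_group S Q \<cong> presented_group S' Q'"
proof -
  have "E \<circ> F \<in> hom (presented_group S Q) (presented_group S Q)"
    "F \<circ> E \<in> hom (presented_group S' Q') (presented_group S' Q')"
    using F E hom_compose by blast+
  then have "\<forall>A\<in>carrier (presented_group S Q). (E \<circ> F) A = A"
    "\<forall>B\<in>carrier (presented_group S' Q'). (F \<circ> E) B = B"
    using assms(3,4) hom_presented_group_id[of "E \<circ> F" S Q] hom_presented_group_id[of "F \<circ> E" S' Q']
    by auto
  moreover have "F ` carrier (presented_group S Q) \<subseteq> carrier (presented_group S' Q')"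
    "E ` carrier (presented_group S' Q') \<subseteq> carrier (presented_group S Q)"
    using F E by (auto simp: hom_def)
  ultimately have "bij_betw F (carrier (presented_group S Q)) (carrier (presented_group S' Q'))"
    by (intro bij_betw_byWitness[where f' = E]) auto
  with F show ?thesis
    unfolding is_iso_def iso_def by blast
qed

section \<open>Balanced intervals\<close>

text \<open>
  The properties of reflection length that make intervals below an element balanced: a left factor
  of a shortest factorisation can be conjugated past the rest and become a right factor.
\<close>

locale length_group = group G for G (structure) +
  fixes len :: "'a \<Rightarrow> nat"
  assumes len_one: "len \<one> = 0"
    and len_eq_0: "x \<in> carrier G \<Longrightarrow> len x = 0 \<Longrightarrow> x = \<one>"
    and len_mult: "x \<in> carrier G \<Longrightarrow> y \<in> carrier G \<Longrightarrow> len (x \<otimes> y) \<le> len x + len y"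
    and len_conj: "x \<in> carrier G \<Longrightarrow> g \<in> carrier G \<Longrightarrow> len (inv g \<otimes> x \<otimes> g) = len x"
begin

definition prec :: "'a \<Rightarrow> 'a \<Rightarrow> bool" where
  "prec x y \<longleftrightarrow> len y = len x + len (inv x \<otimes> y)"

lemma le_refl [simp]: "x \<in> carrier G \<Longrightarrow> prec x x"
  by (simp add: prec_def len_one)

lemma one_le [simp]: "x \<in> carrier G \<Longrightarrow> prec \<one> x"
  by (simp add: prec_def len_one)

lemma le_trans:
  assumes "x \<in> carrier G" "y \<in> carrier G" "z \<in> carrier G" "prec x y" "prec y z"
  shows "prec x z"
proof -
  have "len (inv x \<otimes> z) \<le> len (inv x \<otimes> y) + len (inv y \<otimes> z)"
    using len_mult[of "inv x \<otimes> y" "inv y \<otimes> z"] assms by (simp add: m_assoc)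
  moreover have "len z \<le> len x + len (inv x \<otimes> z)"
    using len_mult[of x "inv x \<otimes> z"] assms by simp
  ultimately show ?thesis
    using assms(4,5) unfolding prec_def by linarith
qed

lemma le_antisym:
  assumes "x \<in> carrier G" "y \<in> carrier G" "prec x y" "prec y x"
  shows "x = y"
proof -
  have "len (inv x \<otimes> y) = 0"
    using assms(3,4) unfolding prec_def by linarith
  then have "inv x \<otimes> y = \<one>"
    using len_eq_0 assms by simp
  then show ?thesis
    using assms by (metis inv_closed inv_equality inv_inv)
qed

lemma le_len: "prec x y \<Longrightarrow> len x \<le> len y"
  by (simp add: prec_def)

lemma len_inv_mult: "prec x y \<Longrightarrow> len (inv x \<otimes> y) = len y - len x"
  by (simp add: prec_def)

lemma le_mult_iff:
  "x \<in> carrier G \<Longrightarrow> y \<in> carrier G \<Longrightarrow> prec x (x \<otimes> y) \<longleftrightarrow> len (x \<otimes> y) = len x + len y"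
  by (simp add: prec_def)

lemma le_left_cancel:
  assumes "s \<in> carrier G" "m \<in> carrier G" "n \<in> carrier G" "prec s m" "prec s n"
  shows "prec (inv s \<otimes> m) (inv s \<otimes> n) \<longleftrightarrow> prec m n"
proof -
  have "inv (inv s \<otimes> m) \<otimes> (inv s \<otimes> n) = inv m \<otimes> n"
    using assms by (simp add: inv_mult_group m_assoc)
  then show ?thesis
    using assms(4,5) by (auto simp: prec_def)
qed

end

text \<open>
  A balanced interval: conjugation invariance of the length makes the left and the right
  divisors of \<open>w\<close> agree.
\<close>

locale balanced_interval = length_group +
  fixes w
  assumes w_closed [simp]: "w \<in> carrier G"
begin

definition S :: "'a set" where
  "S = {x \<in> carrier G. prec x w}"

lemma S_carrier: "x \<in> S \<Longrightarrow> x \<in> carrier G"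
  by (simp add: S_def)

lemma S_le_w: "x \<in> S \<Longrightarrow> prec x w"
  by (simp add: S_def)

lemma one_in_S: "\<one> \<in> S" and w_in_S: "w \<in> S"
  by (simp_all add: S_def)

lemma S_downward: "x \<in> S \<Longrightarrow> y \<in> carrier G \<Longrightarrow> prec y x \<Longrightarrow> y \<in> S"
  unfolding S_def using le_trans[of y x w] by auto

lemma S_conj:
  assumes "x \<in> S" shows "inv w \<otimes> x \<otimes> w \<in> S"
proof -
  have x: "x \<in> carrier G" using assms by (rule S_carrier)
  have "inv (inv w \<otimes> x \<otimes> w) \<otimes> w = inv w \<otimes> (inv x \<otimes> w) \<otimes> w"
    using x by (simp add: inv_mult_group m_assoc)
  then have "len (inv (inv w \<otimes> x \<otimes> w) \<otimes> w) = len (inv x \<otimes> w)"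
    using len_conj[of "inv x \<otimes> w" w] x by simp
  then show ?thesis
    using S_le_w[OF assms] len_conj[of x w] x by (simp add: S_def prec_def)
qed

lemma S_conj_inv:
  assumes "x \<in> S" shows "w \<otimes> x \<otimes> inv w \<in> S"
proof -
  have x: "x \<in> carrier G" using assms by (rule S_carrier)
  have "inv (w \<otimes> x \<otimes> inv w) \<otimes> w = inv (inv w) \<otimes> (inv x \<otimes> w) \<otimes> inv w"
    using x by (simp add: inv_mult_group m_assoc)
  then have "len (inv (w \<otimes> x \<otimes> inv w) \<otimes> w) = len (inv x \<otimes> w)"
    using len_conj[of "inv x \<otimes> w" "inv w"] x by simp
  then show ?thesis
    using S_le_w[OF assms] len_conj[of x "inv w"] x by (simp add: S_def prec_def)
qed

lemma S_right_factor:
  assumes "y \<in> S" "x \<in> carrier G" "prec x y"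
  shows "inv x \<otimes> y \<in> S"
proof -
  have y: "y \<in> carrier G" using assms(1) by (rule S_carrier)
  let ?z = "inv x \<otimes> y"
  \<comment> \<open>conjugating the first factor of \<open>w = x z y'\<close> to the end leaves \<open>z\<close> in front\<close>
  have "inv ?z \<otimes> w = (inv y \<otimes> w) \<otimes> (inv w \<otimes> x \<otimes> w)"
    using assms y by (simp add: inv_mult_group m_assoc)
  then have "len (inv ?z \<otimes> w) \<le> len (inv y \<otimes> w) + len x"
    using len_mult[of "inv y \<otimes> w" "inv w \<otimes> x \<otimes> w"] len_conj[of x w] assms y by simp
  moreover have "len w \<le> len ?z + len (inv ?z \<otimes> w)"
    using len_mult[of ?z "inv ?z \<otimes> w"] assms y by simp
  ultimately have "prec ?z w"
    using S_le_w[OF assms(1)] assms(3) unfolding prec_def by linarith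
  then show ?thesis
    using assms y by (simp add: S_def)
qed

lemma complement_in_S: "x \<in> S \<Longrightarrow> inv x \<otimes> w \<in> S"
  using S_right_factor[OF w_in_S] S_carrier S_le_w by blast

text \<open>
  The domain of the partial product on \<open>S\<close>; the interval monoid and the interval group are the
  monoid and the group generated by this germ.
\<close>

definition germ :: "'a \<Rightarrow> 'a \<Rightarrow> bool" where
  "germ x y \<longleftrightarrow> x \<in> S \<and> y \<in> S \<and> x \<otimes> y \<in> S \<and> len (x \<otimes> y) = len x + len y"

lemma germI_le:
  assumes "y \<in> S" "x \<in> carrier G" "prec x y"
  shows "germ x (inv x \<otimes> y)"
  using assms S_downward[OF assms] S_right_factor[OF assms] S_carrier[OF assms(1)]
  by (simp add: germ_def prec_def)

lemma germ_le: "germ x y \<Longrightarrow> prec x (x \<otimes> y)"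
  by (simp add: germ_def prec_def S_carrier)

text \<open>
  Both sides say that the lengths of \<open>x\<close>, \<open>y\<close> and \<open>(x y)\<^sup>-\<^sup>1 w\<close> add up to that of \<open>w\<close>.
\<close>

lemma germ_iff_le_complement:
  assumes "x \<in> S" "y \<in> S"
  shows "germ x y \<longleftrightarrow> prec y (inv x \<otimes> w)"
proof -
  have xy: "x \<in> carrier G" "y \<in> carrier G" using assms S_carrier by auto
  have "len (x \<otimes> y) \<le> len x + len y"
    by (intro len_mult xy)
  moreover have "inv (x \<otimes> y) \<otimes> w = inv y \<otimes> (inv x \<otimes> w)"
    using xy by (simp add: inv_mult_group m_assoc)
  moreover have "len w = len x + len (inv x \<otimes> w)"
    using assms S_le_w prec_def by blast
  moreover have "len w \<le> len (x \<otimes> y) + len (inv (x \<otimes> y) \<otimes> w)"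
    using len_mult[of "x \<otimes> y" "inv (x \<otimes> y) \<otimes> w"] xy by simp
  ultimately show ?thesis
    unfolding germ_def using assms xy by (auto simp: S_def prec_def)
qed

lemma germ_conj:
  assumes "germ x y" shows "germ (inv w \<otimes> x \<otimes> w) (inv w \<otimes> y \<otimes> w)"
proof -
  have xy: "x \<in> carrier G" "y \<in> carrier G" using assms S_carrier by (auto simp: germ_def)
  have "(inv w \<otimes> x \<otimes> w) \<otimes> (inv w \<otimes> y \<otimes> w) = inv w \<otimes> (x \<otimes> y) \<otimes> w"
    using xy by (simp add: m_assoc)
  then show ?thesis
    using assms xy S_conj len_conj by (simp add: germ_def)
qed

abbreviation cj :: "'a \<Rightarrow> 'a" where "cj x \<equiv> inv w \<otimes> x \<otimes> w"
abbreviation ci :: "'a \<Rightarrow> 'a" where "ci x \<equiv> w \<otimes> x \<otimes> inv w"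

lemma germ_conj_inv:
  assumes "germ x y" shows "germ (ci x) (ci y)"
proof -
  have xy: "x \<in> carrier G" "y \<in> carrier G" using assms S_carrier by (auto simp: germ_def)
  have "ci x \<otimes> ci y = ci (x \<otimes> y)"
    using xy by (simp add: m_assoc)
  then show ?thesis
    using assms xy S_conj_inv len_conj[of _ "inv w"] by (simp add: germ_def)
qed

lemma germ_complement: "s \<in> S \<Longrightarrow> germ s (inv s \<otimes> w)"
  using germI_le[OF w_in_S] S_carrier S_le_w by blast

text \<open>
  Together with \<open>germ_complement\<close> this factors \<open>w\<close> both as \<open>s \<cdot> s\<^sup>-\<^sup>1 w\<close> and as \<open>s\<^sup>-\<^sup>1 w \<cdot> w\<^sup>-\<^sup>1 s w\<close>, so that in
  the interval monoid \<open>s w = w (w\<^sup>-\<^sup>1 s w)\<close>.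
\<close>

lemma germ_complement_cj:
  assumes "s \<in> S" shows "germ (inv s \<otimes> w) (cj s)"
proof -
  have s: "s \<in> carrier G" using assms S_carrier by blast
  have "inv (inv s \<otimes> w) \<otimes> w = cj s"
    using s by (simp add: inv_mult_group m_assoc)
  then show ?thesis
    using germ_complement[OF complement_in_S[OF assms]] by simp
qed

definition rels :: "('a gword \<times> 'a gword) set" where
  "rels = {(pos [u, v], pos [r]) | u v r.
     u \<in> S \<and> v \<in> S \<and> r \<in> S \<and> u \<otimes> v = r \<and> len r = len u + len v}"

abbreviation "GG \<equiv> presented_group S rels"

sublocale GG: group GG
  by (rule group_presented_group)

definition cl :: "'a list \<Rightarrow> 'a gword set" where
  "cl xs = word_class S rels (pos xs)"

lemma cl_closed [simp]: "set xs \<subseteq> S \<Longrightarrow> cl xs \<in> carrier GG"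
  by (simp add: cl_def)

lemma cl_append: "set xs \<subseteq> S \<Longrightarrow> set ys \<subseteq> S \<Longrightarrow> cl (xs @ ys) = cl xs \<otimes>\<^bsub>GG\<^esub> cl ys"
  by (simp add: cl_def presented_group_mult)

lemma cl_Cons: "x \<in> S \<Longrightarrow> set xs \<subseteq> S \<Longrightarrow> cl (x # xs) = cl [x] \<otimes>\<^bsub>GG\<^esub> cl xs"
  using cl_append[of "[x]" xs] by simp

lemma cl_Nil: "cl [] = \<one>\<^bsub>GG\<^esub>"
  by (simp add: cl_def one_presented_group)

lemma cl_germ:
  assumes "germ s t" shows "cl [s] \<otimes>\<^bsub>GG\<^esub> cl [t] = cl [s \<otimes> t]"
proof -
  have "word_eq S rels (pos [s, t]) (pos [s \<otimes> t])"
    using word_eq.relation[of "[]" S "[]" "pos [s, t]" "pos [s \<otimes> t]" rels] assms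
    by (auto simp: germ_def rels_def)
  then have "cl [s, t] = cl [s \<otimes> t]"
    using assms unfolding cl_def by (subst word_class_eq_iff) (auto simp: germ_def)
  then show ?thesis
    using assms cl_append[of "[s]" "[t]"] by (simp add: germ_def)
qed

lemma cl_one: "cl [\<one>] = \<one>\<^bsub>GG\<^esub>"
proof -
  have "germ \<one> \<one>" by (simp add: germ_def one_in_S len_one)
  then have "cl [\<one>] \<otimes>\<^bsub>GG\<^esub> cl [\<one>] = cl [\<one>]" using cl_germ[of \<one> \<one>] by simp
  then show ?thesis using one_in_S by simp
qed

end


section \<open>The greedy head of a word\<close>

locale lattice_interval = balanced_interval +
  assumes finite_S: "finite S"
    and meet_exists: "x \<in> S \<Longrightarrow> y \<in> S \<Longrightarrow>
      \<exists>m\<in>S. prec m x \<and> prec m y \<and> (\<forall>n\<in>S. prec n x \<longrightarrow> prec n y \<longrightarrow> prec n m)"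
    and join_exists: "x \<in> S \<Longrightarrow> y \<in> S \<Longrightarrow>
      \<exists>m\<in>S. prec x m \<and> prec y m \<and> (\<forall>n\<in>S. prec x n \<longrightarrow> prec y n \<longrightarrow> prec m n)"
begin

text \<open>
  The largest element of \<open>S\<close> that divides the word \<open>s t\<close>: the largest part of \<open>t\<close> that can be
  absorbed into \<open>s\<close> is the meet of \<open>t\<close> with the complement \<open>s\<^sup>-\<^sup>1 w\<close>.
\<close>

definition head2 :: "'a \<Rightarrow> 'a \<Rightarrow> 'a" where
  "head2 s t = s \<otimes> (SOME m. m \<in> S \<and> prec m (inv s \<otimes> w) \<and> prec m t \<and>
      (\<forall>n\<in>S. prec n (inv s \<otimes> w) \<longrightarrow> prec n t \<longrightarrow> prec n m))"

definition tail2 :: "'a \<Rightarrow> 'a \<Rightarrow> 'a" where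
  "tail2 s t = inv (head2 s t) \<otimes> (s \<otimes> t)"

lemma head2_props:
  assumes "s \<in> S" "t \<in> S"
  shows head2_in_S: "head2 s t \<in> S"
    and le_head2: "prec s (head2 s t)"
    and le_head2_iff: "\<And>n. n \<in> S \<Longrightarrow> prec s n \<Longrightarrow> prec n (head2 s t) \<longleftrightarrow> prec (inv s \<otimes> n) t"
proof -
  have s: "s \<in> carrier G" using assms S_carrier by auto
  define m where "m = (SOME m. m \<in> S \<and> prec m (inv s \<otimes> w) \<and> prec m t \<and>
      (\<forall>n\<in>S. prec n (inv s \<otimes> w) \<longrightarrow> prec n t \<longrightarrow> prec n m))"
  have m: "m \<in> S" "prec m (inv s \<otimes> w)" "prec m t"
    "\<And>n. n \<in> S \<Longrightarrow> prec n (inv s \<otimes> w) \<Longrightarrow> prec n t \<Longrightarrow> prec n m"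
    using someI_ex[OF meet_exists[OF complement_in_S[OF assms(1)] assms(2), unfolded Bex_def]]
    unfolding m_def by auto
  have mc: "m \<in> carrier G" using m S_carrier by auto
  have h: "head2 s t = s \<otimes> m" by (simp add: head2_def m_def)
  have "germ s m" using germ_iff_le_complement assms m by auto
  then show H: "head2 s t \<in> S" "prec s (head2 s t)"
    using h germ_le by (auto simp: germ_def)
  fix n assume n: "n \<in> S" "prec s n"
  have nc: "n \<in> carrier G" using n S_carrier by auto
  have "inv s \<otimes> n \<in> S" "prec (inv s \<otimes> n) (inv s \<otimes> w)"
    using S_right_factor[OF n(1) s n(2)]
      le_left_cancel[OF s nc w_closed n(2) S_le_w[OF assms(1)]] S_le_w[OF n(1)] by simp_all
  moreover have "prec n (head2 s t) \<longleftrightarrow> prec (inv s \<otimes> n) m"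
    using le_left_cancel[OF s nc S_carrier[OF H(1)] n(2) H(2)] h s mc by simp
  ultimately show "prec n (head2 s t) \<longleftrightarrow> prec (inv s \<otimes> n) t"
    using m(3) m(4)[of "inv s \<otimes> n"] le_trans[of "inv s \<otimes> n" m t] mc s nc S_carrier[OF assms(2)]
    by (metis inv_closed m_closed)
qed

lemma inv_mult_head2_le:
  assumes "s \<in> S" "t \<in> S" shows "prec (inv s \<otimes> head2 s t) t"
  using le_head2_iff[OF assms head2_in_S[OF assms] le_head2[OF assms]] head2_in_S[OF assms] S_carrier
  by simp

text \<open>
  The factorization \<open>s t = head2 s t \<cdot> tail2 s t\<close> moves the part \<open>s\<^sup>-\<^sup>1 head2 s t\<close> of \<open>t\<close> to the left.
\<close>

lemma head2_tail2:
  assumes "s \<in> S" "t \<in> S"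
  shows germ_head2: "germ s (inv s \<otimes> head2 s t)"
    and germ_tail2: "germ (inv s \<otimes> head2 s t) (tail2 s t)"
    and mult_tail2: "(inv s \<otimes> head2 s t) \<otimes> tail2 s t = t"
    and tail2_in_S: "tail2 s t \<in> S"
    and len_tail2: "len (head2 s t) + len (tail2 s t) = len s + len t"
proof -
  let ?h = "head2 s t"
  have c: "s \<in> carrier G" "t \<in> carrier G" "?h \<in> carrier G"
    using assms head2_in_S S_carrier by auto
  show g1: "germ s (inv s \<otimes> ?h)"
    using germI_le[OF head2_in_S[OF assms] _ le_head2[OF assms]] c by simp
  have t: "tail2 s t = inv (inv s \<otimes> ?h) \<otimes> t"
    using c by (simp add: tail2_def inv_mult_group m_assoc)
  show g2: "germ (inv s \<otimes> ?h) (tail2 s t)"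
    using germI_le[OF assms(2) _ inv_mult_head2_le[OF assms]] c t by simp
  show mt: "(inv s \<otimes> ?h) \<otimes> tail2 s t = t"
    unfolding t using c by (simp add: inv_mult_group m_assoc)
  show "tail2 s t \<in> S" using g2 by (simp add: germ_def)
  show "len ?h + len (tail2 s t) = len s + len t"
    using g1 g2 c unfolding germ_def mt by (simp add: mt)
qed

lemma head2_one [simp]: "t \<in> S \<Longrightarrow> head2 \<one> t = t"
proof -
  assume t: "t \<in> S"
  then have "prec (head2 \<one> t) t" "prec t (head2 \<one> t)"
    using inv_mult_head2_le[OF one_in_S t] le_head2_iff[OF one_in_S t t] S_carrier head2_in_S[OF one_in_S t]
    by auto
  then show ?thesis
    using le_antisym head2_in_S[OF one_in_S t] t S_carrier by auto
qed

lemma head2_w [simp]: "t \<in> S \<Longrightarrow> head2 w t = w"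
  using le_antisym[of "head2 w t" w] le_head2[OF w_in_S] head2_in_S[OF w_in_S] S_carrier S_le_w by auto

lemma tail2_one [simp]: "t \<in> S \<Longrightarrow> tail2 \<one> t = \<one>"
  and tail2_w [simp]: "t \<in> S \<Longrightarrow> tail2 w t = t"
  by (simp_all add: tail2_def S_carrier)

text \<open>
  Both sides are the largest element of \<open>S\<close> above \<open>s t\<close> whose quotient by \<open>s t\<close> divides \<open>u\<close>.
\<close>

lemma head2_assoc:
  assumes "germ s t" "u \<in> S"
  shows "head2 s (head2 t u) = head2 (s \<otimes> t) u"
proof -
  have st: "s \<in> S" "t \<in> S" "s \<otimes> t \<in> S" "prec s (s \<otimes> t)"
    using assms germ_le by (auto simp: germ_def)
  have c: "s \<in> carrier G" "t \<in> carrier G" "u \<in> carrier G"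
    using st assms S_carrier by auto
  let ?A = "head2 (s \<otimes> t) u" and ?T = "head2 t u" and ?B = "head2 s (head2 t u)"
  have T: "?T \<in> S" "prec t ?T" using head2_in_S le_head2 st assms by auto
  have A: "?A \<in> S" "prec (s \<otimes> t) ?A" using head2_in_S le_head2 st assms by auto
  have B: "?B \<in> S" "prec s ?B" using head2_in_S le_head2 st T by auto
  have cc: "?A \<in> carrier G" "?B \<in> carrier G" "?T \<in> carrier G" using A B T S_carrier by auto
  have inv3: "inv t \<otimes> (inv s \<otimes> x) = inv (s \<otimes> t) \<otimes> x" if "x \<in> carrier G" for x
    using that c by (simp add: inv_mult_group m_assoc)
  have div: "prec t (inv s \<otimes> x)" if "x \<in> carrier G" "prec s x" "prec (s \<otimes> t) x" for x
    using le_left_cancel[of s "s \<otimes> t" x] that c st by simp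
  have sA: "prec s ?A" using le_trans[OF c(1) _ cc(1) st(4) A(2)] c by simp
  have "prec (inv s \<otimes> ?A) ?T"
    using le_head2_iff[OF st(2) assms(2), of "inv s \<otimes> ?A"] div[OF cc(1) sA A(2)] inv3[OF cc(1)]
      inv_mult_head2_le[OF st(3) assms(2)] S_right_factor[OF A(1) c(1) sA] by simp
  then have AB: "prec ?A ?B"
    using le_head2_iff[OF st(1) T(1) A(1) sA] by simp
  have stB: "prec (s \<otimes> t) ?B"
    using le_head2_iff[OF st(1) T(1) st(3,4)] T c by simp
  have "prec (inv t \<otimes> (inv s \<otimes> ?B)) u"
    using le_head2_iff[OF st(2) assms(2), of "inv s \<otimes> ?B"] div[OF cc(2) B(2) stB]
      inv_mult_head2_le[OF st(1) T(1)] S_right_factor[OF B(1) c(1) B(2)] by simp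
  then have "prec ?B ?A"
    using le_head2_iff[OF st(3) assms(2) B(1) stB] inv3[OF cc(2)] by simp
  then show ?thesis
    using AB le_antisym cc by blast
qed

text \<open>
  The word \<open>s t u\<close> and the word \<open>(s t) u\<close> have the same head, so what remains of them in the group
  agrees as well; lengths add up because each splitting preserves the total length.
\<close>

lemma germ_tail2_tail2:
  assumes "germ s t" "u \<in> S"
  shows "germ (tail2 s (head2 t u)) (tail2 t u)"
    and "tail2 s (head2 t u) \<otimes> tail2 t u = tail2 (s \<otimes> t) u"
proof -
  have st: "s \<in> S" "t \<in> S" "s \<otimes> t \<in> S" "len (s \<otimes> t) = len s + len t"
    using assms by (auto simp: germ_def)
  have T: "head2 t u \<in> S" using head2_in_S st assms by auto
  have c: "s \<in> carrier G" "t \<in> carrier G" "u \<in> carrier G" "head2 t u \<in> carrier G"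
    "head2 (s \<otimes> t) u \<in> carrier G"
    using st assms T head2_in_S S_carrier by auto
  show *: "tail2 s (head2 t u) \<otimes> tail2 t u = tail2 (s \<otimes> t) u"
    using c by (simp add: tail2_def head2_assoc[OF assms] m_assoc)
  show "germ (tail2 s (head2 t u)) (tail2 t u)"
    using len_tail2[OF st(1) T] len_tail2[OF st(2) assms(2)] len_tail2[OF st(3) assms(2)] st
      tail2_in_S[OF st(1) T] tail2_in_S[OF st(2) assms(2)] tail2_in_S[OF st(3) assms(2)]
    unfolding germ_def * by (simp add: head2_assoc[OF assms])
qed


primrec head_word :: "'a list \<Rightarrow> 'a" where
  "head_word [] = \<one>"
| "head_word (s # v) = head2 s (head_word v)"

primrec tail_word :: "'a list \<Rightarrow> 'a list" where
  "tail_word [] = []"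
| "tail_word (s # v) = tail2 s (head_word v) # tail_word v"

text \<open>
  The congruence of the interval monoid on words over \<open>S\<close>.  The germ only yields \<open>1 \<cdot> 1 = 1\<close>, which in a
  monoid does not remove the letter \<open>1\<close>, hence the last rule.
\<close>

inductive meq :: "'a list \<Rightarrow> 'a list \<Rightarrow> bool" where
  meq_refl: "set u \<subseteq> S \<Longrightarrow> meq u u"
| meq_sym: "meq u v \<Longrightarrow> meq v u"
| meq_trans: "meq u v \<Longrightarrow> meq v x \<Longrightarrow> meq u x"
| meq_germ: "set u \<subseteq> S \<Longrightarrow> set v \<subseteq> S \<Longrightarrow> germ s t \<Longrightarrow> meq (u @ [s, t] @ v) (u @ [s \<otimes> t] @ v)"
| meq_one: "set u \<subseteq> S \<Longrightarrow> set v \<subseteq> S \<Longrightarrow> meq (u @ [\<one>] @ v) (u @ v)"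

lemma meq_words: "meq u v \<Longrightarrow> set u \<subseteq> S \<and> set v \<subseteq> S"
  by (induction rule: meq.induct) (auto simp: germ_def one_in_S)

lemma meq_append_left: "meq u v \<Longrightarrow> set p \<subseteq> S \<Longrightarrow> meq (p @ u) (p @ v)"
proof (induction rule: meq.induct)
  case (meq_germ u v s t)
  then show ?case using meq.meq_germ[of "p @ u" v s t] by simp
next
  case (meq_one u v)
  then show ?case using meq.meq_one[of "p @ u" v] by simp
next
  case (meq_trans u v x)
  then show ?case by (meson meq.meq_trans)
qed (simp_all add: meq.meq_refl meq.meq_sym)

lemma meq_append_right: "meq u v \<Longrightarrow> set p \<subseteq> S \<Longrightarrow> meq (u @ p) (v @ p)"
proof (induction rule: meq.induct)
  case (meq_germ u v s t)
  then show ?case using meq.meq_germ[of u "v @ p" s t] by simp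
next
  case (meq_one u v)
  then show ?case using meq.meq_one[of u "v @ p"] by simp
next
  case (meq_trans u v x)
  then show ?case by (meson meq.meq_trans)
qed (simp_all add: meq.meq_refl meq.meq_sym)

lemma meq_Cons: "meq u v \<Longrightarrow> s \<in> S \<Longrightarrow> meq (s # u) (s # v)"
  using meq_append_left[of u v "[s]"] by simp

lemma meq_germ_Cons: "germ s t \<Longrightarrow> set v \<subseteq> S \<Longrightarrow> meq (s # t # v) ((s \<otimes> t) # v)"
  using meq_germ[of "[]" v s t] by simp

lemma head_word_in_S: "set u \<subseteq> S \<Longrightarrow> head_word u \<in> S"
  by (induction u) (auto simp: one_in_S head2_in_S)

lemma tail_word_in_S: "set u \<subseteq> S \<Longrightarrow> set (tail_word u) \<subseteq> S"
  by (induction u) (auto simp: tail2_in_S head_word_in_S)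

lemma meq_head_tail:
  "set u \<subseteq> S \<Longrightarrow> meq u (head_word u # tail_word u)"
proof (induction u)
  case Nil
  show ?case using meq_sym[OF meq_one[of "[]" "[]"]] by simp
next
  case (Cons s v)
  let ?h = "head_word v" and ?m = "inv s \<otimes> head2 s (head_word v)"
  have s: "s \<in> S" and h: "?h \<in> S" and tv: "set (tail_word v) \<subseteq> S"
    using Cons head_word_in_S tail_word_in_S by auto
  note ht = head2_tail2[OF s h]
  have "meq (s # v) (s # ?h # tail_word v)"
    using Cons s by (auto intro: meq_Cons)
  moreover have "meq (s # ?h # tail_word v) (s # ?m # tail2 s ?h # tail_word v)"
    using meq_germ_Cons[OF ht(2) tv] ht(3) s by (auto intro: meq_Cons meq_sym)
  moreover have "meq (s # ?m # tail2 s ?h # tail_word v) (head2 s ?h # tail2 s ?h # tail_word v)"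
    using meq_germ_Cons[OF ht(1), of "tail2 s ?h # tail_word v"] ht(4) tv s
      head2_in_S[OF s h] S_carrier by simp
  ultimately show ?case by (auto intro: meq_trans)
qed

text \<open>
  Head and tail are invariants of the monoid defined by the germ.  Cancellation follows: since
  \<open>tail_word (w # v)\<close> represents the same element as \<open>v\<close>, a leading \<open>w\<close> can be removed from an equation.
\<close>

lemma meq_head: "meq u v \<Longrightarrow> head_word u = head_word v"
proof (induction rule: meq.induct)
  case (meq_germ u v s t)
  have "head_word ([s, t] @ v) = head_word ([s \<otimes> t] @ v)"
    using meq_germ head2_assoc head_word_in_S by simp
  then show ?case by (induction u) auto
next
  case (meq_one u v)
  have "head_word ([\<one>] @ v) = head_word v"
    using meq_one head_word_in_S by simp
  then show ?case by (induction u) auto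
qed auto

lemma meq_tail: "meq u v \<Longrightarrow> meq (tail_word u) (tail_word v)"
proof (induction rule: meq.induct)
  case (meq_germ u v s t)
  have st: "set ([s, t] @ v) \<subseteq> S" "set ([s \<otimes> t] @ v) \<subseteq> S"
    using meq_germ by (auto simp: germ_def)
  have base: "meq (tail_word ([s, t] @ v)) (tail_word ([s \<otimes> t] @ v))"
    using meq_germ_Cons[OF germ_tail2_tail2(1)[OF meq_germ(3)], of "head_word v" "tail_word v"]
      germ_tail2_tail2(2)[OF meq_germ(3)] head_word_in_S tail_word_in_S meq_germ(2) by simp
  show ?case using meq_germ(1)
  proof (induction u)
    case Nil
    then show ?case using base by simp
  next
    case (Cons a u)
    have "head_word (u @ [s, t] @ v) = head_word (u @ [s \<otimes> t] @ v)"
      using Cons meq_germ by (intro meq_head meq.meq_germ) auto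
    moreover have "set (u @ [s \<otimes> t] @ v) \<subseteq> S" "a \<in> S"
      using Cons st by auto
    ultimately show ?case
      using Cons by (auto intro!: meq_Cons tail2_in_S head_word_in_S)
  qed
next
  case (meq_one u v)
  have hv: "head_word v \<in> S" "set (tail_word v) \<subseteq> S"
    using meq_one head_word_in_S tail_word_in_S by auto
  show ?case using meq_one(1)
  proof (induction u)
    case Nil
    then show ?case using hv meq.meq_one[of "[]" "tail_word v"] by simp
  next
    case (Cons a u)
    have "head_word (u @ [\<one>] @ v) = head_word (u @ v)"
      using Cons meq_one by (intro meq_head meq.meq_one) auto
    moreover have "set (u @ v) \<subseteq> S" "a \<in> S"
      using Cons meq_one by auto
    ultimately show ?case
      using Cons by (auto intro!: meq_Cons tail2_in_S head_word_in_S)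
  qed
next
  case (meq_trans u v x)
  then show ?case by (meson meq.meq_trans)
qed (simp_all add: meq.meq_refl meq.meq_sym tail_word_in_S)

lemma meq_w_cancel:
  assumes "meq (w # u) (w # v)" shows "meq u v"
proof -
  have uv: "set u \<subseteq> S" "set v \<subseteq> S" using meq_words[OF assms] by auto
  have "meq (tail_word (w # x)) x" if "set x \<subseteq> S" for x
    using meq_head_tail[OF that] head_word_in_S[OF that] by (simp add: meq_sym)
  then show ?thesis
    using meq_tail[OF assms] uv by (meson meq_sym meq_trans)
qed

end

section \<open>Positive cones of lattice-ordered groups\<close>

text \<open>
  A submonoid \<open>P\<close> orders the group by \<open>x \<le> y\<close> iff \<open>x\<^sup>-\<^sup>1 y \<in> P\<close>.  With a degree that is positive on
  \<open>P - {1}\<close>, joins alone make this a lattice order, and \<open>P\<close> inherits left and right lcms and gcds.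
\<close>

locale lattice_cone = group G for G (structure) +
  fixes P and deg :: "'a \<Rightarrow> int"
  assumes P_carrier: "P \<subseteq> carrier G"
    and P_one: "\<one> \<in> P"
    and P_mult: "x \<in> P \<Longrightarrow> y \<in> P \<Longrightarrow> x \<otimes> y \<in> P"
    and deg_mult: "x \<in> carrier G \<Longrightarrow> y \<in> carrier G \<Longrightarrow> deg (x \<otimes> y) = deg x + deg y"
    and deg_nonneg: "x \<in> P \<Longrightarrow> deg x \<ge> 0"
    and deg_eq_0: "x \<in> P \<Longrightarrow> deg x = 0 \<Longrightarrow> x = \<one>"
    and lower_bound: "x \<in> carrier G \<Longrightarrow> y \<in> carrier G \<Longrightarrow>
      \<exists>z\<in>carrier G. inv z \<otimes> x \<in> P \<and> inv z \<otimes> y \<in> P"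
    and join: "x \<in> carrier G \<Longrightarrow> y \<in> carrier G \<Longrightarrow>
      \<exists>m\<in>carrier G. inv x \<otimes> m \<in> P \<and> inv y \<otimes> m \<in> P \<and>
        (\<forall>n\<in>carrier G. inv x \<otimes> n \<in> P \<longrightarrow> inv y \<otimes> n \<in> P \<longrightarrow> inv m \<otimes> n \<in> P)"
begin

text \<open>Lower bounds have bounded degree, and the join of a maximal one with any other is again one.\<close>

lemma meet:
  assumes "x \<in> carrier G" "y \<in> carrier G"
  shows "\<exists>d\<in>carrier G. inv d \<otimes> x \<in> P \<and> inv d \<otimes> y \<in> P \<and>
    (\<forall>n\<in>carrier G. inv n \<otimes> x \<in> P \<longrightarrow> inv n \<otimes> y \<in> P \<longrightarrow> inv n \<otimes> d \<in> P)"
proof -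
  let ?L = "\<lambda>d. d \<in> carrier G \<and> inv d \<otimes> x \<in> P \<and> inv d \<otimes> y \<in> P"
  have deg_le: "deg u \<le> deg v" if "u \<in> carrier G" "v \<in> carrier G" "inv u \<otimes> v \<in> P" for u v
    using deg_nonneg[OF that(3)] deg_mult[of u "inv u \<otimes> v"] that by simp
  obtain z where "?L z" using lower_bound[OF assms] by blast
  then obtain d where d: "?L d" and max: "\<And>e. ?L e \<Longrightarrow> nat (deg x - deg d) \<le> nat (deg x - deg e)"
    using ex_has_least_nat[of ?L z "\<lambda>d. nat (deg x - deg d)"] by blast
  have "inv n \<otimes> d \<in> P" if n: "?L n" for n
  proof -
    obtain j where j: "j \<in> carrier G" "inv d \<otimes> j \<in> P" "inv n \<otimes> j \<in> P"
      "\<And>e. e \<in> carrier G \<Longrightarrow> inv d \<otimes> e \<in> P \<Longrightarrow> inv n \<otimes> e \<in> P \<Longrightarrow> inv j \<otimes> e \<in> P"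
      using join[of d n] d n by blast
    then have "?L j" using d n assms by blast
    then have "deg j \<le> deg d" using max[of j] deg_le[of j x] assms by linarith
    then have "deg (inv d \<otimes> j) = 0"
      using deg_le[of d j] deg_mult[of d "inv d \<otimes> j"] d j by simp
    then have "inv d \<otimes> j = \<one>" using deg_eq_0 j by blast
    then have "j = d" using d j by (metis inv_closed inv_equality inv_inv)
    then show ?thesis using j by simp
  qed
  with d show ?thesis by blast
qed

abbreviation "cone \<equiv> G\<lparr>carrier := P\<rparr>"

lemma left_divides_cone:
  assumes "a \<in> P" "b \<in> P" shows "left_divides cone a b \<longleftrightarrow> inv a \<otimes> b \<in> P"
proof -
  have c: "a \<in> carrier G" "b \<in> carrier G" using assms P_carrier by auto
  have "b = a \<otimes> c \<longleftrightarrow> c = inv a \<otimes> b" if "c \<in> P" for c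
    using c that P_carrier inv_mult_cancel[of a] by auto
  then show ?thesis unfolding left_divides_def by auto
qed

lemma right_divides_cone:
  assumes "a \<in> P" "b \<in> P" shows "right_divides cone a b \<longleftrightarrow> inv (inv b) \<otimes> inv a \<in> P"
proof -
  have c: "a \<in> carrier G" "b \<in> carrier G" using assms P_carrier by auto
  have "b = c \<otimes> a \<longleftrightarrow> c = b \<otimes> inv a" if "c \<in> P" for c
    using c that P_carrier by (auto simp: m_assoc)
  then show ?thesis unfolding right_divides_def using c by auto
qed

lemma left_lcms_gcds: "has_lcms_and_gcds P (left_divides cone)"
  unfolding has_lcms_and_gcds_def
proof (intro ballI conjI)
  fix x y assume xy: "x \<in> P" "y \<in> P"
  have pc: "\<And>p. p \<in> P \<Longrightarrow> p \<in> carrier G" using P_carrier by blast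
  have c: "x \<in> carrier G" "y \<in> carrier G" using xy pc by auto
  obtain m where m: "m \<in> carrier G" "inv x \<otimes> m \<in> P" "inv y \<otimes> m \<in> P"
    "\<And>n. n \<in> carrier G \<Longrightarrow> inv x \<otimes> n \<in> P \<Longrightarrow> inv y \<otimes> n \<in> P \<Longrightarrow> inv m \<otimes> n \<in> P"
    using join[OF c] by blast
  have "m \<in> P" using P_mult[OF xy(1) m(2)] c m by simp
  then show "\<exists>m\<in>P. left_divides cone x m \<and> left_divides cone y m \<and>
      (\<forall>n\<in>P. left_divides cone x n \<and> left_divides cone y n \<longrightarrow> left_divides cone m n)"
    using m xy P_carrier by (intro bexI[of _ m]) (auto simp: left_divides_cone)
  obtain d where d: "d \<in> carrier G" "inv d \<otimes> x \<in> P" "inv d \<otimes> y \<in> P"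
    "\<And>n. n \<in> carrier G \<Longrightarrow> inv n \<otimes> x \<in> P \<Longrightarrow> inv n \<otimes> y \<in> P \<Longrightarrow> inv n \<otimes> d \<in> P"
    using meet[OF c] by blast
  have "d \<in> P" using d(4)[of \<one>] d(1) c xy by simp
  then show "\<exists>d\<in>P. left_divides cone d x \<and> left_divides cone d y \<and>
      (\<forall>n\<in>P. left_divides cone n x \<and> left_divides cone n y \<longrightarrow> left_divides cone n d)"
    using d xy P_carrier by (intro bexI[of _ d]) (auto simp: left_divides_cone)
qed

text \<open>Inversion turns the order by right division into the opposite of the order by left division.\<close>

lemma right_lcms_gcds: "has_lcms_and_gcds P (right_divides cone)"
  unfolding has_lcms_and_gcds_def
proof (intro ballI conjI)
  fix x y assume xy: "x \<in> P" "y \<in> P"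
  have pc: "\<And>p. p \<in> P \<Longrightarrow> p \<in> carrier G" using P_carrier by blast
  have c: "x \<in> carrier G" "y \<in> carrier G" using xy pc by auto
  obtain m where m: "m \<in> carrier G" "inv m \<otimes> inv x \<in> P" "inv m \<otimes> inv y \<in> P"
    "\<And>n. n \<in> carrier G \<Longrightarrow> inv n \<otimes> inv x \<in> P \<Longrightarrow> inv n \<otimes> inv y \<in> P \<Longrightarrow> inv n \<otimes> m \<in> P"
    using meet[of "inv x" "inv y"] c by auto
  have "inv m \<in> P" using P_mult[OF m(2) xy(1)] c m by (simp add: m_assoc)
  then show "\<exists>m\<in>P. right_divides cone x m \<and> right_divides cone y m \<and>
      (\<forall>n\<in>P. right_divides cone x n \<and> right_divides cone y n \<longrightarrow> right_divides cone m n)"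
    using m(2,3) m(4)[OF inv_closed[OF pc]] m(1) xy
    by (intro bexI[of _ "inv m"]) (simp_all add: right_divides_cone)
  obtain d where d: "d \<in> carrier G" "inv (inv x) \<otimes> d \<in> P" "inv (inv y) \<otimes> d \<in> P"
    "\<And>n. n \<in> carrier G \<Longrightarrow> inv (inv x) \<otimes> n \<in> P \<Longrightarrow> inv (inv y) \<otimes> n \<in> P \<Longrightarrow> inv d \<otimes> n \<in> P"
    using join[of "inv x" "inv y"] c by auto
  have "inv d \<in> P" using d(4)[of \<one>] d(1) c xy by simp
  then show "\<exists>d\<in>P. right_divides cone d x \<and> right_divides cone d y \<and>
      (\<forall>n\<in>P. right_divides cone n x \<and> right_divides cone n y \<longrightarrow> right_divides cone n d)"
    using d(2,3) d(4)[OF inv_closed[OF pc]] d(1) xy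
    by (intro bexI[of _ "inv d"]) (simp_all add: right_divides_cone)
qed

lemma monoid_cone: "monoid cone"
  using P_carrier P_one P_mult by (intro monoidI) (auto simp: m_assoc subset_iff)

lemma cone_cancel:
  assumes "x \<in> P" "y \<in> P" "z \<in> P"
  shows "z \<otimes> x = z \<otimes> y \<Longrightarrow> x = y" "x \<otimes> z = y \<otimes> z \<Longrightarrow> x = y"
  using assms P_carrier by (auto simp: subset_iff)

lemma Units_cone: "Units cone = {\<one>}"
proof -
  have "x = \<one>" if "x \<in> P" "y \<in> P" "x \<otimes> y = \<one>" for x y
  proof -
    have "x \<in> carrier G" "y \<in> carrier G" using that P_carrier by auto
    then have "deg x + deg y = deg \<one>" using deg_mult[of x y] that(3) by simp
    moreover have "deg \<one> = 0" using deg_mult[of \<one> \<one>] by simp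
    ultimately have "deg x = 0" using deg_nonneg that by (smt (verit))
    then show ?thesis using deg_eq_0 that by blast
  qed
  then show ?thesis
    using P_one by (auto simp: Units_def intro: bexI[of _ \<one>])
qed

end


section \<open>The interval group of a lattice interval is a Garside group\<close>

context lattice_interval
begin

lemma meq_map:
  assumes f: "\<And>x. x \<in> S \<Longrightarrow> f x \<in> S" "f \<one> = \<one>"
    "\<And>x y. germ x y \<Longrightarrow> germ (f x) (f y) \<and> f (x \<otimes> y) = f x \<otimes> f y"
    and "meq u v"
  shows "meq (map f u) (map f v)"
  using assms(4)
proof (induction rule: meq.induct)
  case (meq_germ u v s t)
  then show ?case using meq.meq_germ[of "map f u" "map f v" "f s" "f t"] f(1) f(3)[of s t] by auto
next
  case (meq_one u v)
  then show ?case using meq.meq_one[of "map f u" "map f v"] f by auto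
next
  case (meq_trans u v x)
  then show ?case by (meson meq.meq_trans)
next
  case (meq_refl u)
  then show ?case using f(1) by (intro meq.meq_refl) auto
qed (rule meq.meq_sym)

lemma meq_cj: "meq u v \<Longrightarrow> meq (map cj u) (map cj v)"
proof (rule meq_map)
  fix x y assume g: "germ x y"
  then have "x \<in> carrier G" "y \<in> carrier G" using S_carrier by (auto simp: germ_def)
  then have "cj (x \<otimes> y) = cj x \<otimes> cj y" by (simp add: m_assoc)
  with germ_conj[OF g] show "germ (cj x) (cj y) \<and> cj (x \<otimes> y) = cj x \<otimes> cj y" by blast
qed (simp_all add: S_conj)

lemma meq_ci: "meq u v \<Longrightarrow> meq (map ci u) (map ci v)"
proof (rule meq_map)
  fix x y assume g: "germ x y"
  then have "x \<in> carrier G" "y \<in> carrier G" using S_carrier by (auto simp: germ_def)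
  then have "ci (x \<otimes> y) = ci x \<otimes> ci y" by (simp add: m_assoc)
  with germ_conj_inv[OF g] show "germ (ci x) (ci y) \<and> ci (x \<otimes> y) = ci x \<otimes> ci y" by blast
qed (simp_all add: S_conj_inv)

lemma meq_swap_w:
  assumes "s \<in> S" shows "meq [s, w] [w, cj s]"
proof -
  have s: "s \<in> carrier G" using assms S_carrier by blast
  have "meq [s, w] [s, inv s \<otimes> w, cj s]"
  proof -
    have "(inv s \<otimes> w) \<otimes> cj s = w" using s by (simp add: m_assoc)
    then show ?thesis
      using meq_germ_Cons[OF germ_complement_cj[OF assms], of "[]"] assms
      by (auto intro: meq_Cons meq_sym)
  qed
  moreover have "meq [s, inv s \<otimes> w, cj s] [w, cj s]"
    using meq_germ_Cons[OF germ_complement[OF assms], of "[cj s]"] s S_conj assms by simp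
  ultimately show ?thesis by (rule meq_trans)
qed

lemma meq_append_w:
  "set p \<subseteq> S \<Longrightarrow> meq (p @ [w]) (w # map cj p)"
proof (induction p)
  case Nil
  show ?case using meq_refl w_in_S by simp
next
  case (Cons s p)
  then have "meq (s # p @ [w]) (s # w # map cj p)" by (auto intro: meq_Cons)
  moreover have "meq ([s, w] @ map cj p) ([w, cj s] @ map cj p)"
    using Cons S_conj by (intro meq_append_right meq_swap_w) auto
  ultimately show ?case by (auto intro: meq_trans)
qed

lemma meq_append_w_cancel:
  assumes "meq (u @ [w]) (v @ [w])" shows "meq u v"
proof -
  have uv: "set u \<subseteq> S" "set v \<subseteq> S" using meq_words[OF assms] by auto
  have "meq (w # map cj u) (w # map cj v)"
    using meq_append_w[OF uv(1)] meq_append_w[OF uv(2)] assms by (meson meq_sym meq_trans)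
  then have "meq (map ci (map cj u)) (map ci (map cj v))"
    by (rule meq_ci[OF meq_w_cancel])
  moreover have "map ci (map cj p) = p" if "set p \<subseteq> S" for p
    using that S_carrier by (induction p) (auto simp: m_assoc)
  ultimately show ?thesis using uv by simp
qed

lemma meq_append_replicate_w_cancel:
  "meq (u @ replicate k w) (v @ replicate k w) \<Longrightarrow> meq u v"
proof (induction k arbitrary: u v)
  case (Suc k)
  then have "meq (u @ [w]) (v @ [w])" using Suc.IH[of "u @ [w]" "v @ [w]"] by simp
  then show ?case by (rule meq_append_w_cancel)
qed simp

text \<open>
  A pair \<open>(k, p)\<close> stands for the right fraction \<open>p w\<^sup>-\<^sup>k\<close>; a negative letter is absorbed by
  \<open>s\<^sup>-\<^sup>1 p w\<^sup>-\<^sup>k = (s\<^sup>-\<^sup>1 w) (w\<^sup>-\<^sup>1 p w) w\<^sup>-\<^sup>k\<^sup>-\<^sup>1\<close>.  Equality of fractions is an invariant of group words, so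
  positive words that agree in the interval group already agree in the monoid.
\<close>

primrec frac :: "'a gword \<Rightarrow> nat \<times> 'a list" where
  "frac [] = (0, [])"
| "frac (a # g) = (if snd a then (fst (frac g), fst a # snd (frac g))
     else (Suc (fst (frac g)), (inv (fst a) \<otimes> w) # map cj (snd (frac g))))"

definition feq :: "nat \<times> 'a list \<Rightarrow> nat \<times> 'a list \<Rightarrow> bool" where
  "feq a b \<longleftrightarrow> meq (snd a @ replicate (fst b) w) (snd b @ replicate (fst a) w)"

lemma feq_refl: "set (snd a) \<subseteq> S \<Longrightarrow> feq a a"
  using w_in_S by (auto simp: feq_def intro!: meq_refl)

lemma feq_sym: "feq a b \<Longrightarrow> feq b a"
  by (simp add: feq_def meq_sym)

lemma feq_trans:
  assumes "feq a b" "feq b c" shows "feq a c"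
proof -
  have repl: "set (replicate k w) \<subseteq> S" for k using w_in_S by auto
  have "meq (snd a @ replicate (fst c) w @ replicate (fst b) w)
      (snd b @ replicate (fst a) w @ replicate (fst c) w)"
    using meq_append_right[OF assms(1)[unfolded feq_def] repl, of "fst c"]
    by (simp add: add.commute flip: replicate_add)
  moreover have "meq (snd b @ replicate (fst a) w @ replicate (fst c) w)
      (snd c @ replicate (fst a) w @ replicate (fst b) w)"
    using meq_append_right[OF assms(2)[unfolded feq_def] repl, of "fst a"]
    by (simp add: add.commute flip: replicate_add)
  ultimately have "meq ((snd a @ replicate (fst c) w) @ replicate (fst b) w)
      ((snd c @ replicate (fst a) w) @ replicate (fst b) w)"
    by (auto intro: meq_trans)
  then show ?thesis
    unfolding feq_def by (rule meq_append_replicate_w_cancel)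
qed

lemma frac_words: "g \<in> gwords S \<Longrightarrow> set (snd (frac g)) \<subseteq> S"
proof (induction g)
  case (Cons a g)
  then show ?case by (cases a) (auto simp: complement_in_S S_conj)
qed simp

lemma frac_Cons:
  assumes "feq (frac g) (frac h)" "fst a \<in> S"
  shows "feq (frac (a # g)) (frac (a # h))"
proof (cases "snd a")
  case True
  then show ?thesis using assms by (auto simp: feq_def intro: meq_Cons)
next
  case False
  have "map cj (replicate k w) = replicate k w" for k
    by (induction k) (auto simp: m_assoc)
  then have "meq (map cj (snd (frac g)) @ replicate (fst (frac h)) w)
      (map cj (snd (frac h)) @ replicate (fst (frac g)) w)"
    using meq_cj[OF assms(1)[unfolded feq_def]] by simp
  from meq_append_right[OF this, of "[w]"]
  have "meq (map cj (snd (frac g)) @ replicate (Suc (fst (frac h))) w)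
      (map cj (snd (frac h)) @ replicate (Suc (fst (frac g))) w)"
    using w_in_S by (simp add: replicate_append_same)
  then show ?thesis
    using False assms(2) complement_in_S by (auto simp: feq_def intro: meq_Cons)
qed

lemma frac_append:
  "feq (frac g) (frac h) \<Longrightarrow> p \<in> gwords S \<Longrightarrow> feq (frac (p @ g)) (frac (p @ h))"
proof (induction p)
  case (Cons a p)
  then show ?case using frac_Cons[of "p @ g" "p @ h" a] by (cases a) auto
qed simp

lemma frac_cancel:
  assumes "x \<in> S" "v \<in> gwords S"
  shows "feq (frac ([(x, b), (x, \<not> b)] @ v)) (frac v)"
proof -
  let ?p = "snd (frac v)"
  have x: "x \<in> carrier G" using assms S_carrier by blast
  have p: "set ?p \<subseteq> S" "set (map cj ?p) \<subseteq> S" using frac_words assms S_conj by auto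
  have "meq (w # map cj ?p) (?p @ [w])"
    using meq_append_w[OF p(1)] by (rule meq_sym)
  moreover have "meq (x # (inv x \<otimes> w) # map cj ?p) (w # map cj ?p)"
    using meq_germ_Cons[OF germ_complement[OF assms(1)] p(2)] x by simp
  moreover have "meq ((inv x \<otimes> w) # cj x # map cj ?p) (w # map cj ?p)"
  proof -
    have "(inv x \<otimes> w) \<otimes> cj x = w" using x by (simp add: m_assoc)
    then show ?thesis
      using meq_germ_Cons[OF germ_complement_cj[OF assms(1)] p(2)] by simp
  qed
  ultimately have "meq (snd (frac ([(x, b), (x, \<not> b)] @ v))) (?p @ [w])"
    by (cases b) (auto intro: meq_trans)
  then have "meq (snd (frac ([(x, b), (x, \<not> b)] @ v)) @ replicate (fst (frac v)) w)
      ((?p @ [w]) @ replicate (fst (frac v)) w)"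
    by (rule meq_append_right) (use w_in_S in auto)
  then show ?thesis
    by (cases b) (simp_all add: feq_def)
qed

lemma frac_word_eq: "word_eq S rels g h \<Longrightarrow> feq (frac g) (frac h)"
proof (induction rule: word_eq.induct)
  case (refl u)
  then show ?case using feq_refl frac_words by blast
next
  case (sym u v)
  then show ?case using feq_sym by blast
next
  case (trans u v x)
  then show ?case using feq_trans by blast
next
  case (cancel u v x b)
  then show ?case using frac_append[OF frac_cancel] by blast
next
  case (relation u v l r)
  then obtain x y where xy: "l = pos [x, y]" "r = pos [x \<otimes> y]" "germ x y"
    by (auto simp: rels_def germ_def)
  have "meq (x # y # snd (frac v)) ((x \<otimes> y) # snd (frac v))"
    using meq_germ_Cons xy frac_words relation by blast
  moreover have "set (replicate (fst (frac v)) w) \<subseteq> S" using w_in_S by auto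
  ultimately have "meq ((x # y # snd (frac v)) @ replicate (fst (frac v)) w)
      (((x \<otimes> y) # snd (frac v)) @ replicate (fst (frac v)) w)"
    by (rule meq_append_right)
  then have "feq (frac (l @ v)) (frac (r @ v))"
    using xy w_in_S by (auto simp: feq_def)
  then show ?case using frac_append relation by blast
qed

text \<open>
  The interval monoid embeds into the interval group.
\<close>

lemma cl_eq_iff:
  assumes "set xs \<subseteq> S" "set ys \<subseteq> S"
  shows "cl xs = cl ys \<longleftrightarrow> meq xs ys"
proof
  assume "cl xs = cl ys"
  then have "word_eq S rels (pos xs) (pos ys)"
    using assms by (simp add: cl_def word_class_eq_iff)
  moreover have "frac (pos zs) = (0, zs)" for zs
    by (induction zs) auto
  ultimately show "meq xs ys"
    using frac_word_eq by (fastforce simp: feq_def)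
next
  assume "meq xs ys"
  then show "cl xs = cl ys"
  proof (induction rule: meq.induct)
    case (meq_germ u v s t)
    then have "cl ([s, t] @ v) = cl ([s \<otimes> t] @ v)"
      using cl_germ[of s t] cl_Cons[of s "t # v"] cl_Cons[of t v] cl_Cons[of "s \<otimes> t" v]
      by (auto simp: germ_def GG.m_assoc[symmetric])
    then show ?case
      using meq_germ cl_append[of u "[s, t] @ v"] cl_append[of u "[s \<otimes> t] @ v"]
      by (auto simp: germ_def)
  next
    case (meq_one u v)
    then show ?case
      using cl_append[of u "[\<one>] @ v"] cl_append[of u v] cl_Cons[of \<one> v] one_in_S
      by (auto simp: cl_one)
  qed auto
qed

definition PP :: "'a gword set set" where
  "PP = {cl xs | xs. set xs \<subseteq> S}"

lemma PP_carrier: "PP \<subseteq> carrier GG"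
  by (auto simp: PP_def)

lemma cl_in_PP [simp]: "set xs \<subseteq> S \<Longrightarrow> cl xs \<in> PP"
  by (auto simp: PP_def)

lemma PP_closed: "x \<in> PP \<Longrightarrow> y \<in> PP \<Longrightarrow> x \<otimes>\<^bsub>GG\<^esub> y \<in> PP"
proof -
  assume "x \<in> PP" "y \<in> PP"
  then obtain xs ys where "x = cl xs" "y = cl ys" "set xs \<subseteq> S" "set ys \<subseteq> S"
    by (auto simp: PP_def)
  then show ?thesis using cl_append[of xs ys] cl_in_PP[of "xs @ ys"] by simp
qed

definition ldv :: "'a gword set \<Rightarrow> 'a gword set \<Rightarrow> bool" where
  "ldv x y \<longleftrightarrow> inv\<^bsub>GG\<^esub> x \<otimes>\<^bsub>GG\<^esub> y \<in> PP"

lemma ldv_mult_iff: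
  assumes "g \<in> carrier GG" "x \<in> carrier GG" "y \<in> carrier GG"
  shows "ldv (g \<otimes>\<^bsub>GG\<^esub> x) y \<longleftrightarrow> ldv x (inv\<^bsub>GG\<^esub> g \<otimes>\<^bsub>GG\<^esub> y)"
  using assms by (simp add: ldv_def GG.inv_mult_group GG.m_assoc)

lemma ldv_mult_left:
  assumes "g \<in> carrier GG" "x \<in> carrier GG" "y \<in> carrier GG"
  shows "ldv (g \<otimes>\<^bsub>GG\<^esub> x) (g \<otimes>\<^bsub>GG\<^esub> y) \<longleftrightarrow> ldv x y"
  using assms by (simp add: ldv_mult_iff)

lemma ldv_mult: "x \<in> carrier GG \<Longrightarrow> p \<in> PP \<Longrightarrow> ldv x (x \<otimes>\<^bsub>GG\<^esub> p)"
  using PP_carrier by (auto simp: ldv_def)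

lemma ldv_trans:
  assumes "x \<in> carrier GG" "y \<in> carrier GG" "z \<in> carrier GG" "ldv x y" "ldv y z"
  shows "ldv x z"
  using PP_closed[OF assms(4,5)[unfolded ldv_def]] assms(1-3) by (simp add: ldv_def GG.m_assoc)

text \<open>
  A simple left divisor of a positive element divides its greedy head, so two of them have their
  join in \<open>S\<close> as a common divisor.
\<close>

lemma simple_join:
  assumes "s \<in> S" "t \<in> S"
  shows "\<exists>s'\<in>S. \<exists>t'\<in>S. cl [s] \<otimes>\<^bsub>GG\<^esub> cl [s'] = cl [t] \<otimes>\<^bsub>GG\<^esub> cl [t'] \<and>
    (\<forall>x\<in>carrier GG. ldv (cl [s]) x \<longrightarrow> ldv (cl [t]) x \<longrightarrow> ldv (cl [s] \<otimes>\<^bsub>GG\<^esub> cl [s']) x)"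
proof -
  obtain j where j: "j \<in> S" "prec s j" "prec t j" "\<And>n. n \<in> S \<Longrightarrow> prec s n \<Longrightarrow> prec t n \<Longrightarrow> prec j n"
    using join_exists[OF assms] by blast
  have c: "s \<in> carrier G" "t \<in> carrier G" "j \<in> carrier G" using assms j S_carrier by auto
  have fact: "cl [u] \<otimes>\<^bsub>GG\<^esub> cl [inv u \<otimes> v] = cl [v] \<and> inv u \<otimes> v \<in> S"
    if "u \<in> S" "v \<in> S" "prec u v" for u v
    using cl_germ[OF germI_le[OF that(2) _ that(3)]] S_right_factor[OF that(2) _ that(3)] that S_carrier
    by auto
  have head: "prec u (head_word xs)"
    if u: "u \<in> S" and xs: "set xs \<subseteq> S" and dv: "ldv (cl [u]) (cl xs)" for u xs
  proof -
    obtain v where v: "set v \<subseteq> S" "inv\<^bsub>GG\<^esub> cl [u] \<otimes>\<^bsub>GG\<^esub> cl xs = cl v"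
      using dv by (auto simp: ldv_def PP_def)
    then have "cl xs = cl (u # v)"
      using cl_Cons[of u v] u xs by (metis GG.inv_mult_cancel(2) cl_closed empty_subsetI insert_subset list.set)
    then have "head_word xs = head2 u (head_word v)"
      using meq_head[of xs "u # v"] cl_eq_iff[of xs "u # v"] u v xs by simp
    then show ?thesis using le_head2 head_word_in_S u v by simp
  qed
  show ?thesis
  proof (rule bexI[of _ "inv s \<otimes> j"], rule bexI[of _ "inv t \<otimes> j"], intro conjI ballI impI)
    show "inv s \<otimes> j \<in> S" "inv t \<otimes> j \<in> S"
      "cl [s] \<otimes>\<^bsub>GG\<^esub> cl [inv s \<otimes> j] = cl [t] \<otimes>\<^bsub>GG\<^esub> cl [inv t \<otimes> j]"
      using fact j assms by auto
    fix x assume x: "x \<in> carrier GG" "ldv (cl [s]) x" "ldv (cl [t]) x"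
    have "cl [s] \<otimes>\<^bsub>GG\<^esub> (inv\<^bsub>GG\<^esub> cl [s] \<otimes>\<^bsub>GG\<^esub> x) \<in> PP"
      using PP_closed[of "cl [s]"] x(2) assms by (simp add: ldv_def)
    then have "x \<in> PP" using x assms by simp
    then obtain xs where xs: "set xs \<subseteq> S" "x = cl xs" by (auto simp: PP_def)
    have hw: "head_word xs \<in> S" "set (tail_word xs) \<subseteq> S"
      using xs head_word_in_S tail_word_in_S by auto
    have "prec j (head_word xs)"
      using j(4) hw head[OF assms(1) xs(1)] head[OF assms(2) xs(1)] x xs by blast
    then have 1: "cl [head_word xs] = cl [j] \<otimes>\<^bsub>GG\<^esub> cl [inv j \<otimes> head_word xs]"
      and 2: "inv j \<otimes> head_word xs \<in> S"
      using fact[OF j(1) hw(1)] by auto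
    have "x = cl (head_word xs # tail_word xs)"
      using meq_head_tail[OF xs(1)] cl_eq_iff[of xs "head_word xs # tail_word xs"] xs hw by simp
    also have "\<dots> = cl [j] \<otimes>\<^bsub>GG\<^esub> cl ((inv j \<otimes> head_word xs) # tail_word xs)"
      using hw 2 j(1) 1 cl_Cons[of "head_word xs" "tail_word xs"]
        cl_Cons[of "inv j \<otimes> head_word xs" "tail_word xs"] by (simp add: GG.m_assoc)
    finally have "ldv (cl [j]) x"
      using ldv_mult 2 hw j(1) by auto
    then show "ldv (cl [s] \<otimes>\<^bsub>GG\<^esub> cl [inv s \<otimes> j]) x"
      using fact j assms by simp
  qed
qed

text \<open>
  The join of a word with \<open>t\<close> is found by pushing \<open>t\<close> through the word letter by letter; what is left
  of \<open>t\<close> after each letter is again an element of \<open>S\<close>.  In the other direction the word is turned into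
  a word over \<open>S\<close>, which is what the induction in \<open>positive_join\<close> needs.
\<close>

lemma simple_word_join:
  assumes "set xs \<subseteq> S" "t \<in> S"
  shows "\<exists>t' ys. t' \<in> S \<and> set ys \<subseteq> S \<and> cl xs \<otimes>\<^bsub>GG\<^esub> cl [t'] = cl [t] \<otimes>\<^bsub>GG\<^esub> cl ys \<and>
    (\<forall>x\<in>carrier GG. ldv (cl xs) x \<longrightarrow> ldv (cl [t]) x \<longrightarrow> ldv (cl xs \<otimes>\<^bsub>GG\<^esub> cl [t']) x)"
  using assms
proof (induction xs arbitrary: t)
  case Nil
  then show ?case by (intro exI[of _ t] exI[of _ "[]"]) (auto simp: cl_Nil)
next
  case (Cons s xs)
  have s: "s \<in> S" and xs: "set xs \<subseteq> S" using Cons.prems by auto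
  obtain s1 t1 where 1: "s1 \<in> S" "t1 \<in> S" "cl [s] \<otimes>\<^bsub>GG\<^esub> cl [s1] = cl [t] \<otimes>\<^bsub>GG\<^esub> cl [t1]"
    "\<And>x. x \<in> carrier GG \<Longrightarrow> ldv (cl [s]) x \<Longrightarrow> ldv (cl [t]) x \<Longrightarrow> ldv (cl [s] \<otimes>\<^bsub>GG\<^esub> cl [s1]) x"
    using simple_join[OF s Cons.prems(2)] by auto
  obtain t2 ys where 2: "t2 \<in> S" "set ys \<subseteq> S" "cl xs \<otimes>\<^bsub>GG\<^esub> cl [t2] = cl [s1] \<otimes>\<^bsub>GG\<^esub> cl ys"
    "\<And>x. x \<in> carrier GG \<Longrightarrow> ldv (cl xs) x \<Longrightarrow> ldv (cl [s1]) x \<Longrightarrow> ldv (cl xs \<otimes>\<^bsub>GG\<^esub> cl [t2]) x"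
    using Cons.IH[OF xs 1(1)] by blast
  have c: "cl [s] \<in> carrier GG" "cl [t] \<in> carrier GG" "cl [s1] \<in> carrier GG" "cl [t1] \<in> carrier GG"
    "cl [t2] \<in> carrier GG" "cl xs \<in> carrier GG" "cl ys \<in> carrier GG"
    using s xs 1(1,2) 2(1,2) Cons.prems by auto
  have cons: "cl (s # xs) = cl [s] \<otimes>\<^bsub>GG\<^esub> cl xs" "cl (t1 # ys) = cl [t1] \<otimes>\<^bsub>GG\<^esub> cl ys"
    by (rule cl_Cons[OF s xs], rule cl_Cons[OF 1(2) 2(2)])
  have "cl (s # xs) \<otimes>\<^bsub>GG\<^esub> cl [t2] = (cl [s] \<otimes>\<^bsub>GG\<^esub> cl [s1]) \<otimes>\<^bsub>GG\<^esub> cl ys"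
    using c 2(3) by (simp add: cons GG.m_assoc)
  also have "\<dots> = cl [t] \<otimes>\<^bsub>GG\<^esub> cl (t1 # ys)"
    using c by (simp add: 1(3) cons GG.m_assoc)
  finally have eq: "cl (s # xs) \<otimes>\<^bsub>GG\<^esub> cl [t2] = cl [t] \<otimes>\<^bsub>GG\<^esub> cl (t1 # ys)" .
  have "ldv (cl (s # xs) \<otimes>\<^bsub>GG\<^esub> cl [t2]) x"
    if x: "x \<in> carrier GG" "ldv (cl (s # xs)) x" "ldv (cl [t]) x" for x
  proof -
    have "ldv (cl [s]) (cl (s # xs))" using ldv_mult c(1) xs cons by simp
    with ldv_trans[OF c(1) _ x(1) _ x(2)] have "ldv (cl [s]) x" using s xs by simp
    then have "ldv (cl [s1]) (inv\<^bsub>GG\<^esub> cl [s] \<otimes>\<^bsub>GG\<^esub> x)"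
      using 1(4) x c ldv_mult_iff by simp
    moreover have "ldv (cl xs) (inv\<^bsub>GG\<^esub> cl [s] \<otimes>\<^bsub>GG\<^esub> x)"
      using x c ldv_mult_iff cons by simp
    ultimately have "ldv (cl xs \<otimes>\<^bsub>GG\<^esub> cl [t2]) (inv\<^bsub>GG\<^esub> cl [s] \<otimes>\<^bsub>GG\<^esub> x)"
      using 2(4) x c by simp
    then show ?thesis using x c ldv_mult_iff by (simp add: cons GG.m_assoc)
  qed
  with eq 1(2) 2(1,2) show ?case
    by (intro exI[of _ t2] exI[of _ "t1 # ys"]) auto
qed

lemma positive_join:
  assumes "set xs \<subseteq> S" "set zs \<subseteq> S"
  shows "\<exists>m\<in>carrier GG. ldv (cl xs) m \<and> ldv (cl zs) m \<and>
    (\<forall>x\<in>carrier GG. ldv (cl xs) x \<longrightarrow> ldv (cl zs) x \<longrightarrow> ldv m x)"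
  using assms
proof (induction zs arbitrary: xs)
  case Nil
  then show ?case using cl_in_PP[of "[]"] 
    by (intro bexI[of _ "cl xs"]) (auto simp: cl_Nil ldv_def)
next
  case (Cons t zs)
  have t: "t \<in> S" and zs: "set zs \<subseteq> S" using Cons.prems by auto
  obtain t' ys where 1: "t' \<in> S" "set ys \<subseteq> S" "cl xs \<otimes>\<^bsub>GG\<^esub> cl [t'] = cl [t] \<otimes>\<^bsub>GG\<^esub> cl ys"
    "\<And>x. x \<in> carrier GG \<Longrightarrow> ldv (cl xs) x \<Longrightarrow> ldv (cl [t]) x \<Longrightarrow> ldv (cl xs \<otimes>\<^bsub>GG\<^esub> cl [t']) x"
    using simple_word_join[OF Cons.prems(1) t] by blast
  obtain m where m: "m \<in> carrier GG" "ldv (cl ys) m" "ldv (cl zs) m"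
    "\<And>x. x \<in> carrier GG \<Longrightarrow> ldv (cl ys) x \<Longrightarrow> ldv (cl zs) x \<Longrightarrow> ldv m x"
    using Cons.IH[OF 1(2) zs] by blast
  have c: "cl [t] \<in> carrier GG" "cl [t'] \<in> carrier GG" "cl xs \<in> carrier GG" "cl ys \<in> carrier GG"
    "cl zs \<in> carrier GG"
    using t zs 1(1,2) Cons.prems by auto
  have cons: "cl (t # zs) = cl [t] \<otimes>\<^bsub>GG\<^esub> cl zs" by (rule cl_Cons[OF t zs])
  show ?case
  proof (intro bexI[of _ "cl [t] \<otimes>\<^bsub>GG\<^esub> m"] conjI ballI impI)
    show "cl [t] \<otimes>\<^bsub>GG\<^esub> m \<in> carrier GG" using c m by simp
    have "ldv (cl [t] \<otimes>\<^bsub>GG\<^esub> cl ys) (cl [t] \<otimes>\<^bsub>GG\<^esub> m)"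
      using ldv_mult_left[of "cl [t]"] c m by simp
    moreover have "ldv (cl xs) (cl xs \<otimes>\<^bsub>GG\<^esub> cl [t'])"
      using ldv_mult[OF c(3)] 1(1) by simp
    ultimately show "ldv (cl xs) (cl [t] \<otimes>\<^bsub>GG\<^esub> m)"
      using ldv_trans[of "cl xs" "cl xs \<otimes>\<^bsub>GG\<^esub> cl [t']"] 1(3) c m by simp
    show "ldv (cl (t # zs)) (cl [t] \<otimes>\<^bsub>GG\<^esub> m)"
      unfolding cons using ldv_mult_left[of "cl [t]"] c m by simp
    fix x assume x: "x \<in> carrier GG" "ldv (cl xs) x" "ldv (cl (t # zs)) x"
    have "ldv (cl [t]) (cl (t # zs))" unfolding cons using ldv_mult c zs by simp
    with ldv_trans[OF c(1) _ x(1) _ x(3)] have "ldv (cl [t]) x" using t zs by simp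
    then have "ldv (cl [t] \<otimes>\<^bsub>GG\<^esub> cl ys) x" using 1 x by auto
    then have "ldv (cl ys) (inv\<^bsub>GG\<^esub> cl [t] \<otimes>\<^bsub>GG\<^esub> x)" using ldv_mult_iff c x by simp
    moreover have "ldv (cl zs) (inv\<^bsub>GG\<^esub> cl [t] \<otimes>\<^bsub>GG\<^esub> x)"
      using x c ldv_mult_iff cons by simp
    ultimately show "ldv (cl [t] \<otimes>\<^bsub>GG\<^esub> m) x"
      using m c x ldv_mult_iff by simp
  qed
qed

abbreviation "\<Delta> \<equiv> cl [w]"

lemma \<Delta>_closed: "\<Delta> \<in> carrier GG" and \<Delta>_PP: "\<Delta> \<in> PP"
  using w_in_S by auto

lemma \<Delta>_conj_PP: "p \<in> PP \<Longrightarrow> \<exists>q\<in>PP. \<Delta> \<otimes>\<^bsub>GG\<^esub> p = q \<otimes>\<^bsub>GG\<^esub> \<Delta>"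
proof -
  assume "p \<in> PP"
  then obtain xs where xs: "set xs \<subseteq> S" "p = cl xs" by (auto simp: PP_def)
  have ys: "set (map ci xs) \<subseteq> S" using xs S_conj_inv by auto
  have "map cj (map ci xs) = xs"
    using xs S_carrier by (induction xs arbitrary: p) (auto simp: m_assoc)
  then have "cl (map ci xs @ [w]) = cl (w # xs)"
    using meq_append_w[OF ys] cl_eq_iff[of "map ci xs @ [w]" "w # xs"] ys xs w_in_S by simp
  then show ?thesis
    using cl_append[of "map ci xs" "[w]"] cl_Cons[of w xs] ys xs w_in_S
    by (intro bexI[of _ "cl (map ci xs)"]) auto
qed

lemma \<Delta>_pow_conj_PP: "p \<in> PP \<Longrightarrow> \<exists>q\<in>PP. \<Delta> [^]\<^bsub>GG\<^esub> (k::nat) \<otimes>\<^bsub>GG\<^esub> p = q \<otimes>\<^bsub>GG\<^esub> \<Delta> [^]\<^bsub>GG\<^esub> k"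
proof (induction k arbitrary: p)
  case 0
  then have "p \<in> carrier GG" using PP_carrier by auto
  with 0 show ?case by (intro bexI[of _ p]) simp_all
next
  case (Suc k)
  obtain q where q: "q \<in> PP" "\<Delta> \<otimes>\<^bsub>GG\<^esub> p = q \<otimes>\<^bsub>GG\<^esub> \<Delta>" using \<Delta>_conj_PP Suc by blast
  obtain r where r: "r \<in> PP" "\<Delta> [^]\<^bsub>GG\<^esub> k \<otimes>\<^bsub>GG\<^esub> q = r \<otimes>\<^bsub>GG\<^esub> \<Delta> [^]\<^bsub>GG\<^esub> k" using Suc q by blast
  have c: "p \<in> carrier GG" "q \<in> carrier GG" "r \<in> carrier GG" using Suc q r PP_carrier by auto
  have "\<Delta> [^]\<^bsub>GG\<^esub> Suc k \<otimes>\<^bsub>GG\<^esub> p = (\<Delta> [^]\<^bsub>GG\<^esub> k \<otimes>\<^bsub>GG\<^esub> q) \<otimes>\<^bsub>GG\<^esub> \<Delta>"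
    using c \<Delta>_closed q by (simp add: GG.m_assoc)
  also have "\<dots> = r \<otimes>\<^bsub>GG\<^esub> \<Delta> [^]\<^bsub>GG\<^esub> Suc k"
    using c \<Delta>_closed r by (simp add: GG.m_assoc)
  finally show ?case using r by blast
qed

lemma \<Delta>_pow_PP: "\<Delta> [^]\<^bsub>GG\<^esub> (k::nat) \<in> PP"
proof (induction k)
  case 0
  then show ?case using cl_in_PP[of "[]"] by (simp add: cl_Nil)
qed (simp add: PP_closed \<Delta>_PP)

text \<open>
  Conjugation by \<open>\<Delta>\<close> preserves \<open>PP\<close>, so a power of \<open>\<Delta>\<close> on the left can be moved next to any negative
  letter, where it clears the denominator by \<open>\<Delta> s\<^sup>-\<^sup>1 = w s\<^sup>-\<^sup>1\<close>.
\<close>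

lemma fraction:
  assumes "x \<in> carrier GG" shows "\<exists>k::nat. \<Delta> [^]\<^bsub>GG\<^esub> k \<otimes>\<^bsub>GG\<^esub> x \<in> PP"
proof -
  obtain u where u: "u \<in> gwords S" "x = word_class S rels u"
    using assms by (auto simp: carrier_presented_group)
  have "\<exists>k::nat. \<Delta> [^]\<^bsub>GG\<^esub> k \<otimes>\<^bsub>GG\<^esub> word_val GG (gen_class S rels) u \<in> PP"
    using u(1)
  proof (induction u)
    case Nil
    then show ?case using cl_in_PP[of "[]"] by (intro exI[of _ 0]) (simp add: cl_Nil)
  next
    case (Cons a u)
    obtain s b where a: "a = (s, b)" by (cases a)
    have s: "s \<in> S" and u: "u \<in> gwords S" using Cons.prems a by auto
    let ?x = "word_val GG (gen_class S rels) u"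
    have x: "?x \<in> carrier GG"
      using u by (metis word_class_eq_word_val word_class_closed)
    have gen: "gen_class S rels y = cl [y]" for y by (simp add: cl_def)
    obtain k where k: "\<Delta> [^]\<^bsub>GG\<^esub> (k::nat) \<otimes>\<^bsub>GG\<^esub> ?x \<in> PP" using Cons.IH u by blast
    have move: "\<Delta> [^]\<^bsub>GG\<^esub> k \<otimes>\<^bsub>GG\<^esub> (p \<otimes>\<^bsub>GG\<^esub> ?x) \<in> PP" if p: "p \<in> PP" for p
    proof -
      obtain q where q: "q \<in> PP" "\<Delta> [^]\<^bsub>GG\<^esub> k \<otimes>\<^bsub>GG\<^esub> p = q \<otimes>\<^bsub>GG\<^esub> \<Delta> [^]\<^bsub>GG\<^esub> k"
        using \<Delta>_pow_conj_PP[OF p] by blast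
      have c: "p \<in> carrier GG" "q \<in> carrier GG" using p q PP_carrier by auto
      have "\<Delta> [^]\<^bsub>GG\<^esub> k \<otimes>\<^bsub>GG\<^esub> (p \<otimes>\<^bsub>GG\<^esub> ?x) = q \<otimes>\<^bsub>GG\<^esub> (\<Delta> [^]\<^bsub>GG\<^esub> k \<otimes>\<^bsub>GG\<^esub> ?x)"
        using c x \<Delta>_closed q(2) by (simp add: GG.m_assoc[symmetric])
      then show ?thesis using PP_closed q k by simp
    qed
    show ?case
    proof (cases b)
      case True
      then show ?thesis using move[of "cl [s]"] a gen s by auto
    next
      case False
      have sc: "s \<in> carrier G" using s S_carrier by blast
      have t: "w \<otimes> inv s \<in> S" "germ (w \<otimes> inv s) s" "(w \<otimes> inv s) \<otimes> s = w"
      proof -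
        have 1: "w \<otimes> inv s = inv (ci s) \<otimes> w" using sc by (simp add: inv_mult_group m_assoc)
        then show 2: "w \<otimes> inv s \<in> S" using complement_in_S[OF S_conj_inv[OF s]] by simp
        show 3: "(w \<otimes> inv s) \<otimes> s = w" using sc by (simp add: m_assoc)
        have "cj (ci s) = s" using sc by (simp add: m_assoc)
        then show "germ (w \<otimes> inv s) s"
          using germ_complement_cj[OF S_conj_inv[OF s]] 1 by simp
      qed
      have "\<Delta> = cl [w \<otimes> inv s] \<otimes>\<^bsub>GG\<^esub> cl [s]" using cl_germ[OF t(2)] t(3) by simp
      then have D: "\<Delta> \<otimes>\<^bsub>GG\<^esub> (inv\<^bsub>GG\<^esub> cl [s] \<otimes>\<^bsub>GG\<^esub> ?x) = cl [w \<otimes> inv s] \<otimes>\<^bsub>GG\<^esub> ?x"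
        using t(1) s x by (simp add: GG.m_assoc)
      have "\<Delta> [^]\<^bsub>GG\<^esub> Suc k \<otimes>\<^bsub>GG\<^esub> (inv\<^bsub>GG\<^esub> cl [s] \<otimes>\<^bsub>GG\<^esub> ?x)
          = \<Delta> [^]\<^bsub>GG\<^esub> k \<otimes>\<^bsub>GG\<^esub> (cl [w \<otimes> inv s] \<otimes>\<^bsub>GG\<^esub> ?x)"
        using \<Delta>_closed s x by (simp add: GG.m_assoc D)
      then have "\<Delta> [^]\<^bsub>GG\<^esub> Suc k \<otimes>\<^bsub>GG\<^esub> (inv\<^bsub>GG\<^esub> cl [s] \<otimes>\<^bsub>GG\<^esub> ?x) \<in> PP"
        using move[of "cl [w \<otimes> inv s]"] t(1) by simp
      then show ?thesis using False a gen by (intro exI[of _ "Suc k"]) simp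
    qed
  qed
  then show ?thesis using u word_class_eq_word_val by metis
qed

lemma fraction2:
  assumes "x \<in> carrier GG" "y \<in> carrier GG"
  shows "\<exists>k::nat. \<Delta> [^]\<^bsub>GG\<^esub> k \<otimes>\<^bsub>GG\<^esub> x \<in> PP \<and> \<Delta> [^]\<^bsub>GG\<^esub> k \<otimes>\<^bsub>GG\<^esub> y \<in> PP"
proof -
  have add: "\<Delta> [^]\<^bsub>GG\<^esub> (l + k) \<otimes>\<^bsub>GG\<^esub> z \<in> PP"
    if "z \<in> carrier GG" "\<Delta> [^]\<^bsub>GG\<^esub> k \<otimes>\<^bsub>GG\<^esub> z \<in> PP" for k l :: nat and z
  proof -
    have "\<Delta> [^]\<^bsub>GG\<^esub> (l + k) \<otimes>\<^bsub>GG\<^esub> z = \<Delta> [^]\<^bsub>GG\<^esub> l \<otimes>\<^bsub>GG\<^esub> (\<Delta> [^]\<^bsub>GG\<^esub> k \<otimes>\<^bsub>GG\<^esub> z)"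
      using that \<Delta>_closed by (simp add: GG.m_assoc flip: GG.nat_pow_mult)
    then show ?thesis using PP_closed[OF \<Delta>_pow_PP that(2)] by simp
  qed
  obtain k l :: nat where "\<Delta> [^]\<^bsub>GG\<^esub> k \<otimes>\<^bsub>GG\<^esub> x \<in> PP" "\<Delta> [^]\<^bsub>GG\<^esub> l \<otimes>\<^bsub>GG\<^esub> y \<in> PP"
    using fraction assms by blast
  then show ?thesis
    using add[of x k l] add[of y l k] assms by (intro exI[of _ "k + l"]) (simp add: add.commute)
qed

lemma group_join:
  assumes "x \<in> carrier GG" "y \<in> carrier GG"
  shows "\<exists>m\<in>carrier GG. ldv x m \<and> ldv y m \<and>
    (\<forall>n\<in>carrier GG. ldv x n \<longrightarrow> ldv y n \<longrightarrow> ldv m n)"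
proof -
  obtain k :: nat where k: "\<Delta> [^]\<^bsub>GG\<^esub> k \<otimes>\<^bsub>GG\<^esub> x \<in> PP" "\<Delta> [^]\<^bsub>GG\<^esub> k \<otimes>\<^bsub>GG\<^esub> y \<in> PP"
    using fraction2[OF assms] by blast
  define D where "D = \<Delta> [^]\<^bsub>GG\<^esub> k"
  have D: "D \<in> carrier GG" using \<Delta>_closed by (simp add: D_def)
  obtain m where m: "m \<in> carrier GG" "ldv (D \<otimes>\<^bsub>GG\<^esub> x) m" "ldv (D \<otimes>\<^bsub>GG\<^esub> y) m"
    "\<And>n. n \<in> carrier GG \<Longrightarrow> ldv (D \<otimes>\<^bsub>GG\<^esub> x) n \<Longrightarrow> ldv (D \<otimes>\<^bsub>GG\<^esub> y) n \<Longrightarrow> ldv m n"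
    using k positive_join unfolding D_def[symmetric] by (force simp: PP_def)
  have "ldv (inv\<^bsub>GG\<^esub> D \<otimes>\<^bsub>GG\<^esub> m) n" if "n \<in> carrier GG" "ldv x n" "ldv y n" for n
    using m(4)[of "D \<otimes>\<^bsub>GG\<^esub> n"] ldv_mult_left[of D] ldv_mult_iff[of "inv\<^bsub>GG\<^esub> D" m n] that D m assms
    by simp
  then show ?thesis
    using m D assms ldv_mult_iff by (intro bexI[of _ "inv\<^bsub>GG\<^esub> D \<otimes>\<^bsub>GG\<^esub> m"]) auto
qed

lemma meq_invariants:
  "meq u v \<Longrightarrow> list_prod G u = list_prod G v \<and> sum_list (map len u) = sum_list (map len v)"
proof (induction rule: meq.induct)
  case (meq_germ u v s t)
  then have "set u \<subseteq> carrier G" "set v \<subseteq> carrier G" "s \<in> carrier G" "t \<in> carrier G"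
    using S_carrier by (auto simp: germ_def)
  then show ?case using meq_germ by (auto simp: list_prod_append germ_def m_assoc)
next
  case (meq_one u v)
  then have "set u \<subseteq> carrier G" "set v \<subseteq> carrier G" using S_carrier by auto
  then show ?case by (auto simp: list_prod_append len_one)
qed auto

lemma degree_hom:
  "\<exists>d :: 'a gword set \<Rightarrow> int.
    (\<forall>x\<in>carrier GG. \<forall>y\<in>carrier GG. d (x \<otimes>\<^bsub>GG\<^esub> y) = d x + d y) \<and>
    (\<forall>xs. set xs \<subseteq> S \<longrightarrow> d (cl xs) = int (sum_list (map len xs)))"
proof -
  interpret Z: group integer_group by simp
  let ?f = "\<lambda>x. int (len x)"
  have vp: "word_val integer_group ?f (pos xs) = int (sum_list (map len xs))" for xs
    by (induction xs) (auto simp: integer_group_def)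
  have "\<exists>F\<in>hom GG integer_group. \<forall>u\<in>gwords S. F (word_class S rels u) = word_val integer_group ?f u"
  proof (rule Z.presented_group_hom)
    fix l r assume "(l, r) \<in> rels"
    then obtain u v where "l = pos [u, v]" "r = pos [u \<otimes> v]" "len (u \<otimes> v) = len u + len v"
      by (auto simp: rels_def)
    then show "word_val integer_group ?f l = word_val integer_group ?f r"
      by (simp only: vp) simp
  qed auto
  then obtain F where F: "F \<in> hom GG integer_group"
    "\<And>u. u \<in> gwords S \<Longrightarrow> F (word_class S rels u) = word_val integer_group ?f u"
    by blast
  show ?thesis
  proof (intro exI[of _ F] conjI ballI allI impI)
    show "F (x \<otimes>\<^bsub>GG\<^esub> y) = F x + F y" if "x \<in> carrier GG" "y \<in> carrier GG" for x y
      using hom_mult[OF F(1) that] by (simp add: integer_group_def)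
    show "F (cl xs) = int (sum_list (map len xs))" if "set xs \<subseteq> S" for xs
      using F(2) that by (simp add: cl_def vp)
  qed
qed

lemma len_list_prod: "set u \<subseteq> carrier G \<Longrightarrow> len (list_prod G u) \<le> sum_list (map len u)"
proof (induction u)
  case (Cons a u)
  then show ?case using len_mult[of a "list_prod G u"] by auto
qed (simp add: len_one)

lemma meq_short_word:
  assumes "set u \<subseteq> S" "list_prod G u \<in> S" "len (list_prod G u) = sum_list (map len u)"
  shows "meq u [list_prod G u]"
  using assms
proof (induction u)
  case Nil
  show ?case using meq_sym[OF meq_one[of "[]" "[]"]] by simp
next
  case (Cons s u)
  let ?p = "list_prod G u"
  have c: "s \<in> carrier G" "set u \<subseteq> carrier G" using Cons.prems S_carrier by auto
  have prec: "len ?p \<le> sum_list (map len u)" using len_list_prod c by blast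
  then have eq: "len ?p = sum_list (map len u)" "len (s \<otimes> ?p) = len s + len ?p"
    using Cons.prems len_mult[of s ?p] c by auto
  then have "prec s (s \<otimes> ?p)" using c by (simp add: le_mult_iff)
  then have "germ s ?p" "?p \<in> S"
    using germI_le[of "s \<otimes> ?p" s] S_right_factor[of "s \<otimes> ?p" s] Cons.prems c by auto
  then have "meq [s, ?p] [s \<otimes> ?p]" using meq_germ_Cons[of s ?p "[]"] by simp
  moreover have "meq (s # u) [s, ?p]"
    using Cons eq \<open>?p \<in> S\<close> by (auto intro: meq_Cons)
  ultimately show ?case by (auto intro: meq_trans)
qed

text \<open>
  Positive words with product \<open>\<Delta>\<close> have product \<open>w\<close> in the group and total length \<open>len w\<close>, so they
  are shortest factorisations and their parts multiply to elements of \<open>S\<close>.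
\<close>

lemma factor_of_\<Delta>:
  assumes "set u \<subseteq> S" "set v \<subseteq> S" "cl u \<otimes>\<^bsub>GG\<^esub> cl v = \<Delta>"
  shows "cl u \<in> (\<lambda>s. cl [s]) ` S" "cl v \<in> (\<lambda>s. cl [s]) ` S"
proof -
  have c: "set u \<subseteq> carrier G" "set v \<subseteq> carrier G" using assms S_carrier by auto
  let ?g = "list_prod G u" and ?h = "list_prod G v"
  have "meq (u @ v) [w]"
    using assms cl_append[of u v] cl_eq_iff[of "u @ v" "[w]"] w_in_S by simp
  then have gh: "?g \<otimes> ?h = w" and "sum_list (map len u) + sum_list (map len v) = len w"
    using meq_invariants[of "u @ v" "[w]"] c by (auto simp: list_prod_append)
  moreover have "len w \<le> len ?g + len ?h" using len_mult[of ?g ?h] c gh by simp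
  ultimately have len: "len ?g = sum_list (map len u)" "len ?h = sum_list (map len v)"
    "len w = len ?g + len ?h"
    using len_list_prod[OF c(1)] len_list_prod[OF c(2)] by linarith+
  have g: "?g \<in> S" using len gh le_mult_iff[of ?g ?h] c by (simp add: S_def)
  have "?h = inv ?g \<otimes> w" using gh[symmetric] c by simp
  then have h: "?h \<in> S" using complement_in_S[OF g] by simp
  have "cl u = cl [?g]" "cl v = cl [?h]"
    using meq_short_word len g h assms cl_eq_iff by auto
  then show "cl u \<in> (\<lambda>s. cl [s]) ` S" "cl v \<in> (\<lambda>s. cl [s]) ` S" using g h by auto
qed

theorem garside: "garside_group GG"
proof -
  obtain d :: "'a gword set \<Rightarrow> int" where d:
    "\<And>x y. x \<in> carrier GG \<Longrightarrow> y \<in> carrier GG \<Longrightarrow> d (x \<otimes>\<^bsub>GG\<^esub> y) = d x + d y"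
    "\<And>xs. set xs \<subseteq> S \<Longrightarrow> d (cl xs) = int (sum_list (map len xs))"
    using degree_hom by auto
  interpret C: lattice_cone GG PP d
  proof
    show "PP \<subseteq> carrier GG" by (rule PP_carrier)
    show "\<one>\<^bsub>GG\<^esub> \<in> PP" using cl_in_PP[of "[]"] by (simp add: cl_Nil)
    show "x \<otimes>\<^bsub>GG\<^esub> y \<in> PP" if "x \<in> PP" "y \<in> PP" for x y using PP_closed that .
    show "d (x \<otimes>\<^bsub>GG\<^esub> y) = d x + d y" if "x \<in> carrier GG" "y \<in> carrier GG" for x y
      using d that by blast
    show "d x \<ge> 0" if "x \<in> PP" for x using that d by (auto simp: PP_def)
    show "x = \<one>\<^bsub>GG\<^esub>" if x: "x \<in> PP" "d x = 0" for x
    proof -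
      obtain xs where xs: "set xs \<subseteq> S" "x = cl xs" using x by (auto simp: PP_def)
      then have "\<forall>s\<in>set xs. len s = 0" using x(2) d(2)[OF xs(1)] by auto
      then have "set xs \<subseteq> {\<one>}" using xs(1) len_eq_0 S_carrier by blast
      then have "cl xs = \<one>\<^bsub>GG\<^esub>"
        using xs(1)
      proof (induction xs)
        case (Cons s xs)
        then have "s = \<one>" "cl xs = \<one>\<^bsub>GG\<^esub>" "set xs \<subseteq> S" by simp_all
        then show ?case
          using cl_Cons[OF one_in_S, of xs] cl_one GG.l_one[OF GG.one_closed] by metis
      qed (simp add: cl_Nil)
      then show ?thesis using xs by simp
    qed
    show "\<exists>z\<in>carrier GG. inv\<^bsub>GG\<^esub> z \<otimes>\<^bsub>GG\<^esub> x \<in> PP \<and> inv\<^bsub>GG\<^esub> z \<otimes>\<^bsub>GG\<^esub> y \<in> PP"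
      if xy: "x \<in> carrier GG" "y \<in> carrier GG" for x y
    proof -
      obtain k :: nat where "\<Delta> [^]\<^bsub>GG\<^esub> k \<otimes>\<^bsub>GG\<^esub> x \<in> PP" "\<Delta> [^]\<^bsub>GG\<^esub> k \<otimes>\<^bsub>GG\<^esub> y \<in> PP"
        using fraction2[OF xy] by blast
      then show ?thesis
        using GG.nat_pow_closed[OF \<Delta>_closed, of k]
        by (intro bexI[of _ "inv\<^bsub>GG\<^esub> (\<Delta> [^]\<^bsub>GG\<^esub> k)"]) simp_all
    qed
    show "\<exists>m\<in>carrier GG. inv\<^bsub>GG\<^esub> x \<otimes>\<^bsub>GG\<^esub> m \<in> PP \<and> inv\<^bsub>GG\<^esub> y \<otimes>\<^bsub>GG\<^esub> m \<in> PP \<and>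
        (\<forall>n\<in>carrier GG. inv\<^bsub>GG\<^esub> x \<otimes>\<^bsub>GG\<^esub> n \<in> PP \<longrightarrow> inv\<^bsub>GG\<^esub> y \<otimes>\<^bsub>GG\<^esub> n \<in> PP \<longrightarrow>
          inv\<^bsub>GG\<^esub> m \<otimes>\<^bsub>GG\<^esub> n \<in> PP)"
      if "x \<in> carrier GG" "y \<in> carrier GG" for x y
      using group_join[OF that] unfolding ldv_def .
  qed
  let ?M = "GG\<lparr>carrier := PP\<rparr>" and ?D = "(\<lambda>s. cl [s]) ` S"
  have D_PP: "?D \<subseteq> PP" by auto
  have left: "{x \<in> PP. left_divides ?M x \<Delta>} = ?D"
  proof -
    have "cl [s] \<in> {x \<in> PP. left_divides ?M x \<Delta>}" if "s \<in> S" for s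
    proof -
      have "\<Delta> = cl [s] \<otimes>\<^bsub>GG\<^esub> cl [inv s \<otimes> w]"
        using cl_germ[OF germ_complement[OF that]] that S_carrier by simp
      then show ?thesis using that complement_in_S by (auto simp: left_divides_def)
    qed
    moreover have "x \<in> ?D" if x: "x \<in> PP" "left_divides ?M x \<Delta>" for x
    proof -
      obtain c where c: "c \<in> PP" "x \<otimes>\<^bsub>GG\<^esub> c = \<Delta>" using x by (auto simp: left_divides_def)
      obtain u v where "set u \<subseteq> S" "set v \<subseteq> S" "x = cl u" "c = cl v"
        using x c by (auto simp: PP_def)
      with c factor_of_\<Delta> show ?thesis by blast
    qed
    ultimately show ?thesis by auto
  qed
  have right: "{x \<in> PP. right_divides ?M x \<Delta>} = ?D"
  proof -
    have "cl [s] \<in> {x \<in> PP. right_divides ?M x \<Delta>}" if "s \<in> S" for s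
    proof -
      have s: "s \<in> carrier G" using that S_carrier by blast
      have "cj (ci s) = s" "(inv (ci s) \<otimes> w) \<otimes> s = w"
        using s by (simp_all add: inv_mult_group m_assoc)
      then have "\<Delta> = cl [inv (ci s) \<otimes> w] \<otimes>\<^bsub>GG\<^esub> cl [s]"
        using cl_germ[OF germ_complement_cj[OF S_conj_inv[OF that]]] by simp
      then show ?thesis
        using that complement_in_S[OF S_conj_inv[OF that]] by (auto simp: right_divides_def)
    qed
    moreover have "x \<in> ?D" if x: "x \<in> PP" "right_divides ?M x \<Delta>" for x
    proof -
      obtain c where c: "c \<in> PP" "c \<otimes>\<^bsub>GG\<^esub> x = \<Delta>" using x by (auto simp: right_divides_def)
      obtain u v where "set u \<subseteq> S" "set v \<subseteq> S" "c = cl u" "x = cl v"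
        using x c by (auto simp: PP_def)
      with c factor_of_\<Delta> show ?thesis by blast
    qed
    ultimately show ?thesis by auto
  qed
  have gen: "\<exists>xs. set xs \<subseteq> ?D \<and> list_prod ?M xs = x" if x: "x \<in> PP" for x
  proof -
    obtain u where u: "set u \<subseteq> S" "x = cl u" using x by (auto simp: PP_def)
    have "list_prod ?M (map (\<lambda>s. cl [s]) u) = cl u"
      using u(1)
    proof (induction u)
      case (Cons s u)
      then show ?case using cl_Cons[of s u] by simp
    qed (simp add: cl_Nil)
    then show ?thesis using u by (intro exI[of _ "map (\<lambda>s. cl [s]) u"]) auto
  qed
  have "garside_monoid ?M"
    unfolding garside_monoid_def
  proof (intro conjI)
    show "\<exists>\<Delta>\<in>carrier ?M.
       {x \<in> carrier ?M. left_divides ?M x \<Delta>} = {x \<in> carrier ?M. right_divides ?M x \<Delta>} \<and>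
       finite {x \<in> carrier ?M. left_divides ?M x \<Delta>} \<and>
       (\<forall>x\<in>carrier ?M. \<exists>xs. set xs \<subseteq> {x \<in> carrier ?M. left_divides ?M x \<Delta>} \<and> list_prod ?M xs = x)"
      using left right gen finite_S \<Delta>_PP by (intro bexI[of _ \<Delta>]) auto
  qed (use C.monoid_cone C.cone_cancel C.Units_cone C.left_lcms_gcds C.right_lcms_gcds in auto)
  moreover have "is_group_of_fractions GG ?M"
    unfolding is_group_of_fractions_def
  proof (intro conjI bexI[of _ "\<lambda>x. x"] ballI)
    fix x assume x: "x \<in> carrier GG"
    obtain k :: nat where k: "\<Delta> [^]\<^bsub>GG\<^esub> k \<otimes>\<^bsub>GG\<^esub> x \<in> PP" using fraction x by blast
    show "\<exists>a\<in>carrier ?M. \<exists>b\<in>carrier ?M. x = inv\<^bsub>GG\<^esub> a \<otimes>\<^bsub>GG\<^esub> b"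
      using k x \<Delta>_closed \<Delta>_pow_PP
      by (intro bexI[of _ "\<Delta> [^]\<^bsub>GG\<^esub> k"] bexI[of _ "\<Delta> [^]\<^bsub>GG\<^esub> k \<otimes>\<^bsub>GG\<^esub> x"]) auto
  qed (use PP_carrier group_presented_group in \<open>auto simp: hom_def\<close>)
  ultimately show ?thesis
    unfolding garside_group_def by blast
qed

end

section \<open>Factorisations into three factors\<close>

context group
begin

definition cnj :: "'a \<Rightarrow> 'a \<Rightarrow> 'a" where
  "cnj d x = inv d \<otimes> x \<otimes> d"

lemma cnj_closed [simp]: "d \<in> carrier G \<Longrightarrow> x \<in> carrier G \<Longrightarrow> cnj d x \<in> carrier G"
  by (simp add: cnj_def)

lemma cnj_pow_closed [simp]:
  "d \<in> carrier G \<Longrightarrow> x \<in> carrier G \<Longrightarrow> (cnj d ^^ i) x \<in> carrier G"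
  by (induction i) auto

lemma cnj_eqI: "\<lbrakk>d \<in> carrier G; x \<in> carrier G; y \<in> carrier G; d \<otimes> y = x \<otimes> d\<rbrakk> \<Longrightarrow> cnj d x = y"
  unfolding cnj_def by (metis conj_eq_iff)

lemma cnj_inj: "\<lbrakk>d \<in> carrier G; x \<in> carrier G; y \<in> carrier G; cnj d x = cnj d y\<rbrakk> \<Longrightarrow> x = y"
  by (simp add: cnj_def)

text \<open>
  A factorisation of \<open>d\<close> into three factors can be rotated, any two factors determine the third, and
  two adjacent factors can be replaced by others with the same product.
\<close>

definition tri :: "'a \<Rightarrow> 'a \<Rightarrow> 'a \<Rightarrow> 'a \<Rightarrow> bool" where
  "tri d x y z \<longleftrightarrow> d \<in> carrier G \<and> x \<in> carrier G \<and> y \<in> carrier G \<and> z \<in> carrier G \<and>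
     x \<otimes> (y \<otimes> z) = d"

lemma tri_closed:
  "tri d x y z \<Longrightarrow> d \<in> carrier G \<and> x \<in> carrier G \<and> y \<in> carrier G \<and> z \<in> carrier G"
  by (simp add: tri_def)

lemma tri_rotate: "tri d x y z \<Longrightarrow> tri d y z (cnj d x)"
  by (auto simp: tri_def cnj_def m_assoc inv_mult_group)

lemma tri_cnj: "tri d x y z \<Longrightarrow> tri d (cnj d x) (cnj d y) (cnj d z)"
  by (intro tri_rotate)

lemma tri_cnj_pow:
  "tri d x y z \<Longrightarrow> tri d ((cnj d ^^ i) x) ((cnj d ^^ i) y) ((cnj d ^^ i) z)"
  by (induction i) (auto intro: tri_cnj)

lemma tri_unique:
  "tri d x y z \<Longrightarrow> tri d x' y z \<Longrightarrow> x = x'"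
  "tri d x y z \<Longrightarrow> tri d x y' z \<Longrightarrow> y = y'"
  "tri d x y z \<Longrightarrow> tri d x y z' \<Longrightarrow> z = z'"
  by (auto simp: tri_def)

lemma tri_left:
  assumes "tri d x y z" "x \<otimes> y = x' \<otimes> y'" "x' \<in> carrier G" "y' \<in> carrier G"
  shows "tri d x' y' z"
  using assms by (auto simp: tri_def m_assoc[symmetric])

lemma tri_right:
  assumes "tri d x y z" "y \<otimes> z = y' \<otimes> z'" "y' \<in> carrier G" "z' \<in> carrier G"
  shows "tri d x y' z'"
  using assms by (auto simp: tri_def)

text \<open>
  The pair \<open>(j, i)\<close> names the conjugate by \<open>d\<^sup>i\<close> of the \<open>j\<close>-th orbit representative.
\<close>

definition orb :: "'a \<Rightarrow> 'a list \<Rightarrow> nat \<times> nat \<Rightarrow> 'a" where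
  "orb d hs p = (cnj d ^^ snd p) (hs ! fst p)"

end

type_synonym triple = "(nat \<times> nat) \<times> (nat \<times> nat) \<times> (nat \<times> nat)"

text \<open>
  The reflection factorisations of a product \<open>a c b\<close> of the simple reflections of \<open>H\<^sub>3\<close>, up to
  simultaneous conjugation by that product; the orbits of \<open>a\<close>, \<open>b\<close>, \<open>c\<close> have numbers 0, 1, 2.
\<close>

definition H3_triples :: "triple list" where
  "H3_triples =
    [((0,0),(1,0),(2,1)), ((1,0),(0,1),(2,1)), ((0,1),(2,2),(2,1)), ((2,2),(2,4),(2,1)),
     ((2,4),(0,0),(2,1)),
     ((2,0),(1,0),(0,1)), ((1,0),(2,1),(0,1)), ((2,1),(2,0),(0,1)),
     ((0,0),(2,0),(1,0)), ((2,0),(0,0),(1,0))]"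

text \<open>
  The same for the product \<open>c b a\<close> that represents \<open>H\<^sub>3(a\<^sub>2)\<close>.  Conjugation by it has order three on the
  reflections; the five orbits are those of \<open>a\<close>, \<open>b\<close>, \<open>c\<close>, \<open>b\<^sup>-\<^sup>1 c b\<close> and \<open>c b c\<^sup>-\<^sup>1\<close>.
\<close>

definition H3_a2_triples :: "triple list" where
  "H3_a2_triples =
    [((2,0),(1,0),(0,0)), ((1,0),(3,0),(0,0)), ((3,0),(1,1),(0,0)), ((1,1),(4,0),(0,0)),
     ((4,0),(2,0),(0,0)),
     ((0,0),(3,1),(1,2)), ((3,1),(0,1),(1,2)), ((0,1),(2,2),(1,2)), ((2,2),(4,0),(1,2)),
     ((4,0),(0,0),(1,2)),
     ((1,1),(0,0),(3,1)), ((0,0),(1,1),(3,1)),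
     ((0,0),(4,1),(2,1)), ((4,1),(1,0),(2,1)), ((1,0),(0,0),(2,1)),
     ((0,0),(1,2),(4,1)), ((1,2),(2,0),(4,1)), ((2,0),(0,0),(4,1))]"

context group
begin

lemma funpow_eqs:
  "(f ^^ 2) x = f (f x)" "(f ^^ 3) x = f (f (f x))" "(f ^^ 4) x = f (f (f (f x)))"
  "(f ^^ 5) x = f (f (f (f (f x))))"
  by (simp_all add: eval_nat_numeral)

text \<open>
  Write \<open>x\<^sub>i\<close> for the conjugate of \<open>x\<close> by \<open>d\<^sup>i\<close>.  The braid relations give \<open>a c b = d\<close>, its variants within the
  pentagon of \<open>a\<close>, \<open>b\<close> and the triangle of \<open>b\<close>, \<open>c\<close>, and rotations of these, where the last vertex
  \<open>X = a b a\<^sup>-\<^sup>1\<close> of the pentagon satisfies \<open>X\<^sub>1 = c\<close>.  The factorisation \<open>c\<^sub>2 X c\<^sub>1 = d\<close>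
  rotates to \<open>X c\<^sub>1 c\<^sub>3 = d\<close> and conjugates to \<open>c\<^sub>4 c\<^sub>1 c\<^sub>3 = d\<close>, so \<open>X = c\<^sub>4\<close> and \<open>c\<^sub>5 = X\<^sub>1 = c\<close>.  The other generators
  are determined by \<open>c\<close> and \<open>d\<close>.
\<close>

lemma artin_H3_triples_if_relations:
  assumes c: "a \<in> carrier G" "b \<in> carrier G" "c \<in> carrier G"
    and ab: "a \<otimes> (b \<otimes> (a \<otimes> (b \<otimes> a))) = b \<otimes> (a \<otimes> (b \<otimes> (a \<otimes> b)))"
    and bc: "b \<otimes> (c \<otimes> b) = c \<otimes> (b \<otimes> c)"
    and ac: "a \<otimes> c = c \<otimes> a"
  defines "d \<equiv> a \<otimes> (c \<otimes> b)"
  shows "\<forall>x\<in>{a, b, c}. (cnj d ^^ 5) x = x"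
    and "\<forall>(p, q, r)\<in>set H3_triples. tri d (orb d [a, b, c] p) (orb d [a, b, c] q) (orb d [a, b, c] r)"
proof -
  have d: "d \<in> carrier G" using c by (simp add: d_def)
  let ?t = "cnj d"
  define X where "X = a \<otimes> (b \<otimes> inv a)"
  have X: "X \<in> carrier G" "X \<otimes> a = a \<otimes> b" using c by (simp_all add: X_def m_assoc)
  have acb: "tri d a c b" using c d by (simp add: tri_def d_def)
  have cab: "tri d c a b" using tri_left[OF acb ac] c by simp
  have abc1: "tri d a b (?t c)" using cab by (rule tri_rotate)
  have bca1: "tri d b (?t c) (?t a)" using abc1 by (rule tri_rotate)
  have cba1: "tri d c b (?t a)" using acb by (rule tri_rotate)
  have ba1c1: "tri d b (?t a) (?t c)" using cba1 by (rule tri_rotate)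
  have Xac1: "tri d X a (?t c)" using tri_left[OF abc1] X c by simp
  \<comment> \<open>the braid relation of \<open>b\<close> and \<open>c\<close> closes the triangle \<open>c b = b c\<^sub>1 = c\<^sub>1 c\<close>\<close>
  have "tri d a b (inv b \<otimes> (c \<otimes> b))" using tri_right[OF acb] c by simp
  then have c1: "?t c = inv b \<otimes> (c \<otimes> b)" using tri_unique(3) abc1 by blast
  have "c \<otimes> b = ?t c \<otimes> c" using c by (simp add: c1 m_assoc flip: bc)
  then have ac1c: "tri d a (?t c) c" using tri_right[OF acb] c d by simp
  have c1ca1: "tri d (?t c) c (?t a)" using ac1c by (rule tri_rotate)
  have X1: "?t X = c" using tri_unique(3)[OF tri_rotate[OF Xac1] ac1c] .
  have a1c2c1: "tri d (?t a) (?t (?t c)) (?t c)" using tri_cnj[OF ac1c] .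
  \<comment> \<open>the pentagon \<open>u = a b = b a\<^sub>1 = a\<^sub>1 c\<^sub>2 = c\<^sub>2 X = X a\<close>\<close>
  define u where "u = a \<otimes> b"
  have u: "u \<in> carrier G" using c by (simp add: u_def)
  have "tri d b (inv b \<otimes> u) (?t c)" using tri_left[OF abc1] c u by (simp add: u_def)
  then have a1: "?t a = inv b \<otimes> u" using tri_unique(2) ba1c1 by blast
  have "tri d (?t a) (inv (?t a) \<otimes> u) (?t c)" using tri_left[OF abc1] c u d by (simp add: u_def)
  then have c2: "?t (?t c) = inv (?t a) \<otimes> u" using tri_unique(2) a1c2c1 by blast
  have buu: "b \<otimes> (u \<otimes> u) = (u \<otimes> u) \<otimes> a" using ab c by (simp add: u_def m_assoc)
  have Xu: "X = u \<otimes> inv a" using c by (simp add: X_def u_def m_assoc)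
  have "?t (?t c) \<otimes> X = inv u \<otimes> ((b \<otimes> (u \<otimes> u)) \<otimes> inv a)"
    using c u by (simp add: c2 a1 Xu inv_mult_group m_assoc)
  also have "\<dots> = u" unfolding buu using c u by (simp add: m_assoc)
  finally have c2X: "?t (?t c) \<otimes> X = u" .
  have c2Xc1: "tri d (?t (?t c)) X (?t c)"
    using tri_left[OF abc1] c d X c2X by (simp add: u_def)
  have "tri d (?t (?t (?t (?t c)))) (?t c) (?t (?t (?t c)))"
    using tri_cnj[OF tri_cnj[OF c2Xc1]] by (simp add: X1)
  then have X4: "?t (?t (?t (?t c))) = X"
    using tri_rotate[OF c2Xc1] tri_unique(1) by blast
  have c5: "?t (?t (?t (?t (?t c)))) = c" by (simp add: X4 X1)
  have "tri d (?t (?t (?t (?t (?t (?t a)))))) (?t (?t c)) (?t c)"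
    using tri_cnj_pow[OF a1c2c1, of 5] by (simp add: funpow_eqs c5)
  from tri_unique(1)[OF this a1c2c1]
  have a5: "?t (?t (?t (?t (?t a)))) = a"
    by (rule cnj_inj[OF d _ c(1), rotated]) (simp add: c d)
  have "tri d a c (?t (?t (?t (?t (?t b)))))"
    using tri_cnj_pow[OF acb, of 5] by (simp add: funpow_eqs c5 a5)
  from tri_unique(3)[OF this acb] have b5: "?t (?t (?t (?t (?t b)))) = b" .
  show "\<forall>x\<in>{a, b, c}. (?t ^^ 5) x = x"
    using a5 b5 c5 by (simp add: funpow_eqs)
  show "\<forall>(p, q, r)\<in>set H3_triples. tri d (orb d [a, b, c] p) (orb d [a, b, c] q) (orb d [a, b, c] r)"
    using abc1 ba1c1 a1c2c1 c2Xc1 Xac1 cba1 bca1 c1ca1 acb cab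
    by (simp add: H3_triples_def orb_def funpow_eqs X4)
qed

text \<open>
  The fourth relation says that \<open>d\<close> conjugates \<open>b\<close> to the element of the pentagon of \<open>b\<close>, \<open>c\<close> to which
  \<open>v = c b\<close> conjugates it.  The last one says that \<open>d\<^sup>3\<close> commutes with \<open>a\<close>.  Two steps of the pentagon and the
  triangle of \<open>a\<close>, \<open>c\<close> then show that \<open>d\<^sup>3\<close> commutes with \<open>b\<close>, and hence with everything.
\<close>

lemma H3_a2_triples_if_relations:
  assumes c: "a \<in> carrier G" "b \<in> carrier G" "c \<in> carrier G"
    and ab: "a \<otimes> (b \<otimes> a) = b \<otimes> (a \<otimes> b)"
    and ac: "a \<otimes> (c \<otimes> a) = c \<otimes> (a \<otimes> c)"
    and bc: "b \<otimes> (c \<otimes> (b \<otimes> (c \<otimes> b))) = c \<otimes> (b \<otimes> (c \<otimes> (b \<otimes> c)))"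
    and bcbacb: "b \<otimes> (c \<otimes> (b \<otimes> (a \<otimes> (c \<otimes> b)))) = c \<otimes> (b \<otimes> (a \<otimes> (c \<otimes> (b \<otimes> c))))"
    and cube: "c \<otimes> (b \<otimes> (a \<otimes> (c \<otimes> (b \<otimes> (a \<otimes> (c \<otimes> (b \<otimes> a)))))))
             = a \<otimes> (c \<otimes> (b \<otimes> (a \<otimes> (c \<otimes> (b \<otimes> (a \<otimes> (c \<otimes> b)))))))"
  defines "d \<equiv> c \<otimes> (b \<otimes> a)" and "hs \<equiv> [a, b, c, inv b \<otimes> (c \<otimes> b), c \<otimes> (b \<otimes> inv c)]"
  shows "\<forall>x\<in>set hs. (cnj d ^^ 3) x = x"
    and "\<forall>(p, q, r)\<in>set H3_a2_triples. tri d (orb d hs p) (orb d hs q) (orb d hs r)"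
proof -
  have d: "d \<in> carrier G" using c by (simp add: d_def)
  let ?t = "cnj d"
  define D where "D = inv b \<otimes> (c \<otimes> b)"
  define E where "E = c \<otimes> (b \<otimes> inv c)"
  define v where "v = c \<otimes> b"
  have v: "v \<in> carrier G" using c by (simp add: v_def)
  have dv: "d = v \<otimes> a" using c by (simp add: d_def v_def m_assoc)
  have D: "D \<in> carrier G" "b \<otimes> D = c \<otimes> b" using c by (simp_all add: D_def)
  have E: "E \<in> carrier G" "E \<otimes> c = c \<otimes> b" using c by (simp_all add: E_def m_assoc)
  have cba: "tri d c b a" using c d by (simp add: tri_def d_def)
  have bDa: "tri d b D a" using tri_left[OF cba] D c by simp
  have Eca: "tri d E c a" using tri_left[OF cba] E c by simp
  \<comment> \<open>the pentagon \<open>v = c b = b D = D b\<^sub>1 = b\<^sub>1 E = E c\<close>, where \<open>b\<^sub>1 = v c v\<^sup>-\<^sup>1\<close>\<close>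
  have "d \<otimes> (v \<otimes> (c \<otimes> inv v)) = b \<otimes> d"
  proof -
    have "d \<otimes> (v \<otimes> c) = (b \<otimes> d) \<otimes> v"
      using bcbacb c by (simp add: d_def v_def m_assoc)
    then show ?thesis using c d v by (simp add: m_assoc[symmetric]) (simp add: m_assoc)
  qed
  then have b1: "?t b = v \<otimes> (c \<otimes> inv v)" using c d v by (intro cnj_eqI) simp_all
  have b1E: "?t b \<otimes> E = c \<otimes> b"
    using c by (simp add: b1 E_def v_def m_assoc inv_mult_group)
  have "D \<otimes> (v \<otimes> c) = v \<otimes> v"
  proof -
    have "b \<otimes> (D \<otimes> (v \<otimes> c)) = b \<otimes> (v \<otimes> v)"
      using bc c by (simp add: D_def v_def m_assoc)
    then show ?thesis using c D v by simp
  qed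
  then have Db1: "D \<otimes> ?t b = c \<otimes> b"
    using c D v unfolding b1
    by (metis (no_types, lifting) inv_closed m_assoc m_closed r_inv r_one v_def)
  have Db1a: "tri d D (?t b) a" using tri_left[OF cba] Db1 c d D by simp
  have b1Ea: "tri d (?t b) E a" using tri_left[OF cba] b1E c d E by simp
  have bac1: "tri d b a (?t c)" using cba by (rule tri_rotate)
  \<comment> \<open>\<open>F\<close> and \<open>K\<close> complete the triangles of \<open>a\<close>, \<open>b\<close> and of \<open>a\<close>, \<open>c\<close>\<close>
  define F where "F = b \<otimes> (a \<otimes> inv b)"
  have F: "F \<in> carrier G" "F \<otimes> b = b \<otimes> a" using c by (simp_all add: F_def m_assoc)
  have "a \<otimes> (b \<otimes> a) \<otimes> inv b = b \<otimes> a" using c by (simp add: ab m_assoc)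
  then have aF: "a \<otimes> F = b \<otimes> a" using c by (simp add: F_def m_assoc)
  have cFb: "tri d c F b" using tri_right[OF cba] F c by simp
  have caF: "tri d c a F" using tri_right[OF cba] aF F c by simp
  define K where "K = c \<otimes> (a \<otimes> inv c)"
  have K: "K \<in> carrier G" "K \<otimes> c = c \<otimes> a" using c by (simp_all add: K_def m_assoc)
  have "a \<otimes> (c \<otimes> a) \<otimes> inv c = c \<otimes> a" using c by (simp add: ac m_assoc)
  then have aK: "a \<otimes> K = c \<otimes> a" using c by (simp add: K_def m_assoc)
  have aKF: "tri d a K F" using tri_left[OF caF] aK K c by simp
  have KcF: "tri d K c F" using tri_left[OF caF] K c by simp
  have E1: "?t E = F" using tri_unique(3)[OF tri_rotate[OF Eca] caF] .
  have K1: "?t K = b" using tri_unique(3)[OF tri_rotate[OF KcF] cFb] .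
  have Fbc1: "tri d F b (?t c)" using cFb by (rule tri_rotate)
  have aFc1: "tri d a F (?t c)" using caF by (rule tri_rotate)
  \<comment> \<open>\<open>b\<^sub>1\<close> is the conjugate of \<open>b\<close> both by \<open>d = v a\<close> and by \<open>v\<close>, hence commutes with \<open>a\<close>\<close>
  have vb1: "v \<otimes> ?t b = b \<otimes> v"
  proof -
    have "v \<otimes> ?t b = b \<otimes> (D \<otimes> ?t b)" using c d D by (simp add: v_def m_assoc[symmetric])
    then show ?thesis by (simp add: Db1 v_def)
  qed
  have ab1: "a \<otimes> ?t b = ?t b \<otimes> a"
  proof -
    have "d \<otimes> ?t b = b \<otimes> d" using c d by (simp add: cnj_def m_assoc)
    then have "v \<otimes> (a \<otimes> ?t b) = (b \<otimes> v) \<otimes> a" using c d v by (simp add: dv m_assoc)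
    also have "\<dots> = v \<otimes> (?t b \<otimes> a)" using c d v by (simp add: vb1[symmetric] m_assoc)
    finally show ?thesis using c d v by simp
  qed
  have Dab1: "tri d D a (?t b)" using tri_right[OF Db1a ab1[symmetric]] c d by simp
  have b1aD1: "tri d (?t b) a (?t D)" using Db1a by (rule tri_rotate)
  have ab1D1: "tri d a (?t b) (?t D)" using Dab1 by (rule tri_rotate)
  have aD1b2: "tri d a (?t D) (?t (?t b))" using b1aD1 by (rule tri_rotate)
  have D1a1b2: "tri d (?t D) (?t a) (?t (?t b))" using Dab1 by (rule tri_cnj)
  have Eab2: "tri d E a (?t (?t b))" using b1Ea by (rule tri_rotate)
  define A where "A = v \<otimes> (a \<otimes> inv v)"
  have A: "A \<in> carrier G" "A \<otimes> v = d" using c v by (simp_all add: A_def dv m_assoc)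
  have Acb: "tri d A c b" using A c d by (simp add: tri_def v_def)
  have A1: "?t A = a" using tri_unique(3)[OF tri_rotate[OF Acb] cba] .
  have a1c2b2: "tri d (?t a) (?t (?t c)) (?t (?t b))"
    using tri_cnj[OF tri_cnj[OF Acb]] by (simp add: A1)
  have b2: "?t (?t b) = K"
  proof (rule cnj_eqI)
    have "?t b \<otimes> d = v \<otimes> (c \<otimes> a)"
      unfolding b1 unfolding dv using c v by (simp add: m_assoc)
    also have "\<dots> = d \<otimes> K" using c v K by (simp add: dv m_assoc aK)
    finally show "d \<otimes> K = ?t b \<otimes> d" by simp
  qed (use c d K in auto)
  have b3: "?t (?t (?t b)) = b" by (simp add: b2 K1)
  have a3: "?t (?t (?t a)) = a"
  proof -
    have "(d \<otimes> (d \<otimes> d)) \<otimes> a = a \<otimes> (d \<otimes> (d \<otimes> d))"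
      using arg_cong[OF cube, of "\<lambda>x. x \<otimes> a"] c by (simp add: d_def m_assoc)
    then have "cnj (d \<otimes> (d \<otimes> d)) a = a" using c d by (intro cnj_eqI) simp_all
    then show ?thesis using c d by (simp add: cnj_def inv_mult_group m_assoc)
  qed
  have t3: "tri d (?t (?t (?t x))) (?t (?t (?t y))) (?t (?t (?t z)))" if "tri d x y z" for x y z
    by (intro tri_cnj that)
  have "tri d (?t (?t (?t c))) b a" using t3[OF cba] by (simp add: a3 b3)
  from tri_unique(1)[OF this cba] have c3: "?t (?t (?t c)) = c" .
  have "tri d b (?t (?t (?t D))) a" using t3[OF bDa] by (simp add: a3 b3)
  from tri_unique(2)[OF this bDa] have D3: "?t (?t (?t D)) = D" .
  have "tri d (?t (?t (?t E))) c a" using t3[OF Eca] by (simp add: a3 c3)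
  from tri_unique(1)[OF this Eca] have E3: "?t (?t (?t E)) = E" .
  have c2Eb2: "tri d (?t (?t c)) E (?t (?t b))"
    using tri_cnj[OF tri_cnj[OF cFb]] by (simp add: E3 flip: E1)
  have hs: "hs = [a, b, c, D, E]" by (simp add: hs_def D_def E_def)
  show "\<forall>x\<in>set hs. (?t ^^ 3) x = x"
    by (simp add: hs funpow_eqs a3 b3 c3 D3 E3)
  show "\<forall>(p, q, r)\<in>set H3_a2_triples. tri d (orb d hs p) (orb d hs q) (orb d hs r)"
    using cba bDa Db1a b1Ea Eca aD1b2 D1a1b2 a1c2b2 c2Eb2 Eab2 b1aD1 ab1D1 aFc1 Fbc1 bac1
      aKF KcF caF
    by (simp add: H3_a2_triples_def hs orb_def funpow_eqs E1 b2)
qed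

end

context group
begin

text \<open>
  In a dihedral factorisation pattern \<open>u = p\<^sub>1 p\<^sub>2 = p\<^sub>2 p\<^sub>3 = \<dots> = p\<^sub>m p\<^sub>1\<close> one has \<open>p\<^sub>i u = u p\<^sub>i\<^sub>+\<^sub>2\<close>, and going round once
  gives the braid relation of length \<open>m\<close> between \<open>p\<^sub>1\<close> and \<open>p\<^sub>2\<close>.
\<close>

lemma pentagon_relation:
  assumes "x \<in> carrier G" "y \<in> carrier G" "z \<in> carrier G" "t \<in> carrier G" "s \<in> carrier G"
    and "x \<otimes> y = u" "y \<otimes> z = u" "z \<otimes> t = u" "t \<otimes> s = u" "s \<otimes> x = u"
  shows "x \<otimes> (y \<otimes> (x \<otimes> (y \<otimes> x))) = y \<otimes> (x \<otimes> (y \<otimes> (x \<otimes> y)))"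
proof -
  have u: "u \<in> carrier G" using assms by auto
  \<comment> \<open>passing \<open>u\<close> moves a vertex of the pentagon two steps on\<close>
  have step: "p \<otimes> u = u \<otimes> r" if "p \<in> carrier G" "q \<in> carrier G" "r \<in> carrier G"
    "p \<otimes> q = u" "q \<otimes> r = u" for p q r
    using that by (metis m_assoc)
  have yu: "y \<otimes> (u \<otimes> u) = u \<otimes> (u \<otimes> x)"
  proof -
    have "y \<otimes> (u \<otimes> u) = (u \<otimes> t) \<otimes> u"
      using step[of y z t] assms u by (simp add: m_assoc[symmetric])
    also have "\<dots> = u \<otimes> (u \<otimes> x)"
      using step[of t s x] assms u by (simp add: m_assoc)
    finally show ?thesis .
  qed
  have "x \<otimes> (y \<otimes> (x \<otimes> (y \<otimes> x))) = u \<otimes> (u \<otimes> x)"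
    using assms(1,2) u by (simp add: m_assoc flip: assms(6))
  also have "\<dots> = y \<otimes> (u \<otimes> u)" by (rule yu[symmetric])
  also have "\<dots> = y \<otimes> (x \<otimes> (y \<otimes> (x \<otimes> y)))"
    using assms(1,2) by (simp add: m_assoc flip: assms(6))
  finally show ?thesis .
qed

lemma triangle_relation:
  assumes "x \<in> carrier G" "y \<in> carrier G" "z \<in> carrier G"
    and "x \<otimes> y = u" "y \<otimes> z = u" "z \<otimes> x = u"
  shows "x \<otimes> (y \<otimes> x) = y \<otimes> (x \<otimes> y)"
proof -
  have "x \<otimes> (y \<otimes> x) = u \<otimes> x" using assms(1,2) by (simp add: m_assoc flip: assms(4))
  also have "\<dots> = y \<otimes> u" using assms(1-3) by (simp add: m_assoc assms(6) flip: assms(5))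
  finally show ?thesis by (simp add: assms(4))
qed

lemma tri_cancel:
  assumes "tri d x y z" "tri d x' y' z" shows "x \<otimes> y = x' \<otimes> y'"
proof -
  have "(x \<otimes> y) \<otimes> z = (x' \<otimes> y') \<otimes> z"
    using assms by (simp add: tri_def m_assoc)
  then show ?thesis using assms by (simp add: tri_def)
qed

lemma artin_H3_relations_if_triples:
  assumes "\<forall>(p, q, r)\<in>set H3_triples. tri d (orb d [a, b, c] p) (orb d [a, b, c] q) (orb d [a, b, c] r)"
  shows "a \<otimes> (b \<otimes> (a \<otimes> (b \<otimes> a))) = b \<otimes> (a \<otimes> (b \<otimes> (a \<otimes> b)))"
    and "b \<otimes> (c \<otimes> b) = c \<otimes> (b \<otimes> c)" and "a \<otimes> c = c \<otimes> a" and "d = a \<otimes> (c \<otimes> b)"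
proof -
  let ?t = "cnj d"
  define X where "X = ?t (?t (?t (?t c)))"
  have T: "tri d a b (?t c)" "tri d b (?t a) (?t c)" "tri d (?t a) (?t (?t c)) (?t c)"
    "tri d (?t (?t c)) X (?t c)" "tri d X a (?t c)"
    "tri d c b (?t a)" "tri d b (?t c) (?t a)" "tri d (?t c) c (?t a)" "tri d a c b" "tri d c a b"
    using assms by (simp_all add: H3_triples_def orb_def funpow_eqs X_def)
  note C = T[THEN tri_closed]
  have cc: "a \<in> carrier G" "b \<in> carrier G" "c \<in> carrier G" "?t a \<in> carrier G"
    "?t (?t c) \<in> carrier G" "X \<in> carrier G" "?t c \<in> carrier G"
    using C by auto
  show "a \<otimes> (b \<otimes> (a \<otimes> (b \<otimes> a))) = b \<otimes> (a \<otimes> (b \<otimes> (a \<otimes> b)))"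
    using pentagon_relation[of a b "?t a" "?t (?t c)" X "a \<otimes> b"] cc
      tri_cancel[OF T(2) T(1)] tri_cancel[OF T(3) T(1)] tri_cancel[OF T(4) T(1)] tri_cancel[OF T(5) T(1)]
    by blast
  show "b \<otimes> (c \<otimes> b) = c \<otimes> (b \<otimes> c)"
    using triangle_relation[of c b "?t c" "c \<otimes> b"] cc
      tri_cancel[OF T(7) T(6)] tri_cancel[OF T(8) T(6)] by simp
  show "a \<otimes> c = c \<otimes> a" using tri_cancel[OF T(9,10)] .
  show "d = a \<otimes> (c \<otimes> b)" using T(9) by (simp add: tri_def)
qed

lemma H3_a2_relations_if_triples:
  assumes tr: "\<forall>(p, q, r)\<in>set H3_a2_triples.
      tri d (orb d [a, b, c, D, E] p) (orb d [a, b, c, D, E] q) (orb d [a, b, c, D, E] r)"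
    and a3: "(cnj d ^^ 3) a = a"
  shows "a \<otimes> (b \<otimes> a) = b \<otimes> (a \<otimes> b)" and "a \<otimes> (c \<otimes> a) = c \<otimes> (a \<otimes> c)"
    and "b \<otimes> (c \<otimes> (b \<otimes> (c \<otimes> b))) = c \<otimes> (b \<otimes> (c \<otimes> (b \<otimes> c)))"
    and "b \<otimes> (c \<otimes> (b \<otimes> (a \<otimes> (c \<otimes> b)))) = c \<otimes> (b \<otimes> (a \<otimes> (c \<otimes> (b \<otimes> c))))"
    and "c \<otimes> (b \<otimes> (a \<otimes> (c \<otimes> (b \<otimes> (a \<otimes> (c \<otimes> (b \<otimes> a)))))))
       = a \<otimes> (c \<otimes> (b \<otimes> (a \<otimes> (c \<otimes> (b \<otimes> (a \<otimes> (c \<otimes> b)))))))"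
    and "d = c \<otimes> (b \<otimes> a)" and "D = inv b \<otimes> (c \<otimes> b)" and "E = c \<otimes> (b \<otimes> inv c)"
proof -
  let ?t = "cnj d"
  have T: "tri d c b a" "tri d b D a" "tri d D (?t b) a" "tri d (?t b) E a" "tri d E c a"
    "tri d a (?t E) (?t c)" "tri d (?t E) b (?t c)" "tri d b a (?t c)"
    "tri d a (?t (?t b)) (?t E)" "tri d (?t (?t b)) c (?t E)" "tri d c a (?t E)"
    using tr by (simp_all add: H3_a2_triples_def orb_def funpow_eqs)
  note C = T[THEN tri_closed]
  have cc: "a \<in> carrier G" "b \<in> carrier G" "c \<in> carrier G" "D \<in> carrier G" "E \<in> carrier G"
    "d \<in> carrier G" "?t b \<in> carrier G" "?t E \<in> carrier G" "?t (?t b) \<in> carrier G"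
    using C by auto
  show "a \<otimes> (b \<otimes> a) = b \<otimes> (a \<otimes> b)"
    using triangle_relation[of b a "?t E" "b \<otimes> a"] cc
      tri_cancel[OF T(6) T(8)] tri_cancel[OF T(7) T(8)] by simp
  show "a \<otimes> (c \<otimes> a) = c \<otimes> (a \<otimes> c)"
    using triangle_relation[of c a "?t (?t b)" "c \<otimes> a"] cc
      tri_cancel[OF T(9) T(11)] tri_cancel[OF T(10) T(11)] by simp
  have v: "b \<otimes> D = c \<otimes> b" "D \<otimes> ?t b = c \<otimes> b" "?t b \<otimes> E = c \<otimes> b" "E \<otimes> c = c \<otimes> b"
    using tri_cancel[OF T(2) T(1)] tri_cancel[OF T(3) T(1)] tri_cancel[OF T(4) T(1)]
      tri_cancel[OF T(5) T(1)] by auto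
  show "b \<otimes> (c \<otimes> (b \<otimes> (c \<otimes> b))) = c \<otimes> (b \<otimes> (c \<otimes> (b \<otimes> c)))"
    using pentagon_relation[of c b D "?t b" E "c \<otimes> b"] cc v by simp
  show d: "d = c \<otimes> (b \<otimes> a)" using T(1) by (simp add: tri_def)
  have "b \<otimes> (d \<otimes> (c \<otimes> b)) = (d \<otimes> ?t b) \<otimes> (c \<otimes> b)"
    using cc by (simp add: cnj_def m_assoc)
  also have "\<dots> = d \<otimes> ((?t b \<otimes> E) \<otimes> c)"
    using cc by (simp add: m_assoc v(4))
  finally show "b \<otimes> (c \<otimes> (b \<otimes> (a \<otimes> (c \<otimes> b)))) = c \<otimes> (b \<otimes> (a \<otimes> (c \<otimes> (b \<otimes> c))))"
    using cc unfolding v(3) by (simp add: d m_assoc)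
  show "D = inv b \<otimes> (c \<otimes> b)" using cc by (simp flip: v(1))
  have "E = (E \<otimes> c) \<otimes> inv c" using cc by (simp add: m_assoc)
  then show "E = c \<otimes> (b \<otimes> inv c)" using cc by (simp add: v(4) m_assoc)
  have "a \<otimes> (d \<otimes> (d \<otimes> d)) = (d \<otimes> (d \<otimes> d)) \<otimes> ((?t ^^ 3) a)"
    using cc by (simp add: funpow_eqs cnj_def m_assoc)
  then have "a \<otimes> (d \<otimes> (d \<otimes> d)) = (d \<otimes> (d \<otimes> d)) \<otimes> a" by (simp only: a3)
  then have "(a \<otimes> (c \<otimes> (b \<otimes> (a \<otimes> (c \<otimes> (b \<otimes> (a \<otimes> (c \<otimes> b)))))))) \<otimes> a
      = (c \<otimes> (b \<otimes> (a \<otimes> (c \<otimes> (b \<otimes> (a \<otimes> (c \<otimes> (b \<otimes> a)))))))) \<otimes> a"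
    using cc unfolding d by (simp add: m_assoc)
  then show "c \<otimes> (b \<otimes> (a \<otimes> (c \<otimes> (b \<otimes> (a \<otimes> (c \<otimes> (b \<otimes> a)))))))
       = a \<otimes> (c \<otimes> (b \<otimes> (a \<otimes> (c \<otimes> (b \<otimes> (a \<otimes> (c \<otimes> b)))))))"
    using cc by (metis m_closed right_cancel)
qed

end


section \<open>Reflection length\<close>

locale reflection_group = group W for W (structure) and R +
  assumes R_closed: "R \<subseteq> carrier W"
    and R_involution: "r \<in> R \<Longrightarrow> r \<otimes> r = \<one>"
    and R_generates: "generate W R = carrier W"
begin

abbreviation T where "T \<equiv> reflections W R"
abbreviation rl where "rl \<equiv> reflection_length W R"

lemma T_closed: "t \<in> T \<Longrightarrow> t \<in> carrier W"
  using R_closed by (auto simp: reflections_def)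

lemma R_subset_T: "R \<subseteq> T"
  unfolding reflections_def using R_closed by (force intro: exI[of _ \<one>])

lemma T_involution: "t \<in> T \<Longrightarrow> t \<otimes> t = \<one>"
proof -
  assume "t \<in> T"
  then obtain g r where gr: "g \<in> carrier W" "r \<in> R" "t = inv g \<otimes> r \<otimes> g"
    by (auto simp: reflections_def)
  then have r: "r \<in> carrier W" using R_closed by auto
  have "t \<otimes> t = inv g \<otimes> (r \<otimes> r) \<otimes> g"
    using gr r by (simp add: m_assoc)
  then show ?thesis using R_involution gr by simp
qed

lemma T_conj: "t \<in> T \<Longrightarrow> g \<in> carrier W \<Longrightarrow> inv g \<otimes> t \<otimes> g \<in> T"
proof -
  assume "t \<in> T" and g: "g \<in> carrier W"
  then obtain h r where hr: "h \<in> carrier W" "r \<in> R" "t = inv h \<otimes> r \<otimes> h"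
    by (auto simp: reflections_def)
  then have r: "r \<in> carrier W" using R_closed by auto
  have "inv g \<otimes> t \<otimes> g = inv (h \<otimes> g) \<otimes> r \<otimes> (h \<otimes> g)"
    using hr r g by (simp add: m_assoc inv_mult_group)
  then show ?thesis unfolding reflections_def using hr g by blast
qed

text \<open>
  Reflection length is a minimum over a nonempty set.
\<close>

lemma T_factorisation: "g \<in> carrier W \<Longrightarrow> \<exists>ts. set ts \<subseteq> T \<and> list_prod W ts = g"
proof -
  assume "g \<in> carrier W"
  then have "g \<in> generate W R" using R_generates by simp
  then show ?thesis
  proof (induction rule: generate.induct)
    case one
    show ?case by (rule exI[of _ "[]"]) simp
  next
    case (incl r)
    then show ?case using R_subset_T R_closed by (intro exI[of _ "[r]"]) auto
  next
    case (inv r)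
    then have "inv r = r" using R_involution R_closed by (auto intro: inv_equality)
    then show ?case using inv R_subset_T R_closed by (intro exI[of _ "[r]"]) auto
  next
    case (eng g h)
    then obtain ts us where "set ts \<subseteq> T" "list_prod W ts = g" "set us \<subseteq> T" "list_prod W us = h"
      by blast
    then show ?case
      using T_closed by (intro exI[of _ "ts @ us"]) (auto simp: list_prod_append subset_iff)
  qed
qed

lemma rl_le: "set ts \<subseteq> T \<Longrightarrow> rl (list_prod W ts) \<le> length ts"
  unfolding reflection_length_def by (intro Least_le) blast

lemma rl_factorisation:
  assumes "g \<in> carrier W" shows "\<exists>ts. length ts = rl g \<and> set ts \<subseteq> T \<and> list_prod W ts = g"
proof -
  obtain ts where "set ts \<subseteq> T" "list_prod W ts = g" using T_factorisation[OF assms] by blast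
  then have "\<exists>us. length us = length ts \<and> set us \<subseteq> T \<and> list_prod W us = g" by blast
  then show ?thesis
    unfolding reflection_length_def
    by (rule LeastI[of "\<lambda>k. \<exists>us. length us = k \<and> set us \<subseteq> T \<and> list_prod W us = g"])
qed

lemma rl_mult: "g \<in> carrier W \<Longrightarrow> h \<in> carrier W \<Longrightarrow> rl (g \<otimes> h) \<le> rl g + rl h"
proof -
  assume gh: "g \<in> carrier W" "h \<in> carrier W"
  obtain ts us where tu: "length ts = rl g" "set ts \<subseteq> T" "list_prod W ts = g"
    "length us = rl h" "set us \<subseteq> T" "list_prod W us = h"
    using rl_factorisation gh by metis
  then have "list_prod W (ts @ us) = g \<otimes> h"
    using T_closed by (subst list_prod_append) auto
  then show ?thesis using rl_le[of "ts @ us"] tu by simp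
qed

lemma rl_conj_le: "g \<in> carrier W \<Longrightarrow> h \<in> carrier W \<Longrightarrow> rl (inv h \<otimes> g \<otimes> h) \<le> rl g"
proof -
  assume gh: "g \<in> carrier W" "h \<in> carrier W"
  obtain ts where ts: "length ts = rl g" "set ts \<subseteq> T" "list_prod W ts = g"
    using rl_factorisation gh by metis
  then have "list_prod W (map (\<lambda>x. inv h \<otimes> x \<otimes> h) ts) = inv h \<otimes> g \<otimes> h"
    using list_prod_conj[of h ts] gh T_closed by auto
  then show ?thesis
    using rl_le[of "map (\<lambda>x. inv h \<otimes> x \<otimes> h) ts"] ts T_conj gh by (auto simp: subset_iff)
qed

sublocale length_group W rl
proof
  show "rl \<one> = 0" using rl_le[of "[]"] by simp
  show "x = \<one>" if "x \<in> carrier W" "rl x = 0" for x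
    using rl_factorisation[OF that(1)] that(2) by auto
  show "rl (x \<otimes> y) \<le> rl x + rl y" if "x \<in> carrier W" "y \<in> carrier W" for x y
    using rl_mult that .
  show "rl (inv g \<otimes> x \<otimes> g) = rl x" if xg: "x \<in> carrier W" "g \<in> carrier W" for x g
  proof (rule antisym)
    show "rl (inv g \<otimes> x \<otimes> g) \<le> rl x" using rl_conj_le xg .
    have "inv (inv g) \<otimes> (inv g \<otimes> x \<otimes> g) \<otimes> inv g = x" using xg by (simp add: m_assoc)
    then show "rl x \<le> rl (inv g \<otimes> x \<otimes> g)"
      using rl_conj_le[of "inv g \<otimes> x \<otimes> g" "inv g"] xg by simp
  qed
qed

end

text \<open>
  A poset of rank three with bottom and top is a lattice as soon as no two distinct atoms lie
  below two distinct coatoms.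
\<close>

context length_group
begin

lemma le_same_len:
  assumes "x \<in> carrier G" "y \<in> carrier G" "prec x y" "len x = len y"
  shows "x = y"
proof -
  have "inv x \<otimes> y = \<one>" using assms len_eq_0[of "inv x \<otimes> y"] by (simp add: prec_def)
  then have "x \<otimes> (inv x \<otimes> y) = x" using assms by simp
  then show ?thesis using assms by simp
qed

lemma rank3_meet_join:
  assumes w: "w \<in> carrier G" "len w = 3"
    and bowtie: "\<And>x y u v. \<lbrakk>{x, y, u, v} \<subseteq> carrier G; len x = 1; len y = 1; len u = 2; len v = 2;
      x \<noteq> y; prec x u; prec y u; prec x v; prec y v; prec u w; prec v w\<rbrakk> \<Longrightarrow> u = v"
    and x: "x \<in> carrier G" "prec x w" and y: "y \<in> carrier G" "prec y w"
  shows "\<exists>m\<in>{z \<in> carrier G. prec z w}. prec x m \<and> prec y m \<and>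
      (\<forall>n\<in>{z \<in> carrier G. prec z w}. prec x n \<longrightarrow> prec y n \<longrightarrow> prec m n)" (is ?join)
    and "\<exists>m\<in>{z \<in> carrier G. prec z w}. prec m x \<and> prec m y \<and>
      (\<forall>n\<in>{z \<in> carrier G. prec z w}. prec n x \<longrightarrow> prec n y \<longrightarrow> prec n m)" (is ?meet)
proof -
  have same: "u = v" if "u \<in> carrier G" "v \<in> carrier G" "prec u v" "len v \<le> len u" for u v
    using that le_len[OF that(3)] le_same_len by auto
  have top: "n = w" if "n \<in> carrier G" "prec n w" "3 \<le> len n" for n
    using same that w by auto
  have bot: "n = \<one>" if "n \<in> carrier G" "len n = 0" for n using len_eq_0 that by blast
  consider "prec x y" | "prec y x" | "\<not> prec x y" "\<not> prec y x" by blast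
  then have "?join \<and> ?meet"
  proof cases
    case 1
    then show ?thesis using x y by (auto intro!: bexI[of _ y] bexI[of _ x])
  next
    case 2
    then show ?thesis using x y by (auto intro!: bexI[of _ y] bexI[of _ x])
  next
    case 3
    have len: "len x = 1 \<or> len x = 2" "len y = 1 \<or> len y = 2"
    proof -
      have "len x \<noteq> 0" "len y \<noteq> 0" using 3 x y bot one_le by metis+
      moreover have "len x \<noteq> 3" "len y \<noteq> 3" using 3 x y top[OF x] top[OF y] by auto
      moreover have "len x \<le> 3" "len y \<le> 3" using le_len x y w by fastforce+
      ultimately show "len x = 1 \<or> len x = 2" "len y = 1 \<or> len y = 2" by linarith+
    qed
    have up: "len n \<ge> 2" "len n = 2 \<Longrightarrow> len x = 1 \<and> len y = 1"
      if n: "n \<in> carrier G" "prec x n" "prec y n" for n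
    proof -
      have "len x < len n" "len y < len n"
        using same[OF x(1) n(1,2)] same[OF y(1) n(1,3)] n 3 not_le by blast+
      then show "len n \<ge> 2" "len n = 2 \<Longrightarrow> len x = 1 \<and> len y = 1" using len by linarith+
    qed
    have down: "len n \<le> 1" "len n = 1 \<Longrightarrow> len x = 2 \<and> len y = 2"
      if n: "n \<in> carrier G" "prec n x" "prec n y" for n
    proof -
      have "len n < len x" "len n < len y"
        using same[OF n(1) x(1) n(2)] same[OF n(1) y(1) n(3)] n 3 not_le by blast+
      then show "len n \<le> 1" "len n = 1 \<Longrightarrow> len x = 2 \<and> len y = 2" using len by linarith+
    qed
    have ne: "x \<noteq> y" using 3 x by auto
    have ?join
    proof (cases "\<exists>u\<in>carrier G. prec u w \<and> len u = 2 \<and> prec x u \<and> prec y u")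
      case True
      then obtain u where u: "u \<in> carrier G" "prec u w" "len u = 2" "prec x u" "prec y u" by blast
      have "prec u n" if n: "n \<in> carrier G" "prec n w" "prec x n" "prec y n" for n
      proof (cases "len n = 2")
        case True
        then show ?thesis
          using bowtie[of x y u n] up(2)[OF u(1,4,5) u(3)] u n x y ne by auto
      next
        case False
        then have "3 \<le> len n" using up(1)[OF n(1,3,4)] by linarith
        then show ?thesis using top n u by blast
      qed
      then show ?thesis using u by blast
    next
      case False
      have "prec w n" if n: "n \<in> carrier G" "prec n w" "prec x n" "prec y n" for n
      proof -
        have "len n \<noteq> 2" using False n by blast
        then have "3 \<le> len n" using up(1)[OF n(1,3,4)] by linarith
        then show ?thesis using top[OF n(1,2)] w by simp
      qed
      then show ?thesis using w x y by (intro bexI[of _ w]) auto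
    qed
    moreover have ?meet
    proof (cases "\<exists>u\<in>carrier G. prec u w \<and> len u = 1 \<and> prec u x \<and> prec u y")
      case True
      then obtain u where u: "u \<in> carrier G" "prec u w" "len u = 1" "prec u x" "prec u y" by blast
      have "prec n u" if n: "n \<in> carrier G" "prec n w" "prec n x" "prec n y" for n
      proof (cases "len n = 1")
        case True
        then have "n = u"
          using bowtie[of n u x y] down(2)[OF u(1,4,5) u(3)] u n x y ne by auto
        then show ?thesis using u by simp
      next
        case False
        then have "n = \<one>" using down(1)[OF n(1,3,4)] bot n by auto
        then show ?thesis using u by simp
      qed
      then show ?thesis using u by blast
    next
      case False
      have "prec n \<one>" if n: "n \<in> carrier G" "prec n w" "prec n x" "prec n y" for n
      proof -
        have "len n \<noteq> 1" using False n by blast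
        then have "n = \<one>" using down(1)[OF n(1,3,4)] bot n by auto
        then show ?thesis by simp
      qed
      then show ?thesis using w x y by (intro bexI[of _ \<one>]) auto
    qed
    ultimately show ?thesis by blast
  qed
  then show ?join ?meet by blast+
qed

end

context lattice_interval
begin

lemma lattice_interval_order: "lattice \<lparr>carrier = S, eq = (=), le = prec\<rparr>"
proof -
  let ?L = "\<lparr>carrier = S, eq = (=), le = prec\<rparr>"
  have po: "partial_order ?L"
  proof -
    have anti: "\<And>x y. x \<in> S \<Longrightarrow> y \<in> S \<Longrightarrow> prec x y \<Longrightarrow> prec y x \<Longrightarrow> x = y"
      using le_antisym S_carrier by blast
    have trans: "\<And>x y z. \<lbrakk>prec x y; prec y z; x \<in> S; y \<in> S; z \<in> S\<rbrakk> \<Longrightarrow> prec x z"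
      using le_trans S_carrier by blast
    show ?thesis
    proof (unfold_locales, goal_cases)
      case (5 x y)
      then show ?case using anti by simp
    next
      case (6 x y z)
      then show ?case using trans by simp
    qed (auto simp: S_carrier)
  qed
  interpret L: partial_order ?L by (rule po)
  show ?thesis
  proof unfold_locales
    fix x y assume "x \<in> carrier ?L" "y \<in> carrier ?L"
    then have xy: "x \<in> S" "y \<in> S" by auto
    show "\<exists>s. least ?L s (Upper ?L {x, y})"
      using join_exists[OF xy] xy unfolding least_def Upper_def by auto
    show "\<exists>s. greatest ?L s (Lower ?L {x, y})"
      using meet_exists[OF xy] xy unfolding greatest_def Lower_def by auto
  qed
qed

end


section \<open>Interval groups of rank three\<close>

text \<open>
  Intervals of length three all of whose nontrivial elements have an atom below them, as for
  reflection length.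
\<close>

locale rank3_interval = balanced_interval +
  assumes len_w: "len w = 3"
    and atom_below: "x \<in> S \<Longrightarrow> x \<noteq> \<one> \<Longrightarrow> \<exists>t\<in>S. len t = 1 \<and> prec t x"
begin

definition atoms :: "'a set" where
  "atoms = {t \<in> S. len t = 1}"

lemma len_S: "x \<in> S \<Longrightarrow> len x \<le> 3"
  using le_len S_le_w len_w by fastforce

lemma len_0_iff: "x \<in> S \<Longrightarrow> len x = 0 \<longleftrightarrow> x = \<one>"
  using len_eq_0 len_one S_carrier by auto

lemma len_3_iff: "x \<in> S \<Longrightarrow> len x = 3 \<longleftrightarrow> x = w"
proof
  assume x: "x \<in> S" "len x = 3"
  then show "x = w" using le_same_len[of x w] S_le_w S_carrier len_w by simp
qed (simp add: len_w)

lemma len_complement: "x \<in> S \<Longrightarrow> len (inv x \<otimes> w) = 3 - len x"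
  using len_inv_mult[OF S_le_w] len_w by simp

text \<open>The left complement of \<open>x\<close> is the conjugate by \<open>w\<^sup>-\<^sup>1\<close> of the right one.\<close>

lemma left_complement:
  assumes "x \<in> S"
  shows "w \<otimes> inv x \<in> S" and "len (w \<otimes> inv x) = 3 - len x" and "germ (w \<otimes> inv x) x"
proof -
  have x: "x \<in> carrier G" using assms S_carrier by blast
  have eq: "w \<otimes> inv x = ci (inv x \<otimes> w)" using x by (simp add: m_assoc)
  show 1: "w \<otimes> inv x \<in> S" unfolding eq using S_conj_inv complement_in_S assms by blast
  show 2: "len (w \<otimes> inv x) = 3 - len x"
    unfolding eq using len_conj[of "inv x \<otimes> w" "inv w"] x len_complement[OF assms] by simp
  show "germ (w \<otimes> inv x) x"
    using 1 2 assms x len_w w_in_S len_S[OF assms] by (simp add: germ_def m_assoc)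
qed

lemma split_two:
  assumes "u \<in> S" "len u = 2"
  obtains x y where "x \<in> atoms" "y \<in> atoms" "x \<otimes> y = u" "germ x y"
proof -
  have "u \<noteq> \<one>" using assms len_one by auto
  then obtain x where x: "x \<in> S" "len x = 1" "prec x u" using atom_below assms by blast
  have c: "x \<in> carrier G" "u \<in> carrier G" using x assms S_carrier by auto
  have "inv x \<otimes> u \<in> S" "len (inv x \<otimes> u) = 1" "germ x (inv x \<otimes> u)"
    using S_right_factor[OF assms(1) c(1) x(3)] len_inv_mult[OF x(3)] germI_le[OF assms(1) c(1) x(3)]
      x assms by simp_all
  then show ?thesis using that[of x "inv x \<otimes> u"] x c by (simp add: atoms_def)
qed

lemma split_w:
  obtains t where "t \<in> atoms" "germ t (inv t \<otimes> w)" "len (inv t \<otimes> w) = 2"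
proof -
  have "w \<noteq> \<one>" using len_w len_one by auto
  then obtain t where "t \<in> S" "len t = 1" using atom_below w_in_S by blast
  then show ?thesis using that[of t] germ_complement[of t] len_complement[of t] by (simp add: atoms_def)
qed

lemma tri_GG:
  assumes "x \<in> atoms" "y \<in> atoms" "z \<in> atoms" "x \<otimes> (y \<otimes> z) = w"
  shows "GG.tri (cl [w]) (cl [x]) (cl [y]) (cl [z])"
proof -
  have c: "x \<in> carrier G" "y \<in> carrier G" "z \<in> carrier G"
    and s: "x \<in> S" "y \<in> S" "z \<in> S" and l: "len x = 1" "len y = 1" "len z = 1"
    using assms S_carrier by (auto simp: atoms_def)
  have xy: "x \<otimes> y = w \<otimes> inv z" using c by (simp add: m_assoc flip: assms(4))
  have "germ (x \<otimes> y) z" "(x \<otimes> y) \<otimes> z = w" "germ x y"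
    using left_complement[OF s(3)] s l c assms(4) by (simp_all add: xy germ_def m_assoc)
  then have "cl [w] = (cl [x] \<otimes>\<^bsub>GG\<^esub> cl [y]) \<otimes>\<^bsub>GG\<^esub> cl [z]"
    using cl_germ by metis
  then show ?thesis using s w_in_S by (simp add: GG.tri_def GG.m_assoc)
qed

lemma cl_cnj:
  assumes "x \<in> S" shows "cl [cnj w x] = GG.cnj (cl [w]) (cl [x])"
proof -
  have "cl [x] \<otimes>\<^bsub>GG\<^esub> cl [w] = cl [x] \<otimes>\<^bsub>GG\<^esub> (cl [inv x \<otimes> w] \<otimes>\<^bsub>GG\<^esub> cl [cj x])"
    using cl_germ[OF germ_complement_cj[OF assms]] assms S_carrier by (simp add: m_assoc)
  also have "\<dots> = cl [w] \<otimes>\<^bsub>GG\<^esub> cl [cj x]"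
    using cl_germ[OF germ_complement[OF assms]] assms S_carrier complement_in_S S_conj
    by (simp add: GG.m_assoc[symmetric])
  finally show ?thesis
    using assms w_in_S S_conj by (intro GG.cnj_eqI[symmetric]) (simp_all add: cnj_def)
qed

lemma cl_cnj_pow: "x \<in> S \<Longrightarrow> (cnj w ^^ i) x \<in> S \<and> cl [(cnj w ^^ i) x] = (GG.cnj (cl [w]) ^^ i) (cl [x])"
proof (induction i)
  case (Suc i)
  have "cnj w y \<in> S" if "y \<in> S" for y using S_conj[OF that] by (simp add: cnj_def)
  with Suc show ?case using cl_cnj[of "(cnj w ^^ i) x"] by simp
qed simp

text \<open>
  The factorisations of \<open>w\<close> into three atoms present the interval group: the image of an element
  \<open>u = t\<^sup>-\<^sup>1 w\<close> of length two is forced to be \<open>f(t)\<^sup>-\<^sup>1 d\<close>.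
\<close>

lemma hom_from_factorisations:
  fixes K :: "('c, 'd) monoid_scheme"
  assumes "group K" and d: "d \<in> carrier K" and f: "\<And>t. t \<in> atoms \<Longrightarrow> f t \<in> carrier K"
    and tri: "\<And>x y z. \<lbrakk>x \<in> atoms; y \<in> atoms; z \<in> atoms; x \<otimes> (y \<otimes> z) = w\<rbrakk>
      \<Longrightarrow> group.tri K d (f x) (f y) (f z)"
  obtains F where "F \<in> hom GG K" "\<And>t. t \<in> atoms \<Longrightarrow> F (cl [t]) = f t" "F (cl [w]) = d"
proof -
  interpret K: group K by fact
  define F0 where "F0 x = (if len x = 0 then \<one>\<^bsub>K\<^esub> else if len x = 1 then f x
      else if len x = 2 then inv\<^bsub>K\<^esub> (f (w \<otimes> inv x)) \<otimes>\<^bsub>K\<^esub> d else d)" for x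
  have comp: "w \<otimes> inv u \<in> atoms" if "u \<in> S" "len u = 2" for u
    using left_complement[OF that(1)] that by (simp add: atoms_def)
  have F0_closed: "F0 x \<in> carrier K" if "x \<in> S" for x
    using that d f comp by (auto simp: F0_def atoms_def)
  have tri': "f x \<otimes>\<^bsub>K\<^esub> (f y \<otimes>\<^bsub>K\<^esub> f z) = d" if "x \<in> atoms" "y \<in> atoms" "z \<in> atoms"
    "x \<otimes> (y \<otimes> z) = w" for x y z
    using tri[OF that] by (simp add: K.tri_def)
  have F0_2: "F0 (x \<otimes> y) = f x \<otimes>\<^bsub>K\<^esub> f y" if xy: "x \<in> atoms" "y \<in> atoms" "germ x y" for x y
  proof -
    let ?u = "x \<otimes> y"
    let ?t = "w \<otimes> inv ?u"
    have u: "?u \<in> S" "len ?u = 2" using xy by (simp_all add: germ_def atoms_def)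
    have c: "x \<in> carrier G" "y \<in> carrier G" using xy S_carrier by (auto simp: atoms_def)
    have "?t \<otimes> (x \<otimes> y) = w" using c by (simp add: m_assoc)
    then have "f ?t \<otimes>\<^bsub>K\<^esub> (f x \<otimes>\<^bsub>K\<^esub> f y) = d" using tri' comp u xy by blast
    then show ?thesis
      using u f comp xy by (auto simp: F0_def)
  qed
  have rel: "F0 u \<otimes>\<^bsub>K\<^esub> F0 v = F0 (u \<otimes> v)" if "germ u v" for u v
  proof -
    have uv: "u \<in> S" "v \<in> S" "u \<otimes> v \<in> S" "len (u \<otimes> v) = len u + len v"
      using that by (auto simp: germ_def)
    have c: "u \<in> carrier G" "v \<in> carrier G" using uv S_carrier by auto
    have sum: "len u + len v \<le> 3" using len_S uv by metis
    have top: "u \<otimes> v = w" if "len u + len v = 3" using len_3_iff uv that by metis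
    consider "len u = 0" | "len v = 0" | "len u = 1" "len v = 1" | "len u = 1" "len v = 2"
      | "len u = 2" "len v = 1"
      using sum by linarith
    then show ?thesis
    proof cases
      case 1
      then have "u = \<one>" using len_0_iff uv by blast
      then show ?thesis using 1 F0_closed uv c by (simp add: F0_def)
    next
      case 2
      then have "v = \<one>" using len_0_iff uv by blast
      then show ?thesis using 2 F0_closed[OF uv(1)] c by (simp add: F0_def len_one)
    next
      case 3
      then show ?thesis using F0_2[of u v] uv that by (simp add: atoms_def F0_def)
    next
      case 4
      then have w: "u \<otimes> v = w" using top by simp
      then have "w \<otimes> inv v = u" using c by (metis inv_solve_right m_closed)
      then show ?thesis using 4 w uv f d by (simp add: F0_def len_w atoms_def)
    next
      case 5
      then have w: "u \<otimes> v = w" using top by simp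
      obtain x y where xy: "x \<in> atoms" "y \<in> atoms" "x \<otimes> y = u" "germ x y"
        using split_two[OF uv(1) 5(1)] .
      have v: "v \<in> atoms" using uv 5 by (simp add: atoms_def)
      have xyc: "x \<in> carrier G" "y \<in> carrier G" using xy S_carrier by (auto simp: atoms_def)
      have "x \<otimes> (y \<otimes> v) = w" using xy(3) w xyc c by (simp add: m_assoc[symmetric])
      then have "f x \<otimes>\<^bsub>K\<^esub> (f y \<otimes>\<^bsub>K\<^esub> f v) = d" using tri' xy v by blast
      then have "F0 u \<otimes>\<^bsub>K\<^esub> f v = d" using F0_2[OF xy(1,2,4)] xy v f by (simp add: K.m_assoc)
      then show ?thesis using 5 w by (simp add: F0_def len_w)
    qed
  qed
  have "\<exists>F\<in>hom GG K. \<forall>u\<in>gwords S. F (word_class S rels u) = word_val K F0 u"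
  proof (rule K.presented_group_hom)
    show "F0 \<in> S \<rightarrow> carrier K" using F0_closed by blast
    fix l r assume "(l, r) \<in> rels"
    then obtain u v where uv: "l = pos [u, v]" "r = pos [u \<otimes> v]" "germ u v"
      by (auto simp: rels_def germ_def)
    then have "u \<in> S" "v \<in> S" "u \<otimes> v \<in> S" by (auto simp: germ_def)
    then show "word_val K F0 l = word_val K F0 r"
      unfolding uv(1,2) word_val_pos using rel[OF uv(3)] F0_closed by (simp add: K.m_assoc[symmetric])
  qed
  then obtain F where F: "F \<in> hom GG K"
    "\<And>u. u \<in> gwords S \<Longrightarrow> F (word_class S rels u) = word_val K F0 u"
    by blast
  show ?thesis
  proof (rule that[OF F(1)])
    have "F (cl [x]) = F0 x" if "x \<in> S" for x
      using F(2)[of "[(x, True)]"] that F0_closed by (simp add: cl_def)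
    then show "\<And>t. t \<in> atoms \<Longrightarrow> F (cl [t]) = f t" "F (cl [w]) = d"
      using w_in_S len_w by (simp_all add: atoms_def F0_def)
  qed
qed

text \<open>
  The atoms generate the interval group.
\<close>

lemma hom_eq_on_atoms:
  assumes h: "h \<in> hom GG GG" and fix_atoms: "\<And>t. t \<in> atoms \<Longrightarrow> h (cl [t]) = cl [t]"
    and x: "x \<in> S"
  shows "h (cl [x]) = cl [x]"
proof -
  interpret h: group_hom GG GG h
    using h by (simp add: group_hom_def group_hom_axioms_def)
  have mult: "h (cl [u \<otimes> v]) = cl [u \<otimes> v]" if "germ u v" "h (cl [u]) = cl [u]" "h (cl [v]) = cl [v]" for u v
    using that cl_germ[OF that(1), symmetric] by (simp add: germ_def)
  have two: "h (cl [u]) = cl [u]" if "u \<in> S" "len u = 2" for u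
    using split_two[OF that] mult fix_atoms by metis
  consider "len x = 0" | "len x = 1" | "len x = 2" | "len x = 3"
    using len_S[OF x] by linarith
  then show ?thesis
  proof cases
    case 1
    then have "cl [x] = \<one>\<^bsub>GG\<^esub>" using len_0_iff x cl_one by simp
    then show ?thesis by simp
  next
    case 4
    then have w: "x = w" using len_3_iff x by blast
    obtain t where t: "t \<in> atoms" "germ t (inv t \<otimes> w)" "len (inv t \<otimes> w) = 2"
      using split_w .
    have "t \<in> carrier G" "inv t \<otimes> w \<in> S"
      using t S_carrier complement_in_S by (auto simp: atoms_def)
    then show ?thesis using mult[OF t(2)] fix_atoms[OF t(1)] two t(3) w by simp
  qed (use fix_atoms two x in \<open>auto simp: atoms_def\<close>)
qed

end

section \<open>Signed permutations of five points\<close>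

datatype point = P1 | P2 | P3 | P4 | P5

text \<open>
  Elements of \<open>S\<^sub>5 \<times> {\<plusminus>1}\<close>: the images of the five points, and whether the sign is negative.
\<close>

datatype sperm = SP point point point point point bool

fun app :: "sperm \<Rightarrow> point \<Rightarrow> point" where
  "app (SP a b c d e s) P1 = a"
| "app (SP a b c d e s) P2 = b"
| "app (SP a b c d e s) P3 = c"
| "app (SP a b c d e s) P4 = d"
| "app (SP a b c d e s) P5 = e"

fun sg :: "sperm \<Rightarrow> bool" where
  "sg (SP a b c d e s) = s"

instantiation sperm :: monoid_mult
begin

definition one_sperm :: sperm where
  "one_sperm = SP P1 P2 P3 P4 P5 False"

fun times_sperm :: "sperm \<Rightarrow> sperm \<Rightarrow> sperm" where
  "times_sperm p (SP a b c d e s) = SP (app p a) (app p b) (app p c) (app p d) (app p e) (sg p \<noteq> s)"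

lemma app_mult: "app (p * q) x = app p (app q x)"
  by (cases q; cases x) simp_all

lemma sg_mult [simp]: "sg (p * q) = (sg p \<noteq> sg q)"
  by (cases q) simp

instance
proof
  fix p q r :: sperm
  show "p * q * r = p * (q * r)"
    by (cases r) (auto simp: app_mult)
  show "1 * p = p"
  proof -
    have "app 1 x = x" for x by (cases x) (simp_all add: one_sperm_def)
    moreover have "sg 1 = False" by (simp add: one_sperm_def)
    ultimately show ?thesis by (cases p) simp
  qed
  show "p * 1 = p"
    by (cases p) (simp add: one_sperm_def)
qed

end

definition neg1 :: sperm where
  "neg1 = SP P1 P2 P3 P4 P5 True"

definition is_refl :: "sperm \<Rightarrow> bool" where
  "is_refl p \<longleftrightarrow> sg p \<and> p * p = 1 \<and> p \<noteq> neg1"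

text \<open>
  Involutions of \<open>A\<^sub>5\<close> with sign \<open>-1\<close>.  The products of the first two, the last two and the outer two
  have orders 5, 3 and 2.
\<close>

definition gens :: "sperm list" where
  "gens = [SP P1 P3 P2 P5 P4 True, SP P2 P1 P4 P3 P5 True, SP P1 P5 P4 P3 P2 True]"

text \<open>
  Normal forms: elements of the dihedral group generated by the first two reflections, times
  minimal representatives of its right cosets.
\<close>

definition dihedral_words :: "nat list list" where
  "dihedral_words = [[], [0], [1], [0,1], [1,0], [0,1,0], [1,0,1], [0,1,0,1], [1,0,1,0], [0,1,0,1,0]]"

definition coset_words :: "nat list list" where
  "coset_words = [[], [2], [2,1], [2,1,0], [2,1,0,1], [2,1,0,1,0], [2,1,0,1,2], [2,1,0,1,0,2],
     [2,1,0,1,0,2,1], [2,1,0,1,0,2,1,0], [2,1,0,1,0,2,1,0,1], [2,1,0,1,0,2,1,0,1,2]]"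

definition H3_words :: "nat list list" where
  "H3_words = [d @ r. d \<leftarrow> dihedral_words, r \<leftarrow> coset_words]"

definition H3_elements :: "sperm list" where
  "H3_elements = map (\<lambda>u. prod_list (map (nth gens) u)) H3_words"

definition H3_refls :: "sperm list" where
  "H3_refls = filter is_refl H3_elements"

lemma H3_refls_eq: "H3_refls =
    [SP P1 P5 P4 P3 P2 True, SP P3 P4 P1 P2 P5 True,
     SP P1 P3 P2 P5 P4 True, SP P2 P1 P5 P4 P3 True,
     SP P2 P1 P4 P3 P5 True, SP P5 P2 P4 P3 P1 True,
     SP P4 P5 P3 P1 P2 True, SP P2 P1 P3 P5 P4 True,
     SP P3 P5 P1 P4 P2 True, SP P3 P2 P1 P5 P4 True,
     SP P4 P2 P5 P1 P3 True, SP P5 P3 P2 P4 P1 True,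
     SP P4 P3 P2 P1 P5 True, SP P1 P4 P5 P2 P3 True,
     SP P5 P4 P3 P2 P1 True]"
  by code_simp

text \<open>
  The following facts about 120 explicit elements are checked by evaluation with the simplifier.
\<close>

lemma H3_elements_distinct: "distinct H3_elements"
  by code_simp

lemma rotation_two_refls: "\<forall>p\<in>set H3_elements. \<not> sg p \<longrightarrow> p \<noteq> 1 \<longrightarrow> (\<exists>t\<in>set H3_refls. is_refl (t * p))"
  by code_simp

lemma H3_refls_conjugate: "\<forall>t\<in>set H3_refls. \<exists>h\<in>set H3_elements. h * t = hd gens * h"
  by code_simp

text \<open>
  For an involution \<open>x\<close>, the equation \<open>x u x u = 1\<close> says that \<open>x\<close> inverts \<open>u\<close>.
\<close>

lemma generators_not_normalising: "\<forall>u\<in>set H3_elements. u \<noteq> 1 \<longrightarrow> u \<noteq> neg1 \<longrightarrow>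
    (\<exists>x\<in>set gens. x * u \<noteq> u * x \<and> x * u * x * u \<noteq> 1)"
  by code_simp


section \<open>Enumeration of the Coxeter group of type H3\<close>

text \<open>
  An entry \<open>(r, s, d, q)\<close> stands for the equation \<open>r s = d q\<close>: the generator \<open>s\<close> takes the coset of
  \<open>r\<close> to that of \<open>q\<close>, and \<open>d\<close> is the resulting element of the dihedral group.
\<close>

definition coset_table :: "(nat list \<times> nat \<times> nat list \<times> nat list) list" where
  "coset_table =
    [([], 0, [0], []), ([], 1, [1], []),
     ([], 2, [], [2]), ([2], 0, [0], [2]),
     ([2], 1, [], [2,1]), ([2], 2, [], []),
     ([2,1], 0, [], [2,1,0]), ([2,1], 1, [], [2]),
     ([2,1], 2, [1], [2,1]), ([2,1,0], 0, [], [2,1]),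
     ([2,1,0], 1, [], [2,1,0,1]), ([2,1,0], 2, [1], [2,1,0]),
     ([2,1,0,1], 0, [], [2,1,0,1,0]), ([2,1,0,1], 1, [], [2,1,0]),
     ([2,1,0,1], 2, [], [2,1,0,1,2]), ([2,1,0,1,0], 0, [], [2,1,0,1]),
     ([2,1,0,1,0], 1, [0], [2,1,0,1,0]), ([2,1,0,1,0], 2, [], [2,1,0,1,0,2]),
     ([2,1,0,1,2], 0, [], [2,1,0,1,0,2]), ([2,1,0,1,2], 1, [1], [2,1,0,1,2]),
     ([2,1,0,1,2], 2, [], [2,1,0,1]), ([2,1,0,1,0,2], 0, [], [2,1,0,1,2]),
     ([2,1,0,1,0,2], 1, [], [2,1,0,1,0,2,1]), ([2,1,0,1,0,2], 2, [], [2,1,0,1,0]),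
     ([2,1,0,1,0,2,1], 0, [], [2,1,0,1,0,2,1,0]), ([2,1,0,1,0,2,1], 1, [], [2,1,0,1,0,2]),
     ([2,1,0,1,0,2,1], 2, [0], [2,1,0,1,0,2,1]), ([2,1,0,1,0,2,1,0], 0, [], [2,1,0,1,0,2,1]),
     ([2,1,0,1,0,2,1,0], 1, [], [2,1,0,1,0,2,1,0,1]), ([2,1,0,1,0,2,1,0], 2, [0], [2,1,0,1,0,2,1,0]),
     ([2,1,0,1,0,2,1,0,1], 0, [1], [2,1,0,1,0,2,1,0,1]), ([2,1,0,1,0,2,1,0,1], 1, [], [2,1,0,1,0,2,1,0]),
     ([2,1,0,1,0,2,1,0,1], 2, [], [2,1,0,1,0,2,1,0,1,2]), ([2,1,0,1,0,2,1,0,1,2], 0, [1], [2,1,0,1,0,2,1,0,1,2]),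
     ([2,1,0,1,0,2,1,0,1,2], 1, [0], [2,1,0,1,0,2,1,0,1,2]), ([2,1,0,1,0,2,1,0,1,2], 2, [], [2,1,0,1,0,2,1,0,1])]"

lemma coset_table_total:
  "\<forall>r\<in>set coset_words. \<forall>s\<in>{0, 1, 2}. \<exists>(r', s', d, q)\<in>set coset_table. r' = r \<and> s' = s"
  "\<forall>(r, s, d, q)\<in>set coset_table. d \<in> set dihedral_words \<and> q \<in> set coset_words"
  by code_simp+

context group
begin

lemma coxeter_H3_enumeration:
  assumes c: "a \<in> carrier G" "b \<in> carrier G" "c \<in> carrier G"
    and invol: "a \<otimes> a = \<one>" "b \<otimes> b = \<one>" "c \<otimes> c = \<one>"
    and ab: "a \<otimes> (b \<otimes> (a \<otimes> (b \<otimes> a))) = b \<otimes> (a \<otimes> (b \<otimes> (a \<otimes> b)))"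
    and bc: "b \<otimes> (c \<otimes> b) = c \<otimes> (b \<otimes> c)"
    and ac: "a \<otimes> c = c \<otimes> a"
  defines "ev \<equiv> \<lambda>u. list_prod G (map (nth [a, b, c]) u)"
  assumes u: "set u \<subseteq> {0, 1, 2}"
  shows "\<exists>v\<in>set H3_words. ev u = ev v"
proof -
  \<comment> \<open>the Knuth-Bendix completion of the relations, which rewrites both sides of every table
    entry to the same word\<close>
  have cancel: "a \<otimes> (a \<otimes> x) = x" "b \<otimes> (b \<otimes> x) = x" "c \<otimes> (c \<otimes> x) = x"
    if "x \<in> carrier G" for x
    using that c invol by (simp_all flip: m_assoc)
  have ca: "c \<otimes> (a \<otimes> x) = a \<otimes> (c \<otimes> x)" if "x \<in> carrier G" for x
    using that c ac by (simp flip: m_assoc)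
  have cbc: "c \<otimes> (b \<otimes> (c \<otimes> x)) = b \<otimes> (c \<otimes> (b \<otimes> x))" if "x \<in> carrier G" for x
    using that c arg_cong[OF bc, of "\<lambda>y. y \<otimes> x"] by (simp add: m_assoc)
  have babab: "b \<otimes> (a \<otimes> (b \<otimes> (a \<otimes> (b \<otimes> x)))) = a \<otimes> (b \<otimes> (a \<otimes> (b \<otimes> (a \<otimes> x))))"
    if "x \<in> carrier G" for x
    using that c arg_cong[OF ab, of "\<lambda>y. y \<otimes> x"] by (simp add: m_assoc)
  have cbac: "c \<otimes> (b \<otimes> (a \<otimes> (c \<otimes> x))) = b \<otimes> (c \<otimes> (b \<otimes> (a \<otimes> x)))"
    if "x \<in> carrier G" for x
    using that c by (simp add: cbc flip: ca)
  have cbabcb: "c \<otimes> (b \<otimes> (a \<otimes> (b \<otimes> (c \<otimes> (b \<otimes> x)))))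
      = b \<otimes> (c \<otimes> (b \<otimes> (a \<otimes> (b \<otimes> (c \<otimes> x)))))" if "x \<in> carrier G" for x
    using that c by (simp add: cbac flip: cbc)
  have long: "c \<otimes> (b \<otimes> (a \<otimes> (b \<otimes> (a \<otimes> (c \<otimes> (b \<otimes> (a \<otimes> (b \<otimes> (a \<otimes> x)))))))))
      = b \<otimes> (c \<otimes> (b \<otimes> (a \<otimes> (b \<otimes> (a \<otimes> (c \<otimes> (b \<otimes> (a \<otimes> (b \<otimes> x)))))))))"
    if x: "x \<in> carrier G" for x
  proof -
    have "c \<otimes> (b \<otimes> (a \<otimes> (b \<otimes> (a \<otimes> (c \<otimes> (b \<otimes> (a \<otimes> (b \<otimes> (a \<otimes> x)))))))))
        = c \<otimes> (b \<otimes> (a \<otimes> (b \<otimes> (c \<otimes> (a \<otimes> (b \<otimes> (a \<otimes> (b \<otimes> (a \<otimes> x)))))))))"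
      using x c by (simp add: ca)
    also have "\<dots> = c \<otimes> (b \<otimes> (a \<otimes> (b \<otimes> (c \<otimes> (b \<otimes> (a \<otimes> (b \<otimes> (a \<otimes> (b \<otimes> x)))))))))"
      using x c by (simp add: babab)
    also have "\<dots> = b \<otimes> (c \<otimes> (b \<otimes> (a \<otimes> (b \<otimes> (c \<otimes> (a \<otimes> (b \<otimes> (a \<otimes> (b \<otimes> x)))))))))"
      using x c by (simp add: cbabcb)
    finally show ?thesis using x c by (simp add: ca)
  qed
  have ends: "c \<otimes> a = a \<otimes> c" "c \<otimes> (b \<otimes> c) = b \<otimes> (c \<otimes> b)"
    "b \<otimes> (a \<otimes> (b \<otimes> (a \<otimes> b))) = a \<otimes> (b \<otimes> (a \<otimes> (b \<otimes> a)))"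
    "c \<otimes> (b \<otimes> (a \<otimes> c)) = b \<otimes> (c \<otimes> (b \<otimes> a))"
    "c \<otimes> (b \<otimes> (a \<otimes> (b \<otimes> (c \<otimes> b)))) = b \<otimes> (c \<otimes> (b \<otimes> (a \<otimes> (b \<otimes> c))))"
    "c \<otimes> (b \<otimes> (a \<otimes> (b \<otimes> (a \<otimes> (c \<otimes> (b \<otimes> (a \<otimes> (b \<otimes> a))))))))
      = b \<otimes> (c \<otimes> (b \<otimes> (a \<otimes> (b \<otimes> (a \<otimes> (c \<otimes> (b \<otimes> (a \<otimes> b))))))))"
    using c ca[OF one_closed] cbc[OF one_closed] babab[OF one_closed] cbac[OF one_closed]
      cbabcb[OF one_closed] long[OF one_closed] by simp_all
  note rules = cancel ca cbc babab cbac cbabcb long ends invol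
  have map_c: "set (map (nth [a, b, c]) u) \<subseteq> carrier G" if u: "set u \<subseteq> {0, 1, 2}" for u
  proof
    fix x assume "x \<in> set (map (nth [a, b, c]) u)"
    then obtain i where "i \<in> set u" "x = [a, b, c] ! i" by auto
    moreover have "i = 0 \<or> i = 1 \<or> i = 2" using u \<open>i \<in> set u\<close> by blast
    ultimately show "x \<in> carrier G" using c by auto
  qed
  have ev_append: "ev (u @ v) = ev u \<otimes> ev v" if "set u \<subseteq> {0, 1, 2}" "set v \<subseteq> {0, 1, 2}" for u v
    unfolding ev_def map_append by (rule list_prod_append[OF map_c[OF that(1)] map_c[OF that(2)]])
  have ev_closed: "ev u \<in> carrier G" if "set u \<subseteq> {0, 1, 2}" for u
    unfolding ev_def by (rule list_prod_closed[OF map_c[OF that]])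
  have table: "\<forall>(r, s, d, q)\<in>set coset_table. ev (r @ [s]) = ev (d @ q)"
    using c by (simp add: coset_table_def ev_def rules numeral_2_eq_2)
  have letters: "\<forall>d\<in>set dihedral_words. set d \<subseteq> {0, 1}" "\<forall>r\<in>set coset_words. set r \<subseteq> {0, 1, 2}"
    by (simp_all add: dihedral_words_def coset_words_def)
  have dl: "set d \<subseteq> {0, 1, 2}" if "d \<in> set dihedral_words" for d
    using that letters(1) by blast
  have dihedral: "\<forall>d\<in>set dihedral_words. \<forall>s\<in>{0, 1}. \<exists>d'\<in>set dihedral_words. ev (d @ [s]) = ev d'"
    using c by (simp add: dihedral_words_def ev_def rules)
  have dihedral_word: "\<exists>e'\<in>set dihedral_words. ev (d @ e) = ev e'"
    if "d \<in> set dihedral_words" "set e \<subseteq> {0, 1}" for d e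
    using that(2)
  proof (induction e rule: rev_induct)
    case Nil
    then show ?case using that by auto
  next
    case (snoc s e)
    then obtain e' where e': "e' \<in> set dihedral_words" "ev (d @ e) = ev e'" by auto
    have "set (d @ e) \<subseteq> {0, 1, 2}" "set [s] \<subseteq> {0, 1, 2}" "set e' \<subseteq> {0, 1, 2}"
      using dl[OF that(1)] dl[OF e'(1)] snoc.prems by auto
    then have "ev (d @ e @ [s]) = ev (e' @ [s])"
      using ev_append[of "d @ e" "[s]"] ev_append[of e' "[s]"] e'(2) by simp
    then show ?case using dihedral e'(1) snoc.prems by auto
  qed
  show ?thesis
    using u
  proof (induction u rule: rev_induct)
    case Nil
    have "[] \<in> set H3_words" by (simp add: H3_words_def dihedral_words_def coset_words_def)
    then show ?case by blast
  next
    case (snoc s u)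
    then obtain v where v: "v \<in> set H3_words" "ev u = ev v" by auto
    then obtain d r where dr: "d \<in> set dihedral_words" "r \<in> set coset_words" "v = d @ r"
      by (auto simp: H3_words_def)
    obtain e q where eq: "(r, s, e, q) \<in> set coset_table"
      using bspec[OF bspec[OF coset_table_total(1) dr(2)], of s] snoc.prems by auto
    then have eq': "ev (r @ [s]) = ev (e @ q)" "e \<in> set dihedral_words" "q \<in> set coset_words"
      using bspec[OF table eq] bspec[OF coset_table_total(2) eq] by simp_all
    obtain e' where e': "e' \<in> set dihedral_words" "ev (d @ e) = ev e'"
      using dihedral_word dr(1) eq'(2) letters by blast
    have sub: "set d \<subseteq> {0, 1, 2}" "set r \<subseteq> {0, 1, 2}" "set [s] \<subseteq> {0, 1, 2}" "set e \<subseteq> {0, 1, 2}"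
      "set q \<subseteq> {0, 1, 2}" "set e' \<subseteq> {0, 1, 2}" "set u \<subseteq> {0, 1, 2}"
      using dl[OF dr(1)] dl[OF eq'(2)] dl[OF e'(1)] letters(2) dr(2) eq'(3) snoc.prems by auto
    have "ev (u @ [s]) = ev d \<otimes> ev (r @ [s])"
      using ev_append ev_closed sub v(2) dr(3) by (simp add: m_assoc)
    also have "\<dots> = ev (d @ e) \<otimes> ev q"
      unfolding eq'(1) using ev_append ev_closed sub by (simp add: m_assoc)
    also have "\<dots> = ev (e' @ q)"
      unfolding e'(2) using ev_append sub by simp
    finally show ?case
      using e'(1) eq'(3) by (auto simp: H3_words_def)
  qed
qed

end

section \<open>The faithful representation of a Coxeter group of type H3\<close>

lemma neg1_central: "neg1 * p = p * neg1"
proof -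
  have "app neg1 x = x" for x by (cases x) (simp_all add: neg1_def)
  then show ?thesis by (cases p) (simp add: neg1_def)
qed

lemma H3_words_letters: "\<forall>u\<in>set H3_words. \<forall>i\<in>set u. i = 0 \<or> i = 1 \<or> i = 2"
  by code_simp

text \<open>
  The representation is fixed only up to automorphisms of \<open>A\<^sub>5 \<times> {\<plusminus>1}\<close>: it has to recognise the
  reflections, but the images of the simple reflections are left open.  This is the freedom that
  brings every 5-cycle into one standard position.
\<close>

locale icosahedral = reflection_group W R for W (structure) and R +
  fixes \<Phi> :: "'a \<Rightarrow> sperm"
  assumes \<Phi>_mult: "x \<in> carrier W \<Longrightarrow> y \<in> carrier W \<Longrightarrow> \<Phi> (x \<otimes> y) = \<Phi> x * \<Phi> y"
    and \<Phi>_inj: "inj_on \<Phi> (carrier W)"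
    and \<Phi>_image: "\<Phi> ` carrier W = set H3_elements"
    and \<Phi>_T: "x \<in> carrier W \<Longrightarrow> x \<in> T \<longleftrightarrow> is_refl (\<Phi> x)"

text \<open>
  Sending the simple reflections to \<open>gens\<close> respects the Coxeter relations.  Every element of \<open>W\<close> is
  one of 120 normal forms, and these have 120 different images, so the representation is faithful.
\<close>

lemma H3_representation:
  assumes cox: "coxeter_system W R" and H3: "type_H3 W R"
  shows "\<exists>\<Phi>. icosahedral W R \<Phi>"
proof -
  have R: "group W" "R \<subseteq> carrier W" "\<And>r. r \<in> R \<Longrightarrow> r \<otimes>\<^bsub>W\<^esub> r = \<one>\<^bsub>W\<^esub>"
    using cox by (auto simp: coxeter_system_def)
  interpret group W by (rule R(1))
  let ?Q = "coxeter_relations W R"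
  obtain \<phi> where \<phi>: "\<phi> \<in> iso (presented_group R ?Q) W"
    and \<phi>_gen: "\<And>r. r \<in> R \<Longrightarrow> \<phi> (gen_class R ?Q r) = r"
    using cox by (auto simp: coxeter_system_def)
  obtain a b c where abc: "R = {a, b, c}" "distinct [a, b, c]"
    and ords: "ord (a \<otimes>\<^bsub>W\<^esub> b) = 5" "ord (b \<otimes>\<^bsub>W\<^esub> c) = 3" "ord (a \<otimes>\<^bsub>W\<^esub> c) = 2"
    using H3 by (auto simp: type_H3_def)
  have c: "a \<in> carrier W" "b \<in> carrier W" "c \<in> carrier W" using abc R by auto
  have invol: "a \<otimes>\<^bsub>W\<^esub> a = \<one>\<^bsub>W\<^esub>" "b \<otimes>\<^bsub>W\<^esub> b = \<one>\<^bsub>W\<^esub>" "c \<otimes>\<^bsub>W\<^esub> c = \<one>\<^bsub>W\<^esub>"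
    using abc R by auto
  have inv_R: "inv\<^bsub>W\<^esub> r = r" if "r \<in> R" for r
    using that R by (auto intro: inv_equality)
  have inv_abc: "inv\<^bsub>W\<^esub> a = a" "inv\<^bsub>W\<^esub> b = b" "inv\<^bsub>W\<^esub> c = c"
    using inv_R abc by auto

  define wd where "wd u = \<phi> (word_class R ?Q u)" for u
  have wd_val: "wd u = word_val W (\<lambda>r. r) u" if u: "u \<in> gwords R" for u
  proof -
    have "\<phi> \<in> hom (presented_group R ?Q) W" using \<phi> by (simp add: iso_def)
    then have "wd u = word_val W (\<lambda>r. \<phi> (gen_class R ?Q r)) u"
      unfolding wd_def word_class_eq_word_val[OF u]
      by (rule hom_word_val[OF group_presented_group R(1) _ _ u]) simp
    also have "\<dots> = word_val W (\<lambda>r. r) u" using u \<phi>_gen by (rule word_val_cong)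
    finally show ?thesis .
  qed
  have wd_append: "wd (u @ v) = wd u \<otimes>\<^bsub>W\<^esub> wd v" if "u \<in> gwords R" "v \<in> gwords R" for u v
    using that R(2) by (simp add: wd_val word_val_append[of "\<lambda>r. r" R] subset_iff Pi_iff)
  have wd_surj: "\<exists>u\<in>gwords R. wd u = x" if "x \<in> carrier W" for x
  proof -
    have "x \<in> \<phi> ` carrier (presented_group R ?Q)"
      using that \<phi> by (auto simp: iso_def bij_betw_def)
    then show ?thesis by (auto simp: carrier_presented_group wd_def)
  qed
  have wd_inj: "word_eq R ?Q u v" if "u \<in> gwords R" "v \<in> gwords R" "wd u = wd v" for u v
  proof -
    have "inj_on \<phi> (carrier (presented_group R ?Q))"
      using \<phi> by (auto simp: iso_def bij_betw_def)
    then have "word_class R ?Q u = word_class R ?Q v"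
      using that word_class_closed unfolding wd_def inj_on_def by blast
    then show ?thesis using that word_class_eq_iff by blast
  qed
  have gen: "generate W R = carrier W"
  proof
    show "generate W R \<subseteq> carrier W" using generate_incl[OF R(2)] .
    have "word_val W (\<lambda>r. r) u \<in> generate W R" if "u \<in> gwords R" for u
      using that
    proof (induction u)
      case (Cons x u)
      then show ?case
        by (cases x) (auto intro: generate.intros)
    qed (auto intro: generate.one)
    then show "carrier W \<subseteq> generate W R" using wd_surj wd_val by fastforce
  qed
  interpret reflection_group W R
    using R gen by unfold_locales auto

  \<comment> \<open>as the generators are involutions, the Coxeter relations turn into braid relations\<close>
  have pow: "(a \<otimes>\<^bsub>W\<^esub> b) [^]\<^bsub>W\<^esub> (5::nat) = \<one>\<^bsub>W\<^esub>" "(b \<otimes>\<^bsub>W\<^esub> c) [^]\<^bsub>W\<^esub> (3::nat) = \<one>\<^bsub>W\<^esub>"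
    "(a \<otimes>\<^bsub>W\<^esub> c) [^]\<^bsub>W\<^esub> (2::nat) = \<one>\<^bsub>W\<^esub>"
    using pow_ord_eq_1[of "a \<otimes>\<^bsub>W\<^esub> b"] pow_ord_eq_1[of "b \<otimes>\<^bsub>W\<^esub> c"] pow_ord_eq_1[of "a \<otimes>\<^bsub>W\<^esub> c"]
      ords c by simp_all
  have braid: "u = v" if "u \<otimes>\<^bsub>W\<^esub> inv\<^bsub>W\<^esub> v = \<one>\<^bsub>W\<^esub>" "u \<in> carrier W" "v \<in> carrier W" for u v
  proof -
    have "u = (u \<otimes>\<^bsub>W\<^esub> inv\<^bsub>W\<^esub> v) \<otimes>\<^bsub>W\<^esub> v" using that(2,3) by (simp add: m_assoc)
    then show ?thesis using that by simp
  qed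
  have ab: "a \<otimes>\<^bsub>W\<^esub> (b \<otimes>\<^bsub>W\<^esub> (a \<otimes>\<^bsub>W\<^esub> (b \<otimes>\<^bsub>W\<^esub> a))) = b \<otimes>\<^bsub>W\<^esub> (a \<otimes>\<^bsub>W\<^esub> (b \<otimes>\<^bsub>W\<^esub> (a \<otimes>\<^bsub>W\<^esub> b)))"
    using pow(1) c by - (rule braid, simp_all add: inv_mult_group inv_abc m_assoc eval_nat_numeral)
  have bc: "b \<otimes>\<^bsub>W\<^esub> (c \<otimes>\<^bsub>W\<^esub> b) = c \<otimes>\<^bsub>W\<^esub> (b \<otimes>\<^bsub>W\<^esub> c)"
    using pow(2) c by - (rule braid, simp_all add: inv_mult_group inv_abc m_assoc eval_nat_numeral)
  have ac: "a \<otimes>\<^bsub>W\<^esub> c = c \<otimes>\<^bsub>W\<^esub> a"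
    using pow(3) c by - (rule braid, simp_all add: inv_mult_group inv_abc m_assoc eval_nat_numeral)

  \<comment> \<open>the value of a word ignores the signs of its letters because the generators go to involutions\<close>
  define f where "f r = (if r = a then gens ! 0 else if r = b then gens ! 1 else gens ! 2)" for r
  define pv where "pv u = prod_list (map (\<lambda>x. f (fst x)) u)" for u :: "'a gword"
  have pv_append: "pv (u @ v) = pv u * pv v" for u v by (simp add: pv_def)
  have sq: "\<forall>g\<in>set gens. g * g = 1" by code_simp
  have f_gens: "f r \<in> set gens" for r by (simp add: f_def gens_def)
  have orders: "(gens ! 0 * gens ! 1) ^ 5 = 1" "(gens ! 1 * gens ! 0) ^ 5 = 1"
    "(gens ! 1 * gens ! 2) ^ 3 = 1" "(gens ! 2 * gens ! 1) ^ 3 = 1"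
    "(gens ! 0 * gens ! 2) ^ 2 = 1" "(gens ! 2 * gens ! 0) ^ 2 = 1"
    by code_simp+
  have "ord (b \<otimes>\<^bsub>W\<^esub> a) = 5" "ord (c \<otimes>\<^bsub>W\<^esub> b) = 3" "ord (c \<otimes>\<^bsub>W\<^esub> a) = 2"
    using ord_inv[of "a \<otimes>\<^bsub>W\<^esub> b"] ord_inv[of "b \<otimes>\<^bsub>W\<^esub> c"] ord_inv[of "a \<otimes>\<^bsub>W\<^esub> c"] ords c
    by (simp_all add: inv_mult_group inv_abc)
  then have f_rel: "(f r * f s) ^ ord (r \<otimes>\<^bsub>W\<^esub> s) = 1" if "r \<in> R" "s \<in> R" for r s
    using that abc ords orders invol sq by (auto simp: f_def gens_def)
  have pv_rel: "pv (pos (concat (replicate n [r, s]))) = (f r * f s) ^ n" for n r s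
    by (induction n) (simp_all add: pv_def mult.assoc)
  have pv_eq: "pv u = pv v" if "word_eq R ?Q u v" for u v
    using that
  proof (induction rule: word_eq.induct)
    case (cancel u v x b)
    then show ?case using sq f_gens by (simp add: pv_def flip: mult.assoc)
  next
    case (relation u v l r)
    then obtain x y where "l = pos (concat (replicate (ord (x \<otimes>\<^bsub>W\<^esub> y)) [x, y]))" "r = []" "x \<in> R" "y \<in> R"
      by (auto simp: coxeter_relations_def)
    then have "pv l = 1" "pv r = 1" using pv_rel f_rel by (simp_all add: pv_def)
    then show ?case by (simp add: pv_append)
  qed auto
  define \<Phi> where "\<Phi> x = pv (SOME u. u \<in> gwords R \<and> wd u = x)" for x
  have \<Phi>_wd: "\<Phi> (wd u) = pv u" if "u \<in> gwords R" for u
  proof -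
    define v where "v = (SOME v. v \<in> gwords R \<and> wd v = wd u)"
    have "v \<in> gwords R \<and> wd v = wd u" unfolding v_def by (rule someI[of _ u]) (use that in simp)
    then show ?thesis using pv_eq wd_inj that by (simp add: \<Phi>_def flip: v_def)
  qed
  have \<Phi>_mult: "\<Phi> (x \<otimes>\<^bsub>W\<^esub> y) = \<Phi> x * \<Phi> y" if xy: "x \<in> carrier W" "y \<in> carrier W" for x y
  proof -
    obtain u v where "u \<in> gwords R" "wd u = x" "v \<in> gwords R" "wd v = y" using wd_surj xy by metis
    then show ?thesis using \<Phi>_wd[of "u @ v"] \<Phi>_wd[of u] \<Phi>_wd[of v] wd_append[of u v] pv_append by simp
  qed
  have \<Phi>_R: "\<Phi> r = f r" if "r \<in> R" for r
    using \<Phi>_wd[of "pos [r]"] \<phi>_gen[OF that] that by (simp add: wd_def pv_def)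

  \<comment> \<open>\<open>W\<close> has at most as many elements as there are normal forms\<close>
  define ev where "ev u = list_prod W (map (nth [a, b, c]) u)" for u
  define wo where "wo u = pos (map (nth [a, b, c]) u)" for u
  have letter: "nth [a, b, c] i \<in> R" if "i = 0 \<or> i = 1 \<or> i = 2" for i
    using that abc by auto
  have wo: "wo u \<in> gwords R" "wd (wo u) = ev u" "pv (wo u) = prod_list (map (nth gens) u)"
    if u: "\<forall>i\<in>set u. i = 0 \<or> i = 1 \<or> i = 2" for u
  proof -
    show g: "wo u \<in> gwords R" using u letter by (auto simp: wo_def)
    show "wd (wo u) = ev u" unfolding wd_val[OF g] by (simp add: wo_def ev_def word_val_pos)
    have "f (nth [a, b, c] i) = nth gens i" if "i = 0 \<or> i = 1 \<or> i = 2" for i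
      using that abc by (auto simp: f_def)
    then show "pv (wo u) = prod_list (map (nth gens) u)"
      using u by (induction u) (auto simp: wo_def pv_def)
  qed
  have enum: "\<exists>v\<in>set H3_words. x = ev v" if x: "x \<in> carrier W" for x
  proof -
    obtain u where u: "u \<in> gwords R" "wd u = x" using wd_surj x by blast
    define ix where "ix r = (if r = a then 0 else if r = b then 1 else 2 :: nat)" for r
    have ix: "nth [a, b, c] (ix r) = r" if "r \<in> R" for r using that abc by (auto simp: ix_def)
    have "x = word_val W (\<lambda>r. r) u" using u wd_val by simp
    also have "\<dots> = ev (map (\<lambda>z. ix (fst z)) u)"
      using u(1)
    proof (induction u)
      case (Cons z u)
      then show ?case by (cases z) (auto simp: ev_def ix inv_R)
    qed (simp add: ev_def)
    finally show ?thesis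
      using coxeter_H3_enumeration[OF c invol ab bc ac, of "map (\<lambda>z. ix (fst z)) u"]
      by (force simp: ev_def ix_def)
  qed
  have \<Phi>_ev: "\<Phi> (ev v) = prod_list (map (nth gens) v)" "ev v \<in> carrier W" if "v \<in> set H3_words" for v
  proof -
    have v: "\<forall>i\<in>set v. i = 0 \<or> i = 1 \<or> i = 2" using H3_words_letters that by blast
    show "\<Phi> (ev v) = prod_list (map (nth gens) v)" using wo[OF v] \<Phi>_wd by metis
    have "set (map (nth [a, b, c]) v) \<subseteq> carrier W" using v letter R(2) by auto
    then show "ev v \<in> carrier W" unfolding ev_def by (rule list_prod_closed)
  qed
  have "inj_on (\<lambda>u. prod_list (map (nth gens) u)) (set H3_words)"
    using H3_elements_distinct by (simp add: H3_elements_def distinct_map)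
  then have inj: "inj_on \<Phi> (carrier W)"
    using enum \<Phi>_ev unfolding inj_on_def by metis
  have image: "\<Phi> ` carrier W = set H3_elements"
    using enum \<Phi>_ev by (force simp: H3_elements_def)

  \<comment> \<open>conjugates of generators are odd involutions, and not central; conversely all odd noncentral
    involutions are conjugate\<close>
  have \<Phi>_one: "\<Phi> \<one>\<^bsub>W\<^esub> = 1"
    using \<Phi>_wd[of "[]"] wd_val[of "[]"] by (simp add: pv_def)
  have gens_props: "\<forall>g\<in>set gens. sg g \<and> g \<noteq> neg1" by code_simp
  have refl_R: "x \<in> T \<longleftrightarrow> is_refl (\<Phi> x)" if x: "x \<in> carrier W" for x
  proof
    assume xT: "x \<in> T"
    then obtain g r where gr: "g \<in> carrier W" "r \<in> R" "x = inv\<^bsub>W\<^esub> g \<otimes>\<^bsub>W\<^esub> r \<otimes>\<^bsub>W\<^esub> g"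
      by (auto simp: reflections_def)
    have r: "r \<in> carrier W" "\<Phi> r \<in> set gens" using gr R \<Phi>_R f_gens by auto
    have \<Phi>x: "\<Phi> x = \<Phi> (inv\<^bsub>W\<^esub> g) * \<Phi> r * \<Phi> g" using gr r \<Phi>_mult by simp
    have ginv: "\<Phi> (inv\<^bsub>W\<^esub> g) * \<Phi> g = 1" "\<Phi> g * \<Phi> (inv\<^bsub>W\<^esub> g) = 1"
      using gr \<Phi>_mult[of "inv\<^bsub>W\<^esub> g" g] \<Phi>_mult[of g "inv\<^bsub>W\<^esub> g"] \<Phi>_one by simp_all
    have "sg 1 = False" by (simp add: one_sperm_def)
    then have "sg (\<Phi> x)" using gens_props r(2) arg_cong[OF ginv(1), of sg] by (auto simp: \<Phi>x)
    moreover have "\<Phi> x * \<Phi> x = 1"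
      using \<Phi>_mult[OF x x] T_involution[OF xT] \<Phi>_one by simp
    moreover have "\<Phi> x \<noteq> neg1"
    proof
      assume neg: "\<Phi> x = neg1"
      have cancel: "\<Phi> g * (\<Phi> (inv\<^bsub>W\<^esub> g) * y) = y" for y
        by (simp add: ginv flip: mult.assoc)
      have "\<Phi> r = \<Phi> g * (\<Phi> x * \<Phi> (inv\<^bsub>W\<^esub> g))"
        by (simp add: \<Phi>x mult.assoc cancel ginv)
      also have "\<dots> = neg1" by (simp add: neg neg1_central cancel)
      finally show False using gens_props r(2) by simp
    qed
    ultimately show "is_refl (\<Phi> x)" by (simp add: is_refl_def)
  next
    assume "is_refl (\<Phi> x)"
    then have "\<Phi> x \<in> set H3_refls" using image x by (auto simp: H3_refls_def)
    then obtain h where h: "h \<in> set H3_elements" "h * \<Phi> x = hd gens * h"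
      using H3_refls_conjugate by blast
    then obtain g where g: "g \<in> carrier W" "\<Phi> g = h" using image by (metis imageE)
    have "hd gens = \<Phi> a" using \<Phi>_R abc by (simp add: f_def gens_def)
    then have "\<Phi> (g \<otimes>\<^bsub>W\<^esub> x) = \<Phi> (a \<otimes>\<^bsub>W\<^esub> g)" using g h x c \<Phi>_mult by simp
    then have "g \<otimes>\<^bsub>W\<^esub> x = a \<otimes>\<^bsub>W\<^esub> g" using inj g x c unfolding inj_on_def by blast
    then have "x = inv\<^bsub>W\<^esub> g \<otimes>\<^bsub>W\<^esub> a \<otimes>\<^bsub>W\<^esub> g" using conj_eq_iff[OF c(1) x g(1)] by blast
    then show "x \<in> T" unfolding reflections_def using g abc by blast
  qed
  have "icosahedral W R \<Phi>"
    using \<Phi>_mult inj image refl_R by unfold_locales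
  then show ?thesis by blast
qed

context icosahedral
begin

lemma \<Phi>_eqD: "x \<in> carrier W \<Longrightarrow> y \<in> carrier W \<Longrightarrow> \<Phi> x = \<Phi> y \<Longrightarrow> x = y"
  using \<Phi>_inj by (simp add: inj_on_def)

lemma \<Phi>_lift: "p \<in> set H3_elements \<Longrightarrow> \<exists>x\<in>carrier W. \<Phi> x = p"
  using \<Phi>_image by (metis imageE)

lemma \<Phi>_one: "\<Phi> \<one> = 1"
proof -
  have "1 \<in> set H3_elements" by code_simp
  then obtain x where "x \<in> carrier W" "\<Phi> x = 1" using \<Phi>_image by (metis imageE)
  then show ?thesis using \<Phi>_mult[of \<one> x] by simp
qed

lemma \<Phi>_inv: "x \<in> carrier W \<Longrightarrow> \<Phi> (inv x) * \<Phi> x = 1" "x \<in> carrier W \<Longrightarrow> \<Phi> x * \<Phi> (inv x) = 1"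
  using \<Phi>_mult[of "inv x" x] \<Phi>_mult[of x "inv x"] \<Phi>_one by simp_all

lemma sg_one [simp]: "\<not> sg 1"
  by (simp add: one_sperm_def)

lemma sg_list_prod: "set ts \<subseteq> T \<Longrightarrow> sg (\<Phi> (list_prod W ts)) \<longleftrightarrow> odd (length ts)"
proof (induction ts)
  case (Cons t ts)
  then have t: "t \<in> carrier W" "is_refl (\<Phi> t)" "set ts \<subseteq> carrier W"
    using T_closed \<Phi>_T by auto
  then have "\<Phi> (list_prod W (t # ts)) = \<Phi> t * \<Phi> (list_prod W ts)"
    by (simp add: \<Phi>_mult)
  then show ?case using Cons t by (simp add: is_refl_def)
qed (simp add: \<Phi>_one)

lemma rl_parity: "x \<in> carrier W \<Longrightarrow> sg (\<Phi> x) \<longleftrightarrow> odd (rl x)"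
  using rl_factorisation[of x] sg_list_prod by force

lemma rl_one_iff: "x \<in> carrier W \<Longrightarrow> rl x = 1 \<longleftrightarrow> x \<in> T"
proof
  assume x: "x \<in> carrier W" "rl x = 1"
  obtain ts where ts: "length ts = 1" "set ts \<subseteq> T" "list_prod W ts = x"
    using rl_factorisation x by metis
  then obtain t where "ts = [t]" by (metis One_nat_def length_0_conv length_Suc_conv)
  then show "x \<in> T" using ts T_closed by auto
next
  assume "x \<in> carrier W" "x \<in> T"
  then show "rl x = 1"
    using rl_le[of "[x]"] rl_parity[of x] \<Phi>_T[of x] by (auto simp: is_refl_def elim: oddE)
qed

text \<open>
  Length and sign have the same parity.  Every nontrivial rotation is a product of two reflections,
  so an element of sign \<open>-1\<close> that is no reflection needs exactly three.
\<close>

lemma rl_formula: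
  assumes x: "x \<in> carrier W"
  shows "rl x = (if sg (\<Phi> x) then if is_refl (\<Phi> x) then 1 else 3 else if \<Phi> x = 1 then 0 else 2)"
proof -
  have even: "rl y = 2" if y: "y \<in> carrier W" "\<not> sg (\<Phi> y)" "y \<noteq> \<one>" for y
  proof -
    have "\<Phi> y \<noteq> 1" using y \<Phi>_eqD[of y \<one>] \<Phi>_one by auto
    then obtain p where p: "p \<in> set H3_refls" "is_refl (p * \<Phi> y)"
      using rotation_two_refls y \<Phi>_image by blast
    then obtain t where t: "t \<in> carrier W" "\<Phi> t = p" using \<Phi>_lift by (auto simp: H3_refls_def)
    have tT: "t \<in> T" "t \<otimes> y \<in> T" using p t y \<Phi>_T \<Phi>_mult by (auto simp: H3_refls_def)
    have "t \<otimes> (t \<otimes> y) = y" using T_involution[OF tT(1)] t y by (simp flip: m_assoc)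
    then have "rl y \<le> 2" using rl_le[of "[t, t \<otimes> y]"] tT t y by simp
    moreover have "rl y \<noteq> 0" using len_eq_0 y by blast
    moreover have "even (rl y)" using rl_parity y by blast
    ultimately show ?thesis by (auto elim: evenE)
  qed
  show ?thesis
  proof (cases "sg (\<Phi> x)")
    case False
    then show ?thesis using even[OF x False] \<Phi>_eqD[OF x one_closed] \<Phi>_one len_one by auto
  next
    case odd: True
    show ?thesis
    proof (cases "is_refl (\<Phi> x)")
      case True
      then show ?thesis using odd rl_one_iff[OF x] \<Phi>_T[OF x] by simp
    next
      case False
      have "hd gens \<in> set H3_refls" by code_simp
      then have "hd gens \<in> set H3_elements" "is_refl (hd gens)" by (simp_all add: H3_refls_def)
      then obtain t where t0: "t \<in> carrier W" "\<Phi> t = hd gens" using \<Phi>_lift by metis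
      with \<open>is_refl (hd gens)\<close> have t: "t \<in> carrier W" "t \<in> T" using \<Phi>_T[OF t0(1)] by simp_all
      have ttx: "t \<otimes> (t \<otimes> x) = x" using T_involution[OF t(2)] t x by (simp flip: m_assoc)
      have "t \<otimes> x \<noteq> \<one>"
      proof
        assume "t \<otimes> x = \<one>"
        then have "x = t" using ttx t by simp
        then show False using False \<Phi>_T t by blast
      qed
      then have "rl (t \<otimes> x) = 2"
        using even[of "t \<otimes> x"] t x odd \<Phi>_mult \<Phi>_T by (simp add: is_refl_def)
      then have "rl x \<le> 3" using len_mult[of t "t \<otimes> x"] t x rl_one_iff[OF t(1)] ttx by simp
      moreover have "rl x \<noteq> 1" using rl_one_iff x \<Phi>_T False by blast
      moreover have "odd (rl x)" using rl_parity x odd by blast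
      ultimately have "rl x = 3" by (auto elim!: oddE)
      then show ?thesis using odd False by simp
    qed
  qed
qed

lemma conjugate_representation:
  assumes h: "h \<in> carrier W"
  shows "icosahedral W R (\<lambda>x. \<Phi> (h \<otimes> x \<otimes> inv h))"
proof unfold_locales
  show "\<Phi> (h \<otimes> (x \<otimes> y) \<otimes> inv h) = \<Phi> (h \<otimes> x \<otimes> inv h) * \<Phi> (h \<otimes> y \<otimes> inv h)"
    if "x \<in> carrier W" "y \<in> carrier W" for x y
    using that h by (simp add: m_assoc flip: \<Phi>_mult)
  show "inj_on (\<lambda>x. \<Phi> (h \<otimes> x \<otimes> inv h)) (carrier W)"
  proof (rule inj_onI)
    fix x y assume xy: "x \<in> carrier W" "y \<in> carrier W" "\<Phi> (h \<otimes> x \<otimes> inv h) = \<Phi> (h \<otimes> y \<otimes> inv h)"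
    then have "h \<otimes> x \<otimes> inv h = h \<otimes> y \<otimes> inv h" using h \<Phi>_eqD by simp
    then show "x = y" using h xy by simp
  qed
  have "(\<lambda>x. h \<otimes> x \<otimes> inv h) ` carrier W = carrier W"
  proof (intro equalityI subsetI)
    fix y assume y: "y \<in> carrier W"
    then have "y = h \<otimes> (inv h \<otimes> y \<otimes> h) \<otimes> inv h" using h by (simp add: m_assoc)
    then show "y \<in> (\<lambda>x. h \<otimes> x \<otimes> inv h) ` carrier W" using y h by blast
  qed (use h in auto)
  then show "(\<lambda>x. \<Phi> (h \<otimes> x \<otimes> inv h)) ` carrier W = set H3_elements"
    using \<Phi>_image by (metis image_image)
  show "x \<in> T \<longleftrightarrow> is_refl (\<Phi> (h \<otimes> x \<otimes> inv h))" if x: "x \<in> carrier W" for x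
  proof -
    have "h \<otimes> x \<otimes> inv h \<in> T \<longleftrightarrow> x \<in> T"
    proof
      assume "h \<otimes> x \<otimes> inv h \<in> T"
      moreover have "inv h \<otimes> (h \<otimes> x \<otimes> inv h) \<otimes> h = x" using x h by (simp add: m_assoc)
      ultimately show "x \<in> T" using T_conj h by metis
    next
      assume "x \<in> T"
      then show "h \<otimes> x \<otimes> inv h \<in> T" using T_conj[of x "inv h"] h by simp
    qed
    then show ?thesis using \<Phi>_T[of "h \<otimes> x \<otimes> inv h"] x h by simp
  qed
qed

end

section \<open>Quasi-Coxeter elements\<close>

text \<open>
  An odd permutation; conjugation by it exchanges the two classes of 5-cycles in \<open>A\<^sub>5\<close>.
\<close>

definition swap12 :: sperm where
  "swap12 = SP P2 P1 P3 P4 P5 False"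

lemma swap12_square: "swap12 * swap12 = 1"
  by code_simp

lemma swap12_normalises:
  "\<forall>p\<in>set H3_elements. swap12 * p * swap12 \<in> set H3_elements \<and> is_refl (swap12 * p * swap12) = is_refl p"
  by code_simp

text \<open>
  A product of the three simple reflections, in the order \<open>a c b\<close>.
\<close>

definition five_cycle :: sperm where
  "five_cycle = gens ! 0 * gens ! 2 * gens ! 1"

text \<open>
  Reflections \<open>a\<close>, \<open>b\<close>, \<open>c\<close> that satisfy the relations of the group of \<open>H\<^sub>3(a\<^sub>2)\<close>; their product \<open>c b a\<close> is
  \<open>-1\<close> times a 3-cycle.
\<close>

definition three_cycle_gens :: "sperm list" where
  "three_cycle_gens = [SP P1 P3 P2 P5 P4 True, SP P2 P1 P3 P5 P4 True, SP P4 P3 P2 P1 P5 True]"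

definition three_cycle :: sperm where
  "three_cycle = three_cycle_gens ! 2 * three_cycle_gens ! 1 * three_cycle_gens ! 0"

lemma odd_elements_classification:
  "\<forall>p\<in>set H3_elements. sg p \<longrightarrow> p \<noteq> neg1 \<longrightarrow> \<not> is_refl p \<longrightarrow>
    (\<exists>q\<in>{p, swap12 * p * swap12}. \<exists>h\<in>set H3_elements. h * q = five_cycle * h \<or> h * q = three_cycle * h)"
  by code_simp

context icosahedral
begin

lemma swap_representation: "icosahedral W R (\<lambda>x. swap12 * \<Phi> x * swap12)"
proof unfold_locales
  have cancel: "swap12 * (swap12 * p) = p" for p
    by (simp add: swap12_square flip: mult.assoc)
  have cancel': "swap12 * (swap12 * p * swap12) * swap12 = p" for p
    by (simp add: mult.assoc swap12_square cancel)
  show "swap12 * \<Phi> (x \<otimes> y) * swap12 = swap12 * \<Phi> x * swap12 * (swap12 * \<Phi> y * swap12)"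
    if "x \<in> carrier W" "y \<in> carrier W" for x y
    using that by (simp add: \<Phi>_mult mult.assoc cancel)
  show "inj_on (\<lambda>x. swap12 * \<Phi> x * swap12) (carrier W)"
  proof (rule inj_onI)
    fix x y assume xy: "x \<in> carrier W" "y \<in> carrier W"
      and "swap12 * \<Phi> x * swap12 = swap12 * \<Phi> y * swap12"
    then have "\<Phi> x = \<Phi> y" by (metis cancel')
    then show "x = y" using \<Phi>_eqD xy by blast
  qed
  show "(\<lambda>x. swap12 * \<Phi> x * swap12) ` carrier W = set H3_elements"
  proof (intro equalityI subsetI)
    fix p assume "p \<in> (\<lambda>x. swap12 * \<Phi> x * swap12) ` carrier W"
    then show "p \<in> set H3_elements" using swap12_normalises \<Phi>_image by blast
  next
    fix p assume p: "p \<in> set H3_elements"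
    then obtain x where x: "x \<in> carrier W" "\<Phi> x = swap12 * p * swap12"
      using swap12_normalises \<Phi>_lift by blast
    then have "p = swap12 * \<Phi> x * swap12" by (simp add: cancel')
    then show "p \<in> (\<lambda>x. swap12 * \<Phi> x * swap12) ` carrier W" using x by blast
  qed
  show "x \<in> T \<longleftrightarrow> is_refl (swap12 * \<Phi> x * swap12)" if "x \<in> carrier W" for x
    using \<Phi>_T[OF that] swap12_normalises \<Phi>_image that by blast
qed

text \<open>
  By the classification of odd elements, a conjugation in \<open>S\<^sub>5\<close> takes the image of \<open>w\<close> to one of two
  standard elements.  It is realised by conjugating in \<open>W\<close> and possibly with \<open>swap12\<close>.
\<close>

lemma normal_form:
  assumes w: "w \<in> carrier W" and "sg (\<Phi> w)" "\<Phi> w \<noteq> neg1" "\<not> is_refl (\<Phi> w)"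
  shows "\<exists>\<Psi>. icosahedral W R \<Psi> \<and> (\<Psi> w = five_cycle \<or> \<Psi> w = three_cycle)"
proof -
  have conj: "\<exists>\<Psi>. icosahedral W R \<Psi> \<and> (\<Psi> w = five_cycle \<or> \<Psi> w = three_cycle)"
    if X: "icosahedral W R X" and h: "h \<in> set H3_elements"
      and eq: "h * X w = five_cycle * h \<or> h * X w = three_cycle * h" for X h
  proof -
    interpret X: icosahedral W R X by (rule X)
    obtain g where g: "g \<in> carrier W" "X g = h" using X.\<Phi>_lift h by blast
    have "X (g \<otimes> w \<otimes> inv g) = h * X w * X (inv g)" using g w X.\<Phi>_mult by simp
    moreover have "z * h * X (inv g) = z" for z
      using X.\<Phi>_inv(2)[OF g(1)] g(2) by (simp add: mult.assoc)
    ultimately have "X (g \<otimes> w \<otimes> inv g) = five_cycle \<or> X (g \<otimes> w \<otimes> inv g) = three_cycle"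
      using eq by auto
    then show ?thesis using X.conjugate_representation[OF g(1)] by blast
  qed
  obtain q h where q: "q = \<Phi> w \<or> q = swap12 * \<Phi> w * swap12" and
    h: "h \<in> set H3_elements" "h * q = five_cycle * h \<or> h * q = three_cycle * h"
    using odd_elements_classification assms \<Phi>_image by blast
  from q show ?thesis
  proof
    assume "q = \<Phi> w"
    then show ?thesis using conj[OF icosahedral_axioms h(1)] h(2) by simp
  next
    assume "q = swap12 * \<Phi> w * swap12"
    then show ?thesis using conj[OF swap_representation h(1)] h(2) by simp
  qed
qed


text \<open>
  The elements that conjugate \<open>u\<close> to \<open>u\<close> or \<open>u\<^sup>-\<^sup>1\<close> form a proper subgroup unless \<open>u\<close> is central.
\<close>

lemma not_generating:
  assumes ts: "ts \<subseteq> T" "generate W ts = carrier W"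
    and u: "u \<in> carrier W" "\<Phi> u \<noteq> 1" "\<Phi> u \<noteq> neg1"
  shows "\<exists>t\<in>ts. t \<otimes> u \<noteq> u \<otimes> t \<and> t \<otimes> (u \<otimes> (t \<otimes> u)) \<noteq> \<one>"
proof (rule ccontr)
  assume "\<not> ?thesis"
  then have *: "\<And>t. t \<in> ts \<Longrightarrow> t \<otimes> u = u \<otimes> t \<or> t \<otimes> (u \<otimes> (t \<otimes> u)) = \<one>" by blast
  let ?N = "\<lambda>x. x \<otimes> (u \<otimes> inv x) = u \<or> x \<otimes> (u \<otimes> inv x) = inv u"
  have ts_c: "t \<in> carrier W" "inv t = t" if "t \<in> ts" for t
    using that ts(1) T_closed[of t] inv_equality[OF T_involution, of t] by auto
  have N_ts: "?N t" if t: "t \<in> ts" for t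
  proof -
    have tt: "t \<otimes> t = \<one>" using t ts T_involution by blast
    from *[OF t] show ?thesis
    proof
      assume "t \<otimes> u = u \<otimes> t"
      then have "t \<otimes> (u \<otimes> t) = u" using ts_c[OF t] u tt by (metis m_assoc r_one)
      then show ?thesis using ts_c[OF t] by simp
    next
      assume "t \<otimes> (u \<otimes> (t \<otimes> u)) = \<one>"
      then have "t \<otimes> (u \<otimes> t) = inv u" using ts_c[OF t] u by (intro inv_equality[symmetric]) (simp_all add: m_assoc)
      then show ?thesis using ts_c[OF t] by simp
    qed
  qed
  have N: "x \<in> carrier W \<and> ?N x" if "x \<in> generate W ts" for x
    using that
  proof (induction rule: generate.induct)
    case (eng x y)
    have inv_case: "x \<otimes> (inv u \<otimes> inv x) = inv (x \<otimes> (u \<otimes> inv x))"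
      using eng u by (simp add: inv_mult_group m_assoc)
    have "(x \<otimes> y) \<otimes> (u \<otimes> inv (x \<otimes> y)) = x \<otimes> ((y \<otimes> (u \<otimes> inv y)) \<otimes> inv x)"
      using eng u by (simp add: inv_mult_group m_assoc)
    then show ?case using eng u inv_case by auto
  next
    case (inv t)
    then show ?case using N_ts[of t] ts_c[of t] by simp
  next
    case (incl t)
    then show ?case using N_ts[of t] ts_c[of t] by simp
  qed (use u in simp)
  obtain p where p: "p \<in> set gens" "p * \<Phi> u \<noteq> \<Phi> u * p" "p * \<Phi> u * p * \<Phi> u \<noteq> 1"
    using generators_not_normalising u \<Phi>_image by blast
  have "\<forall>p\<in>set gens. p \<in> set H3_elements \<and> p * p = 1" by code_simp
  then obtain x where x: "x \<in> carrier W" "\<Phi> x = p" and pp: "p * p = 1"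
    using p(1) \<Phi>_lift by blast
  have "x \<otimes> x = \<one>" using x pp \<Phi>_eqD[of "x \<otimes> x" \<one>] \<Phi>_mult \<Phi>_one by simp
  then have "inv x = x" using x by (auto intro: inv_equality)
  then have "x \<otimes> (u \<otimes> x) = u \<or> x \<otimes> (u \<otimes> x) = inv u" using N[of x] x ts(2) by simp
  then show False
  proof
    assume "x \<otimes> (u \<otimes> x) = u"
    then have "\<Phi> u * p = p * (\<Phi> u * p) * p"
      using \<Phi>_mult x u by (metis m_closed)
    also have "\<dots> = p * \<Phi> u" using pp by (simp add: mult.assoc)
    finally show False using p by simp
  next
    assume "x \<otimes> (u \<otimes> x) = inv u"
    then have "p * (\<Phi> u * p) = \<Phi> (inv u)"
      using \<Phi>_mult x u by (metis m_closed)
    then show False using p \<Phi>_inv(1)[OF u(1)] by (simp add: mult.assoc[symmetric])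
  qed
qed

text \<open>
  Excluded are the rotations, the reflections and \<open>-1\<close>.  If \<open>w = t\<close> or \<open>w = t\<^sub>1 t\<^sub>2\<close>, the factors commute
  with \<open>w\<close> or invert it.  If \<open>w = t\<^sub>1 t\<^sub>2 t\<^sub>3 = -1\<close>, then \<open>t\<^sub>1\<close> and \<open>t\<^sub>2\<close> invert \<open>t\<^sub>1 t\<^sub>2 = - t\<^sub>3\<close> and \<open>t\<^sub>3\<close> commutes with it.
  In no case do the factors generate \<open>W\<close>.
\<close>

lemma quasi_coxeter_image:
  assumes "quasi_coxeter W R w"
  shows "w \<in> carrier W" "sg (\<Phi> w)" "\<Phi> w \<noteq> neg1" "\<not> is_refl (\<Phi> w)"
proof -
  obtain ts where w: "w \<in> carrier W" and ts: "set ts \<subseteq> T" "list_prod W ts = w" "length ts = rl w"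
    and gen: "generate W (set ts) = carrier W"
    using assms by (auto simp: quasi_coxeter_def reduced_decomposition_def)
  note key = not_generating[OF ts(1) gen]
  have tc: "t \<in> carrier W" "t \<otimes> t = \<one>" "is_refl (\<Phi> t)" if "t \<in> set ts" for t
    using that ts T_closed T_involution \<Phi>_T by blast+
  have tt: "t \<otimes> (t \<otimes> y) = y" if "t \<in> set ts" "y \<in> carrier W" for t y
    using tc that by (simp flip: m_assoc)
  show "w \<in> carrier W" by (rule w)
  have "hd gens \<in> set H3_elements" "hd gens \<noteq> 1" "hd gens \<noteq> neg1" by code_simp+
  then obtain g where "g \<in> carrier W" "\<Phi> g \<noteq> 1" "\<Phi> g \<noteq> neg1" using \<Phi>_lift by metis
  then have "ts \<noteq> []" using key[of g] by auto
  then have rl0: "rl w \<noteq> 0" by (simp flip: ts(3))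
  have rl1: "rl w \<noteq> 1"
  proof
    assume "rl w = 1"
    then have "length ts = 1" using ts(3) by simp
    then obtain t where t: "ts = [t]" by (auto simp: length_Suc_conv)
    then have "sg (\<Phi> t)" "\<Phi> t \<noteq> neg1" using tc[of t] by (auto simp: is_refl_def)
    then have "\<Phi> t \<noteq> 1" by auto
    with \<open>\<Phi> t \<noteq> neg1\<close> show False using key[of t] tc[of t] t by auto
  qed
  have pair: "\<exists>t\<in>set ts - {t1, t2}. t \<otimes> (t1 \<otimes> t2) \<noteq> (t1 \<otimes> t2) \<otimes> t"
    if t12: "t1 \<in> set ts" "t2 \<in> set ts" and u: "\<Phi> (t1 \<otimes> t2) \<noteq> 1" for t1 t2
  proof -
    have "\<not> sg (\<Phi> (t1 \<otimes> t2))" using tc t12 \<Phi>_mult by (simp add: is_refl_def)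
    then have "\<Phi> (t1 \<otimes> t2) \<noteq> neg1" by (auto simp: neg1_def)
    moreover have "t1 \<otimes> t2 \<in> carrier W" using tc t12 by simp
    ultimately obtain t where t: "t \<in> set ts" "t \<otimes> (t1 \<otimes> t2) \<noteq> (t1 \<otimes> t2) \<otimes> t"
      "t \<otimes> ((t1 \<otimes> t2) \<otimes> (t \<otimes> (t1 \<otimes> t2))) \<noteq> \<one>"
      using key u by blast
    have c: "t1 \<in> carrier W" "t2 \<in> carrier W" using tc t12 by auto
    have "t1 \<otimes> ((t1 \<otimes> t2) \<otimes> (t1 \<otimes> (t1 \<otimes> t2))) = \<one>"
      "t2 \<otimes> ((t1 \<otimes> t2) \<otimes> (t2 \<otimes> (t1 \<otimes> t2))) = \<one>"
      using c tt[OF t12(1)] tt[OF t12(2)] tc(2)[OF t12(1)] tc(2)[OF t12(2)] by (simp_all add: m_assoc)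
    then have "t \<noteq> t1" "t \<noteq> t2" using t(3) by auto
    with t show ?thesis by blast
  qed
  show sg: "sg (\<Phi> w)"
  proof (rule ccontr)
    assume even: "\<not> sg (\<Phi> w)"
    then have two: "rl w = 2" "\<Phi> w \<noteq> 1" using rl_formula[OF w] rl0 by (auto split: if_splits)
    then have "length ts = 2" using ts(3) by simp
    then obtain t1 t2 where t: "ts = [t1, t2]"
      by (auto simp: numeral_2_eq_2 length_Suc_conv)
    then have "w = t1 \<otimes> t2" using ts(2) tc by simp
    then show False using pair[of t1 t2] two t by auto
  qed
  show "\<not> is_refl (\<Phi> w)" using rl1 sg rl_formula[OF w] by auto
  show "\<Phi> w \<noteq> neg1"
  proof
    assume neg: "\<Phi> w = neg1"
    have "rl w = 3" using rl_formula[OF w] sg rl1 by (auto split: if_splits)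
    then have "length ts = 3" using ts(3) by simp
    then obtain t1 t2 t3 where t: "ts = [t1, t2, t3]"
      by (auto simp: numeral_3_eq_3 length_Suc_conv)
    have c: "t1 \<in> carrier W" "t2 \<in> carrier W" "t3 \<in> carrier W" using t tc by auto
    have w': "w = (t1 \<otimes> t2) \<otimes> t3" using ts(2) t c by (simp add: m_assoc)
    have u: "\<Phi> (t1 \<otimes> t2) \<noteq> 1"
    proof
      assume "\<Phi> (t1 \<otimes> t2) = 1"
      then have "\<Phi> w = \<Phi> t3" using w' c \<Phi>_mult[of "t1 \<otimes> t2" t3] by simp
      then show False using neg tc(3)[of t3] t by (simp add: is_refl_def)
    qed
    have "t3 \<otimes> (t1 \<otimes> t2) = (t1 \<otimes> t2) \<otimes> t3"
    proof -
      have "\<Phi> (t3 \<otimes> w) = \<Phi> (w \<otimes> t3)" using c w neg neg1_central by (simp add: \<Phi>_mult)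
      then have "t3 \<otimes> w = w \<otimes> t3" using \<Phi>_eqD c w by simp
      then have "(t3 \<otimes> (t1 \<otimes> t2)) \<otimes> t3 = ((t1 \<otimes> t2) \<otimes> t3) \<otimes> t3"
        using c by (simp add: w' m_assoc)
      then show ?thesis using c by simp
    qed
    then show False using pair[of t1 t2] u t by auto
  qed
qed

end

section \<open>Intervals in the standard position\<close>

definition conj_by :: "sperm \<Rightarrow> sperm \<Rightarrow> sperm \<Rightarrow> sperm" where
  "conj_by gi g p = gi * p * g"

definition orbit_val :: "sperm \<Rightarrow> sperm \<Rightarrow> sperm list \<Rightarrow> nat \<times> nat \<Rightarrow> sperm" where
  "orbit_val gi g hs p = (conj_by gi g ^^ snd p) (hs ! fst p)"

definition orbit_table :: "sperm \<Rightarrow> sperm \<Rightarrow> nat \<Rightarrow> sperm list \<Rightarrow> (sperm \<times> nat \<times> nat) list" where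
  "orbit_table gi g n hs = [(orbit_val gi g hs (j, i), (j, i)). j \<leftarrow> [0..<length hs], i \<leftarrow> [0..<n]]"

definition orbit_index :: "sperm \<Rightarrow> sperm \<Rightarrow> nat \<Rightarrow> sperm list \<Rightarrow> sperm \<Rightarrow> nat \<times> nat" where
  "orbit_index gi g n hs t = the (map_of (orbit_table gi g n hs) t)"

definition shift :: "nat \<Rightarrow> nat \<Rightarrow> nat \<times> nat \<Rightarrow> nat \<times> nat" where
  "shift n i p = (fst p, (snd p + i) mod n)"

definition shifts :: "nat \<Rightarrow> triple list \<Rightarrow> triple list" where
  "shifts n Ts = [(shift n i p, shift n i q, shift n i r). i \<leftarrow> [0..<n], (p, q, r) \<leftarrow> Ts]"

text \<open>
  What has to be checked about a standard element \<open>g\<close> with inverse \<open>gi\<close>: the orbits of \<open>hs\<close> under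
  conjugation by \<open>g\<close> exhaust the reflections and have period \<open>n\<close>, and the factorisations of \<open>g\<close> into
  three reflections are, up to simultaneous conjugation by powers of \<open>g\<close>, those listed in \<open>Ts\<close>.
  The third factor is determined by the first two, \<open>z = y x g\<close>.
\<close>

definition orbit_data :: "sperm \<Rightarrow> sperm \<Rightarrow> nat \<Rightarrow> sperm list \<Rightarrow> triple list \<Rightarrow> bool" where
  "orbit_data gi g n hs Ts \<longleftrightarrow>
    g * gi = 1 \<and> sg g \<and> g \<noteq> neg1 \<and> \<not> is_refl g \<and>
    (\<forall>h\<in>set hs. h \<in> set H3_refls \<and> (conj_by gi g ^^ n) h = h) \<and>
    (\<forall>j\<in>set [0..<length hs]. orbit_index gi g n hs (hs ! j) = (j, 0)) \<and>
    (\<forall>t\<in>set H3_refls. orbit_val gi g hs (orbit_index gi g n hs t) = t \<and>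
       fst (orbit_index gi g n hs t) < length hs) \<and>
    (\<forall>x\<in>set H3_refls. \<forall>y\<in>set H3_refls. is_refl (y * x * g) \<longrightarrow>
       (orbit_index gi g n hs x, orbit_index gi g n hs y, orbit_index gi g n hs (y * x * g))
         \<in> set (shifts n Ts)) \<and>
    (\<forall>(p, q, r)\<in>set Ts. fst p < length hs \<and> fst q < length hs \<and> fst r < length hs \<and>
       orbit_val gi g hs p * (orbit_val gi g hs q * orbit_val gi g hs r) = g)"

lemma five_cycle_eq: "five_cycle = SP P4 P1 P2 P5 P3 True"
  by code_simp

lemma five_cycle_data: "orbit_data (five_cycle ^ 9) five_cycle 5 gens H3_triples"
  by code_simp

definition three_cycle_orbits :: "sperm list" where
  "three_cycle_orbits = three_cycle_gens @
    [three_cycle_gens ! 1 * three_cycle_gens ! 2 * three_cycle_gens ! 1,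
     three_cycle_gens ! 2 * three_cycle_gens ! 1 * three_cycle_gens ! 2]"

lemma three_cycle_data: "orbit_data (three_cycle ^ 5) three_cycle 3 three_cycle_orbits H3_a2_triples"
  by code_simp

text \<open>Two reflections lie below at most one common product of two reflections.\<close>

lemma five_cycle_no_bowtie:
  "\<forall>x\<in>set H3_refls. \<forall>y\<in>set H3_refls. x = y \<or>
    length (filter (\<lambda>z. is_refl (x * five_cycle * z) \<and> is_refl (y * five_cycle * z)) H3_refls) \<le> 1"
  unfolding H3_refls_eq five_cycle_eq by code_simp

lemma (in reflection_group) reflection_below:
  assumes "x \<in> carrier W" "x \<noteq> \<one>"
  shows "\<exists>t\<in>T. prec t x \<and> rl t = 1"
proof -
  obtain ts where ts: "length ts = rl x" "set ts \<subseteq> T" "list_prod W ts = x"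
    using rl_factorisation assms by blast
  then obtain t us where t: "ts = t # us" using assms by (cases ts) auto
  have c: "t \<in> carrier W" "set us \<subseteq> carrier W" using ts t T_closed by auto
  have "inv t \<otimes> x = list_prod W us" using ts(3) t c by auto
  then have "rl (inv t \<otimes> x) \<le> rl x - 1" using rl_le[of us] ts t by auto
  moreover have "rl t \<le> 1" using rl_le[of "[t]"] ts t c by simp
  moreover have "rl x \<le> rl t + rl (inv t \<otimes> x)" using rl_mult[of t "inv t \<otimes> x"] c assms by simp
  moreover have "rl x \<noteq> 0" using len_eq_0 assms by blast
  ultimately have "rl t = 1" "rl x = rl t + rl (inv t \<otimes> x)" by linarith+
  then have "prec t x \<and> rl t = 1" by (simp add: prec_def)
  moreover have "t \<in> T" using ts t by simp
  ultimately show ?thesis by blast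
qed

locale orbit_representation = icosahedral W R \<Phi> for W (structure) and R and \<Phi> +
  fixes w gi g n hs Ts
  assumes w_carrier: "w \<in> carrier W"
    and \<Phi>_w: "\<Phi> w = g"
    and data: "orbit_data gi g n hs Ts"
begin

lemma g_props: "g * gi = 1" "sg g" "g \<noteq> neg1" "\<not> is_refl g"
  and hs_props: "h \<in> set hs \<Longrightarrow> h \<in> set H3_refls" "h \<in> set hs \<Longrightarrow> (conj_by gi g ^^ n) h = h"
  and index_hs: "j < length hs \<Longrightarrow> orbit_index gi g n hs (hs ! j) = (j, 0)"
  and index_props: "t \<in> set H3_refls \<Longrightarrow> orbit_val gi g hs (orbit_index gi g n hs t) = t"
    "t \<in> set H3_refls \<Longrightarrow> fst (orbit_index gi g n hs t) < length hs"
  and index_triple: "\<lbrakk>x \<in> set H3_refls; y \<in> set H3_refls; is_refl (y * x * g)\<rbrakk> \<Longrightarrow>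
    (orbit_index gi g n hs x, orbit_index gi g n hs y, orbit_index gi g n hs (y * x * g))
      \<in> set (shifts n Ts)"
  and triple_props: "(p, q, r) \<in> set Ts \<Longrightarrow> fst p < length hs \<and> fst q < length hs \<and> fst r < length hs \<and>
       orbit_val gi g hs p * (orbit_val gi g hs q * orbit_val gi g hs r) = g"
  using data unfolding orbit_data_def by (blast | force)+

lemma rl_w: "rl w = 3"
  using rl_formula[OF w_carrier] g_props \<Phi>_w by simp

sublocale balanced_interval W rl w
  by unfold_locales (rule w_carrier)

lemma T_eq: "T = {t \<in> S. rl t = 1}"
proof (intro equalityI subsetI)
  fix t assume t: "t \<in> T"
  have c: "t \<in> carrier W" using T_closed t by blast
  have r: "is_refl (\<Phi> t)" using \<Phi>_T c t by blast
  have "inv t = t" using inv_equality[OF T_involution[OF t]] c by blast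
  moreover have "\<not> sg (\<Phi> (t \<otimes> w))" using r g_props c w_carrier \<Phi>_w by (simp add: \<Phi>_mult is_refl_def)
  moreover have "\<Phi> (t \<otimes> w) \<noteq> 1"
  proof
    assume "\<Phi> (t \<otimes> w) = 1"
    then have "t \<otimes> w = \<one>" using \<Phi>_eqD[of "t \<otimes> w" \<one>] \<Phi>_one c w_carrier by simp
    moreover have "t \<otimes> (t \<otimes> w) = w" using T_involution[OF t] c w_carrier by (simp flip: m_assoc)
    ultimately have "w = t" using c by simp
    then show False using r g_props \<Phi>_w by simp
  qed
  ultimately have "rl (inv t \<otimes> w) = 2" using rl_formula[of "t \<otimes> w"] c w_carrier by simp
  then show "t \<in> {t \<in> S. rl t = 1}"
    using rl_one_iff[OF c] t c rl_w by (simp add: S_def prec_def)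
next
  fix t assume "t \<in> {t \<in> S. rl t = 1}"
  then show "t \<in> T" using rl_one_iff S_carrier by blast
qed

sublocale rank3_interval W rl w
proof unfold_locales
  show "rl w = 3" by (rule rl_w)
  fix x assume x: "x \<in> S" "x \<noteq> \<one>"
  then show "\<exists>t\<in>S. rl t = 1 \<and> prec t x"
    using reflection_below[OF S_carrier] T_eq by blast
qed

lemma atoms_eq: "atoms = T"
  using T_eq by (simp add: atoms_def)

lemma \<Phi>_inv_w: "\<Phi> (inv w) = gi"
proof -
  have "\<Phi> (inv w) = (\<Phi> (inv w) * g) * gi" by (simp add: mult.assoc g_props)
  then show ?thesis using \<Phi>_inv(1)[OF w_carrier] \<Phi>_w by simp
qed

lemma \<Phi>_cnj_pow:
  "x \<in> carrier W \<Longrightarrow> \<Phi> ((cnj w ^^ i) x) = (conj_by gi g ^^ i) (\<Phi> x)"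
proof (induction i)
  case (Suc i)
  have "\<Phi> (cnj w y) = conj_by gi g (\<Phi> y)" if "y \<in> carrier W" for y
    using that w_carrier \<Phi>_inv_w \<Phi>_w by (simp add: cnj_def conj_by_def \<Phi>_mult)
  then show ?case using Suc w_carrier by simp
qed simp

definition lift :: "sperm \<Rightarrow> 'a" where
  "lift p = (SOME x. x \<in> carrier W \<and> \<Phi> x = p)"

lemma lift: "p \<in> set H3_refls \<Longrightarrow> lift p \<in> T \<and> \<Phi> (lift p) = p"
proof -
  assume p: "p \<in> set H3_refls"
  then have "\<exists>x. x \<in> carrier W \<and> \<Phi> x = p" using \<Phi>_lift by (auto simp: H3_refls_def)
  then have "lift p \<in> carrier W \<and> \<Phi> (lift p) = p" unfolding lift_def by (rule someI_ex)
  then show ?thesis using \<Phi>_T p by (auto simp: H3_refls_def)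
qed

definition hw where "hw = map lift hs"
definition gh where "gh = map (\<lambda>x. cl [x]) hw"

lemma hw_nth: "j < length hs \<Longrightarrow> hw ! j \<in> T" "j < length hs \<Longrightarrow> \<Phi> (hw ! j) = hs ! j"
  using lift hs_props(1) by (simp_all add: hw_def)

lemma T_S: "t \<in> T \<Longrightarrow> t \<in> S"
  using T_eq by blast

lemma orb_props:
  assumes "fst p < length hs"
  shows "orb w hw p \<in> T" and "\<Phi> (orb w hw p) = orbit_val gi g hs p"
    and "cl [orb w hw p] = GG.orb (cl [w]) gh p"
proof -
  have h: "hw ! fst p \<in> T" "\<Phi> (hw ! fst p) = hs ! fst p" using hw_nth assms by auto
  have c: "hw ! fst p \<in> carrier W" using T_closed h by blast
  have "(cnj w ^^ i) t \<in> T" if "t \<in> T" for i t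
    using that T_conj w_carrier by (induction i) (auto simp: cnj_def[of w])
  then show "orb w hw p \<in> T" using h by (simp add: orb_def)
  show "\<Phi> (orb w hw p) = orbit_val gi g hs p"
    using h c by (simp add: orb_def orbit_val_def \<Phi>_cnj_pow)
  show "cl [orb w hw p] = GG.orb (cl [w]) gh p"
    using cl_cnj_pow[OF T_S[OF h(1)], of "snd p"] assms
    by (simp add: orb_def GG.orb_def gh_def hw_def)
qed

text \<open>
  The listed factorisations hold in \<open>W\<close> and therefore between the generators of the interval group.
\<close>

lemma triples_GG:
  "\<forall>(p, q, r)\<in>set Ts. GG.tri (cl [w]) (GG.orb (cl [w]) gh p) (GG.orb (cl [w]) gh q) (GG.orb (cl [w]) gh r)"
proof clarify
  fix p1 p2 q1 q2 r1 r2 assume pqr: "((p1, p2), (q1, q2), (r1, r2)) \<in> set Ts"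
  let ?p = "(p1, p2)" and ?q = "(q1, q2)" and ?r = "(r1, r2)"
  have lt: "fst ?p < length hs" "fst ?q < length hs" "fst ?r < length hs"
    and prod: "orbit_val gi g hs ?p * (orbit_val gi g hs ?q * orbit_val gi g hs ?r) = g"
    using triple_props[OF pqr] by auto
  let ?x = "orb w hw ?p" and ?y = "orb w hw ?q" and ?z = "orb w hw ?r"
  have T: "?x \<in> T" "?y \<in> T" "?z \<in> T" using orb_props(1) lt by blast+
  then have c: "?x \<in> carrier W" "?y \<in> carrier W" "?z \<in> carrier W" using T_closed by blast+
  have "\<Phi> (?x \<otimes> (?y \<otimes> ?z)) = \<Phi> w"
    using c prod orb_props(2) lt \<Phi>_w by (simp add: \<Phi>_mult)
  then have "?x \<otimes> (?y \<otimes> ?z) = w" using \<Phi>_eqD c w_carrier by simp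
  then have "GG.tri (cl [w]) (cl [?x]) (cl [?y]) (cl [?z])"
    using tri_GG T atoms_eq by blast
  then show "GG.tri (cl [w]) (GG.orb (cl [w]) gh ?p) (GG.orb (cl [w]) gh ?q) (GG.orb (cl [w]) gh ?r)"
    using orb_props(3) lt by simp
qed

lemma gh_props: "length gh = length hs" "set gh \<subseteq> carrier GG"
  using hw_nth T_S by (auto simp: gh_def hw_def in_set_conv_nth)

lemma gh_periodic: "j < length hs \<Longrightarrow> (GG.cnj (cl [w]) ^^ n) (gh ! j) = gh ! j"
proof -
  assume j: "j < length hs"
  have T: "hw ! j \<in> T" and c: "hw ! j \<in> carrier W" using hw_nth j T_closed by blast+
  have "\<Phi> ((cnj w ^^ n) (hw ! j)) = \<Phi> (hw ! j)"
    using \<Phi>_cnj_pow[OF c] hw_nth(2)[OF j] hs_props(2)[of "hs ! j"] j by simp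
  then have "(cnj w ^^ n) (hw ! j) = hw ! j" using \<Phi>_eqD c w_carrier by simp
  then show ?thesis using cl_cnj_pow[OF T_S[OF T], of n] j by (simp add: gh_def hw_def)
qed

text \<open>
  A group \<open>A\<close> in which the listed factorisations hold receives a homomorphism from the interval group.
  If conversely \<open>A\<close> maps to the interval group, with \<open>kh\<close> going to the orbit representatives, then the
  two maps are inverse to each other on generators, as both commute with conjugation by \<open>d\<close> and \<open>w\<close>.
\<close>

lemma interval_group_iso:
  fixes S' :: "'x set" and Q'
  defines "A \<equiv> presented_group S' Q'"
  assumes d: "d \<in> carrier A" and kh: "set kh \<subseteq> carrier A" "length kh = length hs"
    and periodic: "\<forall>k\<in>set kh. (group.cnj A d ^^ n) k = k"
    and tri: "\<forall>(p, q, r)\<in>set Ts. group.tri A d (group.orb A d kh p) (group.orb A d kh q) (group.orb A d kh r)"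
    and E: "E \<in> hom A GG" "\<And>j. j < length hs \<Longrightarrow> E (kh ! j) = gh ! j" "E d = cl [w]"
    and gens: "\<And>y. y \<in> S' \<Longrightarrow> \<exists>j<length hs. gen_class S' Q' y = kh ! j"
  shows "GG \<cong> A"
proof -
  interpret A: group A unfolding A_def by (rule group_presented_group)
  let ?ix = "orbit_index gi g n hs"
  define f where "f t = A.orb d kh (?ix (\<Phi> t))" for t
  have orb_closed: "A.orb d kh p \<in> carrier A" if "fst p < length hs" for p
  proof -
    have "kh ! fst p \<in> carrier A" using that kh nth_mem by fastforce
    then show ?thesis using d by (simp add: A.orb_def)
  qed
  have \<Phi>_refl: "\<Phi> t \<in> set H3_refls" if "t \<in> T" for t
    using that \<Phi>_T T_closed \<Phi>_image by (auto simp: H3_refls_def)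
  have orb_shift: "A.orb d kh (shift n i p) = (A.cnj d ^^ i) (A.orb d kh p)"
    if "fst p < length hs" for i p
  proof -
    have "(A.cnj d ^^ n) (kh ! fst p) = kh ! fst p" using periodic kh that by simp
    then have "(A.cnj d ^^ ((snd p + i) mod n)) (kh ! fst p) = (A.cnj d ^^ (snd p + i)) (kh ! fst p)"
      by (rule funpow_mod_eq)
    then show ?thesis by (simp add: A.orb_def shift_def add.commute[of "snd p"] funpow_add)
  qed
  have tri_shifts: "A.tri d (A.orb d kh p) (A.orb d kh q) (A.orb d kh r)"
    if pqr: "(p, q, r) \<in> set (shifts n Ts)" for p q r
  proof -
    obtain i p' q' r' where *: "(p', q', r') \<in> set Ts"
      "p = shift n i p'" "q = shift n i q'" "r = shift n i r'"
      using pqr by (auto simp: shifts_def)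
    have "A.tri d (A.orb d kh p') (A.orb d kh q') (A.orb d kh r')" using tri *(1) by blast
    then show ?thesis
      using A.tri_cnj_pow[of d _ _ _ i] triple_props[OF *(1)] by (simp add: *(2-) orb_shift)
  qed
  obtain F where F: "F \<in> hom GG A" "\<And>t. t \<in> atoms \<Longrightarrow> F (cl [t]) = f t"
  proof (rule hom_from_factorisations[OF A.is_group d])
    show "f t \<in> carrier A" if "t \<in> atoms" for t
      unfolding f_def using orb_closed index_props \<Phi>_refl that atoms_eq by blast
    fix x y z assume xyz: "x \<in> atoms" "y \<in> atoms" "z \<in> atoms" "x \<otimes> (y \<otimes> z) = w"
    then have T: "x \<in> T" "y \<in> T" "z \<in> T" using atoms_eq by auto
    have c: "x \<in> carrier W" "y \<in> carrier W" "z \<in> carrier W" using T T_closed by auto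
    have "\<Phi> x * \<Phi> x = 1" "\<Phi> y * \<Phi> y = 1"
      using \<Phi>_T c T by (auto simp: is_refl_def)
    then have "\<Phi> y * \<Phi> x * (\<Phi> x * (\<Phi> y * \<Phi> z)) = \<Phi> z"
      by (metis mult.assoc mult_1)
    then have z: "\<Phi> z = \<Phi> y * \<Phi> x * g"
      using \<Phi>_w xyz(4) c by (metis \<Phi>_mult m_closed)
    then have "(?ix (\<Phi> x), ?ix (\<Phi> y), ?ix (\<Phi> z)) \<in> set (shifts n Ts)"
      using index_triple[OF \<Phi>_refl[OF T(1)] \<Phi>_refl[OF T(2)]] \<Phi>_T[OF c(3)] T(3) by simp
    then show "A.tri d (f x) (f y) (f z)" unfolding f_def by (rule tri_shifts)
  qed auto
  interpret E: group_hom A GG E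
    using E(1) by (simp add: group_hom_def group_hom_axioms_def)
  have E_cnj: "E ((A.cnj d ^^ i) x) = (GG.cnj (cl [w]) ^^ i) (E x)" if "x \<in> carrier A" for i x
    using that d by (induction i) (simp_all add: A.cnj_def[of d] GG.cnj_def[of "cl [w]"] E(3))
  have E_orb: "E (A.orb d kh p) = GG.orb (cl [w]) gh p" if "fst p < length hs" for p
    using that kh by (simp add: A.orb_def GG.orb_def E_cnj E(2) subset_iff)
  have EF: "E (F (cl [t])) = cl [t]" if t: "t \<in> atoms" for t
  proof -
    have T: "t \<in> T" using t atoms_eq by simp
    let ?p = "?ix (\<Phi> t)"
    have p: "fst ?p < length hs" "orbit_val gi g hs ?p = \<Phi> t"
      using index_props \<Phi>_refl[OF T] by blast+
    have "orb w hw ?p = t"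
      using \<Phi>_eqD[of "orb w hw ?p" t] orb_props[OF p(1)] p(2) T T_closed by simp
    then show ?thesis
      using orb_props(3)[OF p(1)] E_orb[OF p(1)] F(2)[OF t] by (simp add: f_def)
  qed
  have FE: "F (gh ! j) = kh ! j" if j: "j < length hs" for j
  proof -
    have "F (gh ! j) = f (hw ! j)"
      using j F(2)[of "hw ! j"] hw_nth(1)[OF j] atoms_eq by (simp add: gh_def hw_def)
    then show ?thesis
      using hw_nth(2)[OF j] index_hs[OF j] by (simp add: f_def A.orb_def)
  qed
  have EF_hom: "E \<circ> F \<in> hom GG GG" by (rule Group.hom_compose[OF F(1) E(1)])
  show ?thesis
    unfolding A_def
  proof (rule presented_group_isoI)
    show "F \<in> hom GG (presented_group S' Q')" "E \<in> hom (presented_group S' Q') GG"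
      using F(1) E(1) by (simp_all add: A_def)
    show "E (F (gen_class S rels x)) = gen_class S rels x" if "x \<in> S" for x
      using hom_eq_on_atoms[OF EF_hom _ that] EF by (simp add: cl_def)
    show "F (E (gen_class S' Q' y)) = gen_class S' Q' y" if "y \<in> S'" for y
      using gens[OF that] E(2) FE by auto
  qed
qed

lemma interval_group_eq: "interval_group W R w = GG"
  by (simp add: interval_group_def rels_def interval_def S_def abs_le_def prec_def)

lemma interval_order_eq: "interval_order W R w = \<lparr>carrier = S, eq = (=), le = prec\<rparr>"
proof -
  have "abs_le W R = prec" by (intro ext) (simp add: abs_le_def prec_def)
  then show ?thesis by (simp add: interval_order_def interval_def S_def)
qed

text \<open>
  An element \<open>u\<close> of length two is \<open>w z\<close> for the reflection \<open>z = u\<^sup>-\<^sup>1 w\<close>, and a reflection \<open>x\<close> lies below it iff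
  \<open>x w z\<close> is a reflection.  The hypothesis thus says that two reflections have at most one element of
  length two above them.
\<close>

lemma lattice_intervalI:
  assumes "\<forall>x\<in>set H3_refls. \<forall>y\<in>set H3_refls. x = y \<or>
    length (filter (\<lambda>z. is_refl (x * g * z) \<and> is_refl (y * g * z)) H3_refls) \<le> 1"
  shows "lattice_interval W rl w"
proof -
  have \<Phi>_refl: "\<Phi> t \<in> set H3_refls" if "t \<in> T" for t
    using that \<Phi>_T T_closed \<Phi>_image by (auto simp: H3_refls_def)
  have comp: "inv u \<otimes> w \<in> T" if "u \<in> carrier W" "rl u = 2" "prec u w" for u
    using that rl_w rl_one_iff[of "inv u \<otimes> w"] w_carrier by (simp add: prec_def)
  have below: "is_refl (\<Phi> x * g * \<Phi> (inv u \<otimes> w))"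
    if x: "x \<in> carrier W" "rl x = 1" and u: "u \<in> carrier W" "rl u = 2" "prec u w" and "prec x u" for x u
  proof -
    let ?z = "inv u \<otimes> w"
    have xT: "x \<in> T" using rl_one_iff x by blast
    have zT: "?z \<in> T" using comp u by blast
    have inv: "inv x = x" "inv ?z = ?z"
      using inv_equality[OF T_involution[OF xT]] inv_equality[OF T_involution[OF zT]] T_closed xT zT by auto
    have "u = w \<otimes> inv ?z" using u w_carrier by (simp add: inv_mult_group flip: m_assoc)
    then have u_eq: "u = w \<otimes> ?z" using inv by simp
    have "rl (inv x \<otimes> u) = 1" using \<open>prec x u\<close> x u by (simp add: prec_def)
    then have "inv x \<otimes> u \<in> T" using rl_one_iff[of "inv x \<otimes> u"] x u by simp
    then have "is_refl (\<Phi> (x \<otimes> u))" using \<Phi>_T x u inv by simp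
    moreover have "\<Phi> (x \<otimes> u) = \<Phi> x * (g * \<Phi> ?z)"
    proof -
      have "\<Phi> (x \<otimes> u) = \<Phi> x * \<Phi> (w \<otimes> ?z)" using x u \<Phi>_mult u_eq by metis
      then show ?thesis using T_closed[OF zT] w_carrier \<Phi>_w by (simp only: \<Phi>_mult)
    qed
    ultimately show ?thesis by (simp add: mult.assoc)
  qed
  have bowtie: "u = v"
    if c: "{x, y, u, v} \<subseteq> carrier W" and l: "rl x = 1" "rl y = 1" "rl u = 2" "rl v = 2" and ne: "x \<noteq> y"
      and le: "prec x u" "prec y u" "prec x v" "prec y v" "prec u w" "prec v w" for x y u v
  proof -
    let ?z = "inv u \<otimes> w" and ?z' = "inv v \<otimes> w"
    let ?L = "filter (\<lambda>z. is_refl (\<Phi> x * g * z) \<and> is_refl (\<Phi> y * g * z)) H3_refls"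
    have T: "x \<in> T" "y \<in> T" "?z \<in> T" "?z' \<in> T" using rl_one_iff comp c l le by auto
    have "\<Phi> ?z \<in> set ?L" "\<Phi> ?z' \<in> set ?L" using below c l le \<Phi>_refl T by auto
    moreover have "length ?L \<le> 1"
      using assms \<Phi>_refl[OF T(1)] \<Phi>_refl[OF T(2)] \<Phi>_eqD[of x y] ne c by auto
    ultimately have "\<Phi> ?z = \<Phi> ?z'"
      by (cases ?L rule: list.exhaust) auto
    then have "?z = ?z'" using \<Phi>_eqD c w_carrier by simp
    then have "inv u = inv v" using c w_carrier by simp
    then show "u = v" using c by (metis inv_inv insert_subset)
  qed
  have "finite (set H3_elements)" by simp
  then have "finite (carrier W)" using \<Phi>_inj \<Phi>_image finite_image_iff by metis
  then have "finite S" using S_carrier by (meson finite_subset subsetI)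
  moreover have "\<exists>m\<in>S. prec m x \<and> prec m y \<and> (\<forall>n\<in>S. prec n x \<longrightarrow> prec n y \<longrightarrow> prec n m)"
    "\<exists>m\<in>S. prec x m \<and> prec y m \<and> (\<forall>n\<in>S. prec x n \<longrightarrow> prec y n \<longrightarrow> prec m n)"
    if "x \<in> S" "y \<in> S" for x y
  proof -
    have xy: "x \<in> carrier W" "prec x w" "y \<in> carrier W" "prec y w"
      using that by (simp_all add: S_def)
    note mj = rank3_meet_join[OF w_carrier rl_w bowtie xy, folded S_def]
    show "\<exists>m\<in>S. prec m x \<and> prec m y \<and> (\<forall>n\<in>S. prec n x \<longrightarrow> prec n y \<longrightarrow> prec n m)"
      using mj(2) .
    show "\<exists>m\<in>S. prec x m \<and> prec y m \<and> (\<forall>n\<in>S. prec x n \<longrightarrow> prec y n \<longrightarrow> prec m n)"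
      using mj(1) .
  qed
  ultimately show ?thesis by unfold_locales
qed

end

section \<open>The two interval groups\<close>

definition pos_rels :: "('a list \<times> 'a list) set \<Rightarrow> ('a gword \<times> 'a gword) set" where
  "pos_rels Q = (\<lambda>(l, r). (pos l, pos r)) ` Q"

lemma pos_relation:
  assumes "(xs, ys) \<in> Q" "set xs \<subseteq> S" "set ys \<subseteq> S"
  shows "list_prod (presented_group S (pos_rels Q)) (map (gen_class S (pos_rels Q)) xs)
       = list_prod (presented_group S (pos_rels Q)) (map (gen_class S (pos_rels Q)) ys)"
  using word_val_relation[of "pos xs" "pos ys" "pos_rels Q" S] assms
  by (force simp: pos_rels_def word_val_pos)

lemma (in group) pos_hom:
  assumes f: "f \<in> S \<rightarrow> carrier G"
    and rel: "\<forall>(xs, ys)\<in>Q. list_prod G (map f xs) = list_prod G (map f ys)"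
  shows "\<exists>E\<in>hom (presented_group S (pos_rels Q)) G. \<forall>x\<in>S. E (gen_class S (pos_rels Q) x) = f x"
proof -
  have "\<exists>E\<in>hom (presented_group S (pos_rels Q)) G.
      \<forall>u\<in>gwords S. E (word_class S (pos_rels Q) u) = word_val G f u"
  proof (rule presented_group_hom[OF f])
    show "word_val G f l = word_val G f r" if "(l, r) \<in> pos_rels Q" for l r
      using that rel by (auto simp: pos_rels_def word_val_pos)
  qed
  then obtain E where E: "E \<in> hom (presented_group S (pos_rels Q)) G"
    "\<And>u. u \<in> gwords S \<Longrightarrow> E (word_class S (pos_rels Q) u) = word_val G f u"
    by blast
  have "E (gen_class S (pos_rels Q) x) = f x" if "x \<in> S" for x
  proof -
    have "f x \<in> carrier G" using f that by blast
    then show ?thesis using E(2)[of "[(x, True)]"] that by simp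
  qed
  with E(1) show ?thesis by blast
qed

lemma five_cycle_interval:
  assumes ico: "icosahedral W R \<Phi>" and w: "w \<in> carrier W" "\<Phi> w = five_cycle"
  shows "interval_group W R w \<cong> artin_group_H3 \<and> lattice (interval_order W R w) \<and>
    garside_group (interval_group W R w)"
proof -
  interpret icosahedral W R \<Phi> by (rule ico)
  interpret orbit_representation W R \<Phi> w "five_cycle ^ 9" five_cycle 5 gens H3_triples
    by unfold_locales (use w five_cycle_data in auto)
  interpret lattice_interval W rl w
    by (rule lattice_intervalI[OF five_cycle_no_bowtie])
  define I :: "nat set" where "I = {1, 2, 3}"
  define Q :: "(nat list \<times> nat list) set" where
    "Q = {([1, 2, 1, 2, 1], [2, 1, 2, 1, 2]), ([2, 3, 2], [3, 2, 3]), ([1, 3], [3, 1])}"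
  define A where "A = presented_group I (pos_rels Q)"
  define gc where "gc = gen_class I (pos_rels Q)"
  interpret A: group A unfolding A_def by (rule group_presented_group)
  define a b c where "a = gc 1" and "b = gc 2" and "c = gc 3"
  have abc: "a \<in> carrier A" "b \<in> carrier A" "c \<in> carrier A"
    by (simp_all add: a_def b_def c_def gc_def A_def I_def)
  have pr: "list_prod A (map gc xs) = list_prod A (map gc ys)"
    if "(xs, ys) \<in> Q" "set (xs @ ys) \<subseteq> I" for xs ys
    unfolding A_def gc_def using that by (intro pos_relation) auto
  have rel1: "a \<otimes>\<^bsub>A\<^esub> (b \<otimes>\<^bsub>A\<^esub> (a \<otimes>\<^bsub>A\<^esub> (b \<otimes>\<^bsub>A\<^esub> a)))
      = b \<otimes>\<^bsub>A\<^esub> (a \<otimes>\<^bsub>A\<^esub> (b \<otimes>\<^bsub>A\<^esub> (a \<otimes>\<^bsub>A\<^esub> b)))"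
    using pr[of "[1, 2, 1, 2, 1]" "[2, 1, 2, 1, 2]"] abc unfolding a_def b_def c_def by (simp add: Q_def I_def)
  have rel2: "b \<otimes>\<^bsub>A\<^esub> (c \<otimes>\<^bsub>A\<^esub> b)
      = c \<otimes>\<^bsub>A\<^esub> (b \<otimes>\<^bsub>A\<^esub> c)"
    using pr[of "[2, 3, 2]" "[3, 2, 3]"] abc unfolding a_def b_def c_def by (simp add: Q_def I_def)
  have rel3: "a \<otimes>\<^bsub>A\<^esub> c
      = c \<otimes>\<^bsub>A\<^esub> a"
    using pr[of "[1, 3]" "[3, 1]"] abc unfolding a_def b_def c_def by (simp add: Q_def I_def)
  note T = A.artin_H3_triples_if_relations[OF abc rel1 rel2 rel3]
  let ?d = "a \<otimes>\<^bsub>A\<^esub> (c \<otimes>\<^bsub>A\<^esub> b)"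
  define x y z where "x = gh ! 0" and "y = gh ! 1" and "z = gh ! 2"
  have len: "length gens = 3" by (simp add: gens_def)
  have gh: "gh = [x, y, z]"
    using gh_props(1) by (auto simp: x_def y_def z_def len numeral_3_eq_3 length_Suc_conv)
  have xyz: "x \<in> carrier GG" "y \<in> carrier GG" "z \<in> carrier GG" using gh_props(2) gh by auto
  note G = GG.artin_H3_relations_if_triples[OF triples_GG[unfolded gh]]
  define f where "f i = (if i = 1 then x else if i = 2 then y else z)" for i :: nat
  have f: "f 1 = x" "f 2 = y" "f 3 = z" by (simp_all add: f_def)
  have "\<exists>E\<in>hom A GG. \<forall>i\<in>I. E (gc i) = f i"
    unfolding A_def gc_def
  proof (rule GG.pos_hom)
    show "f \<in> I \<rightarrow> carrier GG" using xyz by (auto simp: f_def)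
    show "\<forall>(xs, ys)\<in>Q. list_prod GG (map f xs) = list_prod GG (map f ys)"
      using G(1-3) xyz by (simp add: Q_def f[unfolded One_nat_def])
  qed
  then obtain E where E: "E \<in> hom A GG" "\<And>i. i \<in> I \<Longrightarrow> E (gc i) = f i" by blast
  have E_abc: "E a = x" "E b = y" "E c = z"
    using E(2) f by (simp_all add: a_def b_def c_def I_def)
  have "GG \<cong> A"
  proof (rule interval_group_iso[of ?d I "pos_rels Q" "[a, b, c]" E, folded A_def])
    show "?d \<in> carrier A" "set [a, b, c] \<subseteq> carrier A" using abc by simp_all
    show "length [a, b, c] = length gens" by (simp add: len)
    show "\<forall>k\<in>set [a, b, c]. (A.cnj ?d ^^ 5) k = k" using T(1) by simp
    show "\<forall>(p, q, r)\<in>set H3_triples.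
        A.tri ?d (A.orb ?d [a, b, c] p) (A.orb ?d [a, b, c] q) (A.orb ?d [a, b, c] r)"
      by (rule T(2))
    show "E \<in> hom A GG" by (rule E(1))
    show "E ([a, b, c] ! j) = gh ! j" if "j < length gens" for j
    proof -
      have "j = 0 \<or> j = 1 \<or> j = 2" using that len by linarith
      then show ?thesis using E_abc by (auto simp: gh)
    qed
    show "E ?d = cl [w]"
      using hom_mult[OF E(1)] abc E_abc G(4) by simp
    show "\<exists>j<length gens. gen_class I (pos_rels Q) i = [a, b, c] ! j" if "i \<in> I" for i
    proof -
      have "i = 1 \<or> i = 2 \<or> i = 3" using that by (simp add: I_def)
      then show ?thesis
        by (auto simp: len a_def b_def c_def gc_def intro: exI[of _ 0] exI[of _ 1] exI[of _ 2])
    qed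
  qed
  moreover have "A = artin_group_H3"
    by (simp add: A_def artin_group_H3_def pos_rels_def Q_def I_def)
  ultimately show ?thesis
    using lattice_interval_order garside interval_group_eq interval_order_eq by simp
qed

lemma three_cycle_interval:
  assumes ico: "icosahedral W R \<Phi>" and w: "w \<in> carrier W" "\<Phi> w = three_cycle"
  shows "interval_group W R w \<cong> H3_a2_group"
proof -
  interpret icosahedral W R \<Phi> by (rule ico)
  interpret orbit_representation W R \<Phi> w "three_cycle ^ 5" three_cycle 3 three_cycle_orbits H3_a2_triples
    by unfold_locales (use w three_cycle_data in auto)
  define I :: "nat set" where "I = {1, 2, 3}"
  define Q :: "(nat list \<times> nat list) set" where
    "Q = {([1, 2, 1], [2, 1, 2]), ([1, 3, 1], [3, 1, 3]),
     ([2, 3, 2, 3, 2], [3, 2, 3, 2, 3]), ([2, 3, 2, 1, 3, 2], [3, 2, 1, 3, 2, 3]),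
     ([3, 2, 1, 3, 2, 1, 3, 2, 1], [1, 3, 2, 1, 3, 2, 1, 3, 2])}"
  define A where "A = presented_group I (pos_rels Q)"
  define gc where "gc = gen_class I (pos_rels Q)"
  interpret A: group A unfolding A_def by (rule group_presented_group)
  define a b c where "a = gc 1" and "b = gc 2" and "c = gc 3"
  have abc: "a \<in> carrier A" "b \<in> carrier A" "c \<in> carrier A"
    by (simp_all add: a_def b_def c_def gc_def A_def I_def)
  have pr: "list_prod A (map gc xs) = list_prod A (map gc ys)"
    if "(xs, ys) \<in> Q" "set (xs @ ys) \<subseteq> I" for xs ys
    unfolding A_def gc_def using that by (intro pos_relation) auto
  have rel1: "a \<otimes>\<^bsub>A\<^esub> (b \<otimes>\<^bsub>A\<^esub> a)
      = b \<otimes>\<^bsub>A\<^esub> (a \<otimes>\<^bsub>A\<^esub> b)"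
    using pr[of "[1, 2, 1]" "[2, 1, 2]"] abc unfolding a_def b_def c_def by (simp add: Q_def I_def)
  have rel2: "a \<otimes>\<^bsub>A\<^esub> (c \<otimes>\<^bsub>A\<^esub> a)
      = c \<otimes>\<^bsub>A\<^esub> (a \<otimes>\<^bsub>A\<^esub> c)"
    using pr[of "[1, 3, 1]" "[3, 1, 3]"] abc unfolding a_def b_def c_def by (simp add: Q_def I_def)
  have rel3: "b \<otimes>\<^bsub>A\<^esub> (c \<otimes>\<^bsub>A\<^esub> (b \<otimes>\<^bsub>A\<^esub> (c \<otimes>\<^bsub>A\<^esub> b)))
      = c \<otimes>\<^bsub>A\<^esub> (b \<otimes>\<^bsub>A\<^esub> (c \<otimes>\<^bsub>A\<^esub> (b \<otimes>\<^bsub>A\<^esub> c)))"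
    using pr[of "[2, 3, 2, 3, 2]" "[3, 2, 3, 2, 3]"] abc unfolding a_def b_def c_def by (simp add: Q_def I_def)
  have rel4: "b \<otimes>\<^bsub>A\<^esub> (c \<otimes>\<^bsub>A\<^esub> (b \<otimes>\<^bsub>A\<^esub> (a \<otimes>\<^bsub>A\<^esub> (c \<otimes>\<^bsub>A\<^esub> b))))
      = c \<otimes>\<^bsub>A\<^esub> (b \<otimes>\<^bsub>A\<^esub> (a \<otimes>\<^bsub>A\<^esub> (c \<otimes>\<^bsub>A\<^esub> (b \<otimes>\<^bsub>A\<^esub> c))))"
    using pr[of "[2, 3, 2, 1, 3, 2]" "[3, 2, 1, 3, 2, 3]"] abc unfolding a_def b_def c_def by (simp add: Q_def I_def)
  have rel5: "c \<otimes>\<^bsub>A\<^esub> (b \<otimes>\<^bsub>A\<^esub> (a \<otimes>\<^bsub>A\<^esub> (c \<otimes>\<^bsub>A\<^esub> (b \<otimes>\<^bsub>A\<^esub> (a \<otimes>\<^bsub>A\<^esub> (c \<otimes>\<^bsub>A\<^esub> (b \<otimes>\<^bsub>A\<^esub> a)))))))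
      = a \<otimes>\<^bsub>A\<^esub> (c \<otimes>\<^bsub>A\<^esub> (b \<otimes>\<^bsub>A\<^esub> (a \<otimes>\<^bsub>A\<^esub> (c \<otimes>\<^bsub>A\<^esub> (b \<otimes>\<^bsub>A\<^esub> (a \<otimes>\<^bsub>A\<^esub> (c \<otimes>\<^bsub>A\<^esub> b)))))))"
    using pr[of "[3, 2, 1, 3, 2, 1, 3, 2, 1]" "[1, 3, 2, 1, 3, 2, 1, 3, 2]"] abc unfolding a_def b_def c_def by (simp add: Q_def I_def)
  note T = A.H3_a2_triples_if_relations[OF abc rel1 rel2 rel3 rel4 rel5]
  let ?d = "c \<otimes>\<^bsub>A\<^esub> (b \<otimes>\<^bsub>A\<^esub> a)"
  define D where "D = inv\<^bsub>A\<^esub> b \<otimes>\<^bsub>A\<^esub> (c \<otimes>\<^bsub>A\<^esub> b)"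
  define F where "F = c \<otimes>\<^bsub>A\<^esub> (b \<otimes>\<^bsub>A\<^esub> inv\<^bsub>A\<^esub> c)"
  define x y z s t where "x = gh ! 0" and "y = gh ! 1" and "z = gh ! 2" and "s = gh ! 3" and "t = gh ! 4"
  have len: "length three_cycle_orbits = 5" by (simp add: three_cycle_orbits_def three_cycle_gens_def)
  have gh: "gh = [x, y, z, s, t]"
    using gh_props(1)
    by (auto simp: x_def y_def z_def s_def t_def len eval_nat_numeral length_Suc_conv)
  have xyz: "x \<in> carrier GG" "y \<in> carrier GG" "z \<in> carrier GG" using gh_props(2) gh by auto
  have x3: "(GG.cnj (cl [w]) ^^ 3) x = x" using gh_periodic[of 0] by (simp add: len gh)
  note G = GG.H3_a2_relations_if_triples[OF triples_GG[unfolded gh] x3]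
  define f where "f i = (if i = 1 then x else if i = 2 then y else z)" for i :: nat
  have f: "f 1 = x" "f 2 = y" "f 3 = z" by (simp_all add: f_def)
  have "\<exists>E\<in>hom A GG. \<forall>i\<in>I. E (gc i) = f i"
    unfolding A_def gc_def
  proof (rule GG.pos_hom)
    show "f \<in> I \<rightarrow> carrier GG" using xyz by (auto simp: f_def)
    show "\<forall>(xs, ys)\<in>Q. list_prod GG (map f xs) = list_prod GG (map f ys)"
      using G(1-5) xyz by (simp add: Q_def f[unfolded One_nat_def])
  qed
  then obtain E where E: "E \<in> hom A GG" "\<And>i. i \<in> I \<Longrightarrow> E (gc i) = f i" by blast
  have E_abc: "E a = x" "E b = y" "E c = z"
    using E(2) f by (simp_all add: a_def b_def c_def I_def)
  interpret E: group_hom A GG E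
    using E(1) by (simp add: group_hom_def group_hom_axioms_def)
  have E_DF: "E D = s" "E F = t" using abc E_abc G(7,8) by (simp_all add: D_def F_def)
  have "GG \<cong> A"
  proof (rule interval_group_iso[of ?d I "pos_rels Q" "[a, b, c, D, F]" E, folded A_def])
    show "?d \<in> carrier A" "set [a, b, c, D, F] \<subseteq> carrier A" using abc by (simp_all add: D_def F_def)
    show "length [a, b, c, D, F] = length three_cycle_orbits" by (simp add: len)
    show "\<forall>k\<in>set [a, b, c, D, F]. (A.cnj ?d ^^ 3) k = k"
      unfolding D_def F_def by (rule T(1))
    show "\<forall>(p, q, r)\<in>set H3_a2_triples. A.tri ?d (A.orb ?d [a, b, c, D, F] p)
        (A.orb ?d [a, b, c, D, F] q) (A.orb ?d [a, b, c, D, F] r)"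
      unfolding D_def F_def by (rule T(2))
    show "E \<in> hom A GG" by (rule E(1))
    show "E ([a, b, c, D, F] ! j) = gh ! j" if "j < length three_cycle_orbits" for j
    proof -
      have "j = 0 \<or> j = 1 \<or> j = 2 \<or> j = 3 \<or> j = 4" using that len by linarith
      then show ?thesis using E_abc E_DF by (auto simp: gh)
    qed
    show "E ?d = cl [w]" using abc E_abc G(6) by simp
    show "\<exists>j<length three_cycle_orbits. gen_class I (pos_rels Q) i = [a, b, c, D, F] ! j"
      if "i \<in> I" for i
    proof -
      have "i = 1 \<or> i = 2 \<or> i = 3" using that by (simp add: I_def)
      then show ?thesis
        by (auto simp: len a_def b_def c_def gc_def intro: exI[of _ 0] exI[of _ 1] exI[of _ 2])
    qed
  qed
  moreover have "A = H3_a2_group"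
    by (simp add: A_def H3_a2_group_def pos_rels_def Q_def I_def)
  ultimately show ?thesis using interval_group_eq by simp
qed

theorem theorem2p22:
  fixes W :: "('a, 'm) monoid_scheme" and R :: "'a set" and w :: 'a
  assumes "coxeter_system W R" and "type_H3 W R" and "w \<in> H3_a1 W R"
  shows "interval_group W R w \<cong> artin_group_H3 \<and>
         lattice (interval_order W R w) \<and>
         garside_group (interval_group W R w)"
proof -
  obtain \<Phi> where "icosahedral W R \<Phi>" using H3_representation assms by blast
  then interpret icosahedral W R \<Phi> .
  have w: "proper_quasi_coxeter W R w" "w \<notin> H3_a2 W R"
    using assms(3) by (auto simp: H3_a1_def)
  then have "quasi_coxeter W R w" by (simp add: proper_quasi_coxeter_def)
  note image = quasi_coxeter_image[OF this]
  obtain \<Psi> where \<Psi>: "icosahedral W R \<Psi>" "\<Psi> w = five_cycle \<or> \<Psi> w = three_cycle"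
    using normal_form[OF image] by blast
  have "\<Psi> w \<noteq> three_cycle"
    using three_cycle_interval[OF \<Psi>(1) image(1)] w by (auto simp: H3_a2_def)
  then show ?thesis
    using five_cycle_interval[OF \<Psi>(1) image(1)] \<Psi>(2) by blast
qed

end
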